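(* Work in $\mathbf{CZF}$ and assume NID. Then for any two set-presented formal spaces $(\mathbb P,\le,\triangleleft)$ and $(\mathbb Q,\le',\triangleleft')$, the class of morphisms of formal spaces from the first to the second is set-generated (as a class of subsets of $\mathbb P\times\mathbb Q$).
   Context: A formal space consists of a set $\mathbb P$ with a preorder $\le$ and a class relation $\triangleleft$ between elements and subsets of $\mathbb P$ such that: $a\in U$ implies $a\triangleleft U$; if $a\triangleleft U$ and $u\triangleleft V$ for all $u\in U$ then $a\triangleleft V$; if $a\le b\triangleleft U$ then $a\triangleleft U$; if $a\triangleleft U$ and $a\triangleleft V$ then $a\triangleleft{\downarrow}U\cap{\downarrow}V$ (${\downarrow}U=\{c:\exists u\in U\,c\le u\}$). It is set-presented if there is a function $\mathrm{BCov}$ assigning to each $a$ a set $\mathrm{BCov}(a)$ of subsets such that $a\triangleleft U$ iff $S\subseteq U$ for some $S\in\mathrm{BCov}(a)$. A morphism $F:(\mathbb P,\le,\triangleleft)\to(\mathbb Q,\le',\triangleleft')$ is a relation $F\subseteq\mathbb P\times\mathbb Q$ such that: (1) if $F(p,q)$, $p'\le p$ and $q\le' q'$ then $F(p',q')$; (2) for every $q$, the set $\{p:F(p,q)\}$ is closed under covering: if $p\triangleleft U$ and $U\subseteq\{p':F(p',q)\}$ then $F(p,q)$; (3) for every $p$ there is $S$ with $p\triangleleft S$ such that each $p'\in S$ is $F$-related to some $q'\in\mathbb Q$; (4) for all $q_0,q_1\in\mathbb Q$ and $p$ with $F(p,q_0)$, $F(p,q_1)$ there is $S$ with $p\triangleleft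 S$ such that every $p'\in S$ is $F$-related to some $q'$ with $q'\le' q_0$ and $q'\le' q_1$; (5) whenever $F(p,q)$ and $q\triangleleft' T$ there is a downward closed $S\subseteq\mathbb P$ with $p\triangleleft S$ such that every $p'\in S$ is $F$-related to some $q'\in T$. A class $\mathcal C$ of subsets of a set $X$ is set-generated if there is a set $G\subseteq\mathcal C$ with $\forall\alpha\in\mathcal C\,\forall x\in\alpha\,\exists\beta\in G\,x\in\beta\subseteq\alpha$. NID: for every set $X$ and set $\mathcal R$ of rules on $X$ (pairs $(a,b)$ of subsets), the class of $Y\subseteq X$ closed under all rules ($a\subseteq Y$ implies $b\cap Y$ inhabited) is set-generated. *)

theory Defs
  imports Main
begin

section \<open>First-order intuitionistic logic with equality, in the language of set theory\<close>

text \<open>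
  Formulas use de Bruijn indices; variables are the only terms, so that a substitution is
  a renaming of variables.
\<close>

datatype fm =
    Falsum
  | Mem nat nat
  | Eq nat nat
  | Conj fm fm
  | Disj fm fm
  | Impl fm fm
  | Forall fm
  | Exists fm

definition up :: "(nat \<Rightarrow> nat) \<Rightarrow> nat \<Rightarrow> nat" where
  "up r = case_nat 0 (\<lambda>i. Suc (r i))"

primrec ren :: "(nat \<Rightarrow> nat) \<Rightarrow> fm \<Rightarrow> fm" where
  "ren r Falsum = Falsum"
| "ren r (Mem i j) = Mem (r i) (r j)"
| "ren r (Eq i j) = Eq (r i) (r j)"
| "ren r (Conj A B) = Conj (ren r A) (ren r B)"
| "ren r (Disj A B) = Disj (ren r A) (ren r B)"
| "ren r (Impl A B) = Impl (ren r A) (ren r B)"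
| "ren r (Forall A) = Forall (ren (up r) A)"
| "ren r (Exists A) = Exists (ren (up r) A)"

definition inst :: "fm \<Rightarrow> nat \<Rightarrow> fm" where
  "inst A i = ren (case_nat i (\<lambda>j. j)) A"

text \<open>
  Natural deduction from a set \<open>T\<close> of axioms and a set \<open>H\<close> of local hypotheses. Free
  variables of the axioms are read as universally quantified (in \<open>AllI\<close> the eigenvariable
  condition, expressed by \<open>ren Suc\<close>, concerns only \<open>H\<close>), and so are free variables of a
  formula derived from the empty set of hypotheses.
\<close>

inductive deriv :: "fm set \<Rightarrow> fm set \<Rightarrow> fm \<Rightarrow> bool" for T :: "fm set" where
  Ax: "A \<in> T \<Longrightarrow> deriv T H A"
| Hyp: "A \<in> H \<Longrightarrow> deriv T H A"
| FalsumE: "deriv T H Falsum \<Longrightarrow> deriv T H A"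
| ConjI: "deriv T H A \<Longrightarrow> deriv T H B \<Longrightarrow> deriv T H (Conj A B)"
| ConjE1: "deriv T H (Conj A B) \<Longrightarrow> deriv T H A"
| ConjE2: "deriv T H (Conj A B) \<Longrightarrow> deriv T H B"
| DisjI1: "deriv T H A \<Longrightarrow> deriv T H (Disj A B)"
| DisjI2: "deriv T H B \<Longrightarrow> deriv T H (Disj A B)"
| DisjE: "deriv T H (Disj A B) \<Longrightarrow> deriv T (insert A H) C \<Longrightarrow> deriv T (insert B H) C
    \<Longrightarrow> deriv T H C"
| ImplI: "deriv T (insert A H) B \<Longrightarrow> deriv T H (Impl A B)"
| ImplE: "deriv T H (Impl A B) \<Longrightarrow> deriv T H A \<Longrightarrow> deriv T H B"
| AllI: "deriv T (ren Suc ` H) A \<Longrightarrow> deriv T H (Forall A)"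
| AllE: "deriv T H (Forall A) \<Longrightarrow> deriv T H (inst A i)"
| ExI: "deriv T H (inst A i) \<Longrightarrow> deriv T H (Exists A)"
| ExE: "deriv T H (Exists A) \<Longrightarrow> deriv T (insert A (ren Suc ` H)) (ren Suc B) \<Longrightarrow> deriv T H B"
| EqRefl: "deriv T H (Eq i i)"
| EqSubst: "deriv T H (Eq i j) \<Longrightarrow> deriv T H (inst A i) \<Longrightarrow> deriv T H (inst A j)"

abbreviation provable :: "fm set \<Rightarrow> fm \<Rightarrow> bool" (infix "\<turnstile>" 5) where
  "T \<turnstile> A \<equiv> deriv T {} A"

text \<open>In a bounded quantification the bounding variable is not the bound one, hence \<open>Suc j\<close>.\<close>

inductive bounded_fm :: "fm \<Rightarrow> bool" where
  "bounded_fm Falsum"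
| "bounded_fm (Mem i j)"
| "bounded_fm (Eq i j)"
| "bounded_fm A \<Longrightarrow> bounded_fm B \<Longrightarrow> bounded_fm (Conj A B)"
| "bounded_fm A \<Longrightarrow> bounded_fm B \<Longrightarrow> bounded_fm (Disj A B)"
| "bounded_fm A \<Longrightarrow> bounded_fm B \<Longrightarrow> bounded_fm (Impl A B)"
| "bounded_fm A \<Longrightarrow> bounded_fm (Forall (Impl (Mem 0 (Suc j)) A))"
| "bounded_fm A \<Longrightarrow> bounded_fm (Exists (Conj (Mem 0 (Suc j)) A))"


section \<open>Notation with named bound variables\<close>

text \<open>
  To write concrete formulas with named variables, a formula under construction is a function
  of the number \<open>n\<close> of binders above it, and so is a variable: a variable bound by a quantifier
  below exactly \<open>n\<close> binders has, at depth \<open>m > n\<close>, the index \<open>m - Suc n\<close>. Applying the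
  construction to \<open>0\<close> gives the formula itself.
\<close>

type_synonym var = "nat \<Rightarrow> nat"
type_synonym form = "nat \<Rightarrow> fm"

definition fFalse :: form ("\<^bold>\<bottom>") where
  "\<^bold>\<bottom> = (\<lambda>n. Falsum)"
definition fMem :: "var \<Rightarrow> var \<Rightarrow> form" (infix "\<^bold>\<in>" 50) where
  "(x \<^bold>\<in> y) = (\<lambda>n. Mem (x n) (y n))"
definition fEq :: "var \<Rightarrow> var \<Rightarrow> form" (infix "\<^bold>=" 50) where
  "(x \<^bold>= y) = (\<lambda>n. Eq (x n) (y n))"
definition fConj :: "form \<Rightarrow> form \<Rightarrow> form" (infixr "\<^bold>\<and>" 35) where
  "(A \<^bold>\<and> B) = (\<lambda>n. Conj (A n) (B n))"
definition fDisj :: "form \<Rightarrow> form \<Rightarrow> form" (infixr "\<^bold>\<or>" 30) where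
  "(A \<^bold>\<or> B) = (\<lambda>n. Disj (A n) (B n))"
definition fImpl :: "form \<Rightarrow> form \<Rightarrow> form" (infixr "\<^bold>\<longrightarrow>" 25) where
  "(A \<^bold>\<longrightarrow> B) = (\<lambda>n. Impl (A n) (B n))"
definition fIff :: "form \<Rightarrow> form \<Rightarrow> form" (infixr "\<^bold>\<longleftrightarrow>" 25) where
  "(A \<^bold>\<longleftrightarrow> B) = ((A \<^bold>\<longrightarrow> B) \<^bold>\<and> (B \<^bold>\<longrightarrow> A))"
definition fAll :: "(var \<Rightarrow> form) \<Rightarrow> form" (binder "\<^bold>\<forall>" 10) where
  "fAll A = (\<lambda>n. Forall (A (\<lambda>m. m - Suc n) (Suc n)))"
definition fEx :: "(var \<Rightarrow> form) \<Rightarrow> form" (binder "\<^bold>\<exists>" 10) where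
  "fEx A = (\<lambda>n. Exists (A (\<lambda>m. m - Suc n) (Suc n)))"

definition fBall :: "var \<Rightarrow> (var \<Rightarrow> form) \<Rightarrow> form" where
  "fBall a A = (\<^bold>\<forall>x. x \<^bold>\<in> a \<^bold>\<longrightarrow> A x)"
definition fBex :: "var \<Rightarrow> (var \<Rightarrow> form) \<Rightarrow> form" where
  "fBex a A = (\<^bold>\<exists>x. x \<^bold>\<in> a \<^bold>\<and> A x)"
definition fSub :: "var \<Rightarrow> var \<Rightarrow> form" (infix "\<^bold>\<subseteq>" 50) where
  "(a \<^bold>\<subseteq> b) = (\<^bold>\<forall>x. x \<^bold>\<in> a \<^bold>\<longrightarrow> x \<^bold>\<in> b)"
definition fAllSub :: "var \<Rightarrow> (var \<Rightarrow> form) \<Rightarrow> form" where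
  "fAllSub a A = (\<^bold>\<forall>x. x \<^bold>\<subseteq> a \<^bold>\<longrightarrow> A x)"
definition fExSub :: "var \<Rightarrow> (var \<Rightarrow> form) \<Rightarrow> form" where
  "fExSub a A = (\<^bold>\<exists>x. x \<^bold>\<subseteq> a \<^bold>\<and> A x)"

syntax
  "_fBall" :: "pttrn \<Rightarrow> var \<Rightarrow> form \<Rightarrow> form" ("(3\<^bold>\<forall>_\<^bold>\<in>_./ _)" [0, 51, 10] 10)
  "_fBex" :: "pttrn \<Rightarrow> var \<Rightarrow> form \<Rightarrow> form" ("(3\<^bold>\<exists>_\<^bold>\<in>_./ _)" [0, 51, 10] 10)
  "_fAllSub" :: "pttrn \<Rightarrow> var \<Rightarrow> form \<Rightarrow> form" ("(3\<^bold>\<forall>_\<^bold>\<subseteq>_./ _)" [0, 51, 10] 10)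
  "_fExSub" :: "pttrn \<Rightarrow> var \<Rightarrow> form \<Rightarrow> form" ("(3\<^bold>\<exists>_\<^bold>\<subseteq>_./ _)" [0, 51, 10] 10)
translations
  "\<^bold>\<forall>x\<^bold>\<in>a. A" \<rightleftharpoons> "CONST fBall a (\<lambda>x. A)"
  "\<^bold>\<exists>x\<^bold>\<in>a. A" \<rightleftharpoons> "CONST fBex a (\<lambda>x. A)"
  "\<^bold>\<forall>x\<^bold>\<subseteq>a. A" \<rightleftharpoons> "CONST fAllSub a (\<lambda>x. A)"
  "\<^bold>\<exists>x\<^bold>\<subseteq>a. A" \<rightleftharpoons> "CONST fExSub a (\<lambda>x. A)"

text \<open>
  An arbitrary formula \<open>A\<close> with \<open>length xs\<close> distinguished variables (the indices below
  \<open>length xs\<close>), applied to the variables \<open>xs\<close>. The other variables of \<open>A\<close> are parameters: they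
  are never captured and stay free in the formula that is built.
\<close>

definition app :: "fm \<Rightarrow> var list \<Rightarrow> form" where
  "app A xs = (\<lambda>n. ren (\<lambda>i. if i < length xs then (xs ! i) n else i - length xs + n) A)"

definition class_rel :: "fm \<Rightarrow> var \<Rightarrow> var \<Rightarrow> form" where
  "class_rel A x y = app A [x, y]"


section \<open>The theory CZF\<close>

definition extensionality :: fm where
  "extensionality = (\<^bold>\<forall>a b. (\<^bold>\<forall>x. x \<^bold>\<in> a \<^bold>\<longleftrightarrow> x \<^bold>\<in> b) \<^bold>\<longrightarrow> a \<^bold>= b) 0"

definition pairing :: fm where
  "pairing = (\<^bold>\<forall>a b. \<^bold>\<exists>c. \<^bold>\<forall>x. x \<^bold>\<in> c \<^bold>\<longleftrightarrow> x \<^bold>= a \<^bold>\<or> x \<^bold>= b) 0"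

definition union_ax :: fm where
  "union_ax = (\<^bold>\<forall>a. \<^bold>\<exists>b. \<^bold>\<forall>x. x \<^bold>\<in> b \<^bold>\<longleftrightarrow> (\<^bold>\<exists>y\<^bold>\<in>a. x \<^bold>\<in> y)) 0"

definition is_inductive :: "var \<Rightarrow> form" where
  "is_inductive a =
    ((\<^bold>\<exists>y\<^bold>\<in>a. \<^bold>\<forall>z\<^bold>\<in>y. \<^bold>\<bottom>) \<^bold>\<and>
     (\<^bold>\<forall>x\<^bold>\<in>a. \<^bold>\<exists>y\<^bold>\<in>a. \<^bold>\<forall>z. z \<^bold>\<in> y \<^bold>\<longleftrightarrow> z \<^bold>\<in> x \<^bold>\<or> z \<^bold>= x))"

definition strong_infinity :: fm where
  "strong_infinity =
    (\<^bold>\<exists>a. is_inductive a \<^bold>\<and> (\<^bold>\<forall>b. is_inductive b \<^bold>\<longrightarrow> a \<^bold>\<subseteq> b)) 0"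

definition set_induction :: "fm \<Rightarrow> fm" where
  "set_induction A =
    ((\<^bold>\<forall>a. (\<^bold>\<forall>x\<^bold>\<in>a. app A [x]) \<^bold>\<longrightarrow> app A [a]) \<^bold>\<longrightarrow> (\<^bold>\<forall>a. app A [a])) 0"

definition separation :: "fm \<Rightarrow> fm" where
  "separation A = (\<^bold>\<forall>a. \<^bold>\<exists>b. \<^bold>\<forall>x. x \<^bold>\<in> b \<^bold>\<longleftrightarrow> x \<^bold>\<in> a \<^bold>\<and> app A [x]) 0"

definition strong_collection :: "fm \<Rightarrow> fm" where
  "strong_collection A =
    (\<^bold>\<forall>a. (\<^bold>\<forall>x\<^bold>\<in>a. \<^bold>\<exists>y. app A [x, y]) \<^bold>\<longrightarrow>
      (\<^bold>\<exists>b. (\<^bold>\<forall>x\<^bold>\<in>a. \<^bold>\<exists>y\<^bold>\<in>b. app A [x, y]) \<^bold>\<and> (\<^bold>\<forall>y\<^bold>\<in>b. \<^bold>\<exists>x\<^bold>\<in>a. app A [x, y]))) 0"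

definition subset_collection :: "fm \<Rightarrow> fm" where
  "subset_collection A =
    (\<^bold>\<forall>a b. \<^bold>\<exists>c. \<^bold>\<forall>u. (\<^bold>\<forall>x\<^bold>\<in>a. \<^bold>\<exists>y\<^bold>\<in>b. app A [x, y, u]) \<^bold>\<longrightarrow>
      (\<^bold>\<exists>d\<^bold>\<in>c. (\<^bold>\<forall>x\<^bold>\<in>a. \<^bold>\<exists>y\<^bold>\<in>d. app A [x, y, u]) \<^bold>\<and>
             (\<^bold>\<forall>y\<^bold>\<in>d. \<^bold>\<exists>x\<^bold>\<in>a. app A [x, y, u]))) 0"

definition CZF :: "fm set" where
  "CZF =
    {extensionality, pairing, union_ax, strong_infinity}
    \<union> range set_induction
    \<union> separation ` {A. bounded_fm A}
    \<union> range strong_collection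
    \<union> range subset_collection"


section \<open>Pairs and relations as sets\<close>

definition is_upair :: "var \<Rightarrow> var \<Rightarrow> var \<Rightarrow> form" where
  "is_upair c a b = (\<^bold>\<forall>x. x \<^bold>\<in> c \<^bold>\<longleftrightarrow> x \<^bold>= a \<^bold>\<or> x \<^bold>= b)"

text \<open>Kuratowski pairs: \<open>c = {{a}, {a, b}}\<close>.\<close>

definition is_pair :: "var \<Rightarrow> var \<Rightarrow> var \<Rightarrow> form" where
  "is_pair c a b = (\<^bold>\<forall>x. x \<^bold>\<in> c \<^bold>\<longleftrightarrow> is_upair x a a \<^bold>\<or> is_upair x a b)"

definition rel :: "var \<Rightarrow> var \<Rightarrow> var \<Rightarrow> form" where
  "rel r a b = (\<^bold>\<exists>c\<^bold>\<in>r. is_pair c a b)"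

definition is_relation :: "var \<Rightarrow> var \<Rightarrow> var \<Rightarrow> form" where
  "is_relation r X Y = (\<^bold>\<forall>c\<^bold>\<in>r. \<^bold>\<exists>a\<^bold>\<in>X. \<^bold>\<exists>b\<^bold>\<in>Y. is_pair c a b)"

definition is_function_on :: "var \<Rightarrow> var \<Rightarrow> form" where
  "is_function_on f X =
    ((\<^bold>\<forall>c\<^bold>\<in>f. \<^bold>\<exists>a\<^bold>\<in>X. \<^bold>\<exists>b. is_pair c a b) \<^bold>\<and>
     (\<^bold>\<forall>a\<^bold>\<in>X. \<^bold>\<exists>b. rel f a b \<^bold>\<and> (\<^bold>\<forall>b'. rel f a b' \<^bold>\<longrightarrow> b' \<^bold>= b)))"


section \<open>Set-generated classes and the principle NID\<close>

definition set_generated :: "(var \<Rightarrow> form) \<Rightarrow> form" where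
  "set_generated C =
    (\<^bold>\<exists>G. (\<^bold>\<forall>\<beta>\<^bold>\<in>G. C \<beta>) \<^bold>\<and>
         (\<^bold>\<forall>\<alpha>. C \<alpha> \<^bold>\<longrightarrow> (\<^bold>\<forall>x\<^bold>\<in>\<alpha>. \<^bold>\<exists>\<beta>\<^bold>\<in>G. x \<^bold>\<in> \<beta> \<^bold>\<and> \<beta> \<^bold>\<subseteq> \<alpha>)))"

definition rule_set :: "var \<Rightarrow> var \<Rightarrow> form" where
  "rule_set X R = (\<^bold>\<forall>r\<^bold>\<in>R. \<^bold>\<exists>a\<^bold>\<subseteq>X. \<^bold>\<exists>b\<^bold>\<subseteq>X. is_pair r a b)"

definition closed_under :: "var \<Rightarrow> var \<Rightarrow> form" where
  "closed_under R Y = (\<^bold>\<forall>a b. rel R a b \<^bold>\<longrightarrow> a \<^bold>\<subseteq> Y \<^bold>\<longrightarrow> (\<^bold>\<exists>x. x \<^bold>\<in> b \<^bold>\<and> x \<^bold>\<in> Y))"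

definition NID :: fm where
  "NID = (\<^bold>\<forall>X R. rule_set X R \<^bold>\<longrightarrow> set_generated (\<lambda>Y. Y \<^bold>\<subseteq> X \<^bold>\<and> closed_under R Y)) 0"


section \<open>Formal spaces\<close>

text \<open>
  The preorder is a set of pairs, whereas the cover \<open>cov\<close> is a class relation, that is, a formula
  with two distinguished variables.
\<close>

definition is_preorder :: "var \<Rightarrow> var \<Rightarrow> form" where
  "is_preorder P le =
    (is_relation le P P \<^bold>\<and>
     (\<^bold>\<forall>a\<^bold>\<in>P. rel le a a) \<^bold>\<and>
     (\<^bold>\<forall>a\<^bold>\<in>P. \<^bold>\<forall>b\<^bold>\<in>P. \<^bold>\<forall>c\<^bold>\<in>P. rel le a b \<^bold>\<and> rel le b c \<^bold>\<longrightarrow> rel le a c))"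

definition in_down :: "var \<Rightarrow> var \<Rightarrow> var \<Rightarrow> var \<Rightarrow> form" where
  "in_down P le U c = (c \<^bold>\<in> P \<^bold>\<and> (\<^bold>\<exists>u\<^bold>\<in>U. rel le c u))"

definition formal_space :: "var \<Rightarrow> var \<Rightarrow> (var \<Rightarrow> var \<Rightarrow> form) \<Rightarrow> form" where
  "formal_space P le cov =
    (is_preorder P le \<^bold>\<and>
     (\<^bold>\<forall>a\<^bold>\<in>P. \<^bold>\<forall>U\<^bold>\<subseteq>P. a \<^bold>\<in> U \<^bold>\<longrightarrow> cov a U) \<^bold>\<and>
     (\<^bold>\<forall>a\<^bold>\<in>P. \<^bold>\<forall>U\<^bold>\<subseteq>P. \<^bold>\<forall>V\<^bold>\<subseteq>P. cov a U \<^bold>\<and> (\<^bold>\<forall>u\<^bold>\<in>U. cov u V) \<^bold>\<longrightarrow> cov a V) \<^bold>\<and>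
     (\<^bold>\<forall>a\<^bold>\<in>P. \<^bold>\<forall>b\<^bold>\<in>P. \<^bold>\<forall>U\<^bold>\<subseteq>P. rel le a b \<^bold>\<and> cov b U \<^bold>\<longrightarrow> cov a U) \<^bold>\<and>
     (\<^bold>\<forall>a\<^bold>\<in>P. \<^bold>\<forall>U\<^bold>\<subseteq>P. \<^bold>\<forall>V\<^bold>\<subseteq>P. cov a U \<^bold>\<and> cov a V \<^bold>\<longrightarrow>
        (\<^bold>\<exists>W. (\<^bold>\<forall>c. c \<^bold>\<in> W \<^bold>\<longleftrightarrow> in_down P le U c \<^bold>\<and> in_down P le V c) \<^bold>\<and> cov a W)))"

definition set_presented :: "var \<Rightarrow> (var \<Rightarrow> var \<Rightarrow> form) \<Rightarrow> form" where
  "set_presented P cov =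
    (\<^bold>\<exists>BCov. is_function_on BCov P \<^bold>\<and>
       (\<^bold>\<forall>a\<^bold>\<in>P. \<^bold>\<forall>B. rel BCov a B \<^bold>\<longrightarrow>
          (\<^bold>\<forall>S\<^bold>\<in>B. S \<^bold>\<subseteq> P) \<^bold>\<and>
          (\<^bold>\<forall>U\<^bold>\<subseteq>P. cov a U \<^bold>\<longleftrightarrow> (\<^bold>\<exists>S\<^bold>\<in>B. S \<^bold>\<subseteq> U))))"

definition morphism ::
  "var \<Rightarrow> var \<Rightarrow> (var \<Rightarrow> var \<Rightarrow> form) \<Rightarrow> var \<Rightarrow> var \<Rightarrow> (var \<Rightarrow> var \<Rightarrow> form) \<Rightarrow> var \<Rightarrow> form" where
  "morphism P le cov Q le' cov' F =
    (is_relation F P Q \<^bold>\<and>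
     (\<^bold>\<forall>p\<^bold>\<in>P. \<^bold>\<forall>p'\<^bold>\<in>P. \<^bold>\<forall>q\<^bold>\<in>Q. \<^bold>\<forall>q'\<^bold>\<in>Q.
        rel F p q \<^bold>\<and> rel le p' p \<^bold>\<and> rel le' q q' \<^bold>\<longrightarrow> rel F p' q') \<^bold>\<and>
     (\<^bold>\<forall>q\<^bold>\<in>Q. \<^bold>\<forall>p\<^bold>\<in>P. \<^bold>\<forall>U\<^bold>\<subseteq>P. cov p U \<^bold>\<and> (\<^bold>\<forall>u\<^bold>\<in>U. rel F u q) \<^bold>\<longrightarrow> rel F p q) \<^bold>\<and>
     (\<^bold>\<forall>p\<^bold>\<in>P. \<^bold>\<exists>S\<^bold>\<subseteq>P. cov p S \<^bold>\<and> (\<^bold>\<forall>p'\<^bold>\<in>S. \<^bold>\<exists>q'\<^bold>\<in>Q. rel F p' q')) \<^bold>\<and>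
     (\<^bold>\<forall>q0\<^bold>\<in>Q. \<^bold>\<forall>q1\<^bold>\<in>Q. \<^bold>\<forall>p\<^bold>\<in>P. rel F p q0 \<^bold>\<and> rel F p q1 \<^bold>\<longrightarrow>
        (\<^bold>\<exists>S\<^bold>\<subseteq>P. cov p S \<^bold>\<and>
           (\<^bold>\<forall>p'\<^bold>\<in>S. \<^bold>\<exists>q'\<^bold>\<in>Q. rel F p' q' \<^bold>\<and> rel le' q' q0 \<^bold>\<and> rel le' q' q1))) \<^bold>\<and>
     (\<^bold>\<forall>p\<^bold>\<in>P. \<^bold>\<forall>q\<^bold>\<in>Q. \<^bold>\<forall>T\<^bold>\<subseteq>Q. rel F p q \<^bold>\<and> cov' q T \<^bold>\<longrightarrow>
        (\<^bold>\<exists>S\<^bold>\<subseteq>P. (\<^bold>\<forall>s\<^bold>\<in>S. \<^bold>\<forall>c\<^bold>\<in>P. rel le c s \<^bold>\<longrightarrow> c \<^bold>\<in> S) \<^bold>\<and> cov p S \<^bold>\<and>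
           (\<^bold>\<forall>p'\<^bold>\<in>S. \<^bold>\<exists>q'\<^bold>\<in>T. rel F p' q'))))"

end

theory Submission
  imports Defs "HOL-Library.Countable" "HOL-Library.Infinite_Set"
begin

text \<open>
  Derivability is replaced by forcing in Kripke models with growing domains, which is complete for
  intuitionistic logic, so that it suffices to argue inside a Kripke model of CZF and NID.

  There, a morphism \<open>F\<close> is coded by the set of all pairs \<open>(S, V)\<close> of subsets of \<open>P\<close> and \<open>Q\<close>, taken
  from sufficiently large sets, such that every \<open>p \<in> S\<close> is related by \<open>F\<close> to some \<open>q \<in> V\<close>. In
  particular \<open>F(p, q)\<close> becomes membership of \<open>({p}, {q})\<close>. As the covers are set-presented, the
  conditions on a morphism, which have the form "there is a cover \<open>S\<close> such that for all \<open>p' \<in> S\<close>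
  there is \<open>q'\<close>", then turn into a set of nondeterministic rules: one rule produces some pair
  \<open>(S, V)\<close>, and another one leads from \<open>(S, V)\<close> and \<open>p' \<in> S\<close> to \<open>({p'}, {q'})\<close> for some
  \<open>q' \<in> V\<close>. NID yields a generating set for the closed sets, and the morphisms read off from
  its members generate all morphisms.
\<close>

section \<open>Renamings\<close>

text \<open>Formal derivations in set theory are unwieldy, whereas in a Kripke model each axiom
  becomes a statement about worlds that ordinary HOL automation can use; the quantification over
  later worlds keeps the argument intuitionistic. The obstacle is the shape of a rule: its
  conclusion claims that one element of a set lies in \<open>Y\<close>, while the conditions on a
  morphism hide a statement "for all \<open>p'\<close> in \<open>S\<close> there is
  \<open>q'\<close>" under an existential quantifier. The code \<open>(S, V)\<close> names that
  inner statement by a single element, so that choosing the cover is choosing a code. CZF has no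
  power set, so the sets \<open>SS\<close> and \<open>VV\<close> of possible \<open>S\<close> and
  \<open>V\<close> are assembled by collection and union: singletons, members of the values of
  \<open>BCov\<close>, \<open>Q\<close> itself and the sets of common lower bounds of two elements
  of \<open>Q\<close>. Separation is available for bounded formulas only; hence a set
  \<open>U\<close> that bounds the quantifiers in the rules, and bounded versions of pairing.
  Morphisms are read off from the codes \<open>({p}, {q})\<close> alone, so inclusion of closed sets
  gives inclusion of morphisms.\<close>

primrec fv :: "fm \<Rightarrow> nat set" where
  "fv Falsum = {}"
| "fv (Mem i j) = {i, j}"
| "fv (Eq i j) = {i, j}"
| "fv (Conj A B) = fv A \<union> fv B"
| "fv (Disj A B) = fv A \<union> fv B"
| "fv (Impl A B) = fv A \<union> fv B"
| "fv (Forall A) = {i. Suc i \<in> fv A}"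
| "fv (Exists A) = {i. Suc i \<in> fv A}"

lemma up_0 [simp]: "up r 0 = 0" and up_Suc [simp]: "up r (Suc i) = Suc (r i)"
  by (simp_all add: up_def)

lemma up_comp: "up r \<circ> up s = up (r \<circ> s)"
  by (auto simp: fun_eq_iff up_def split: nat.split)

lemma finite_fv [simp]: "finite (fv A)"
proof (induction A)
  case (Forall A)
  then have "finite (Suc -` fv A)" by (intro finite_vimageI) auto
  then show ?case by (simp add: vimage_def)
next
  case (Exists A)
  then have "finite (Suc -` fv A)" by (intro finite_vimageI) auto
  then show ?case by (simp add: vimage_def)
qed auto

lemma ren_ren: "ren r (ren s A) = ren (r \<circ> s) A"
  by (induction A arbitrary: r s) (auto simp: up_comp)

lemma ren_cong: "(\<And>i. i \<in> fv A \<Longrightarrow> r i = s i) \<Longrightarrow> ren r A = ren s A"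
proof (induction A arbitrary: r s)
  case (Conj A B)
  have "ren r A = ren s A" "ren r B = ren s B"
    by (rule Conj.IH, rule Conj.prems, simp)+
  then show ?case by (simp only: ren.simps)
next
  case (Disj A B)
  have "ren r A = ren s A" "ren r B = ren s B"
    by (rule Disj.IH, rule Disj.prems, simp)+
  then show ?case by (simp only: ren.simps)
next
  case (Impl A B)
  have "ren r A = ren s A" "ren r B = ren s B"
    by (rule Impl.IH, rule Impl.prems, simp)+
  then show ?case by (simp only: ren.simps)
next
  case (Forall A)
  have "up r i = up s i" if "i \<in> fv A" for i
    using that Forall.prems by (cases i) auto
  then have "ren (up r) A = ren (up s) A" by (rule Forall.IH)
  then show ?case by (simp only: ren.simps)
next
  case (Exists A)
  have "up r i = up s i" if "i \<in> fv A" for i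
    using that Exists.prems by (cases i) auto
  then have "ren (up r) A = ren (up s) A" by (rule Exists.IH)
  then show ?case by (simp only: ren.simps)
qed simp_all

lemma ren_ident: "(\<And>i. i \<in> fv A \<Longrightarrow> r i = i) \<Longrightarrow> ren r A = A"
proof -
  assume "\<And>i. i \<in> fv A \<Longrightarrow> r i = i"
  then have "ren r A = ren (\<lambda>i. i) A" by (rule ren_cong)
  moreover have "up (\<lambda>i. i) = (\<lambda>i. i)" by (auto simp: fun_eq_iff up_def split: nat.split)
  then have "ren (\<lambda>i. i) B = B" for B by (induction B) auto
  ultimately show ?thesis by simp
qed

lemma Suc_mem_up_image: "Suc i \<in> up r ` S \<longleftrightarrow> i \<in> r ` {j. Suc j \<in> S}"
proof
  assume "Suc i \<in> up r ` S"
  then obtain j where j: "j \<in> S" "Suc i = up r j" by auto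
  then show "i \<in> r ` {j. Suc j \<in> S}" by (cases j) auto
next
  assume "i \<in> r ` {j. Suc j \<in> S}"
  then obtain j where "Suc j \<in> S" "i = r j" by auto
  then show "Suc i \<in> up r ` S" by (intro image_eqI[of _ _ "Suc j"]) auto
qed

lemma fv_ren: "fv (ren r A) = r ` fv A"
  by (induction A arbitrary: r) (auto simp: Suc_mem_up_image)

lemma ren_inst: "ren r (inst A i) = inst (ren (up r) A) (r i)"
  unfolding inst_def ren_ren
  by (rule arg_cong[where f="\<lambda>s. ren s A"]) (auto simp: fun_eq_iff split: nat.split)

lemma fv_inst: "fv (inst A i) \<subseteq> insert i (fv (Forall A))"
  by (force simp: inst_def fv_ren split: nat.splits)

text \<open>Links the quantifier rules with semantics: in the canonical model an environment is a
  renaming, and instantiating a quantifier body by \<open>x\<close> is the same as extending the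
  environment by \<open>x\<close>.\<close>

lemma inst_ren_up: "inst (ren (up e) A) x = ren (case_nat x e) A"
  unfolding inst_def ren_ren
  by (rule arg_cong[where f="\<lambda>s. ren s A"]) (auto simp: fun_eq_iff split: nat.split)

section \<open>Derivations\<close>

lemma deriv_mono: "deriv T H A \<Longrightarrow> H \<subseteq> H' \<Longrightarrow> deriv T H' A"
proof (induction arbitrary: H' rule: deriv.induct)
  case (DisjE H A B C)
  show ?case
    by (rule deriv.DisjE[OF DisjE.IH(1)[OF DisjE.prems] DisjE.IH(2) DisjE.IH(3)])
      (use DisjE.prems in blast)+
next
  case (ImplI A H B)
  then show ?case by (meson deriv.ImplI insert_mono)
next
  case (AllI H A)
  then show ?case by (meson deriv.AllI image_mono)
next
  case (ExE H A B)
  show ?case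
    by (rule deriv.ExE[OF ExE.IH(1)[OF ExE.prems] ExE.IH(2)])
      (use ExE.prems in blast)
next
  case (Ax A H)
  then show ?case by (simp add: deriv.Ax)
next
  case (Hyp A H)
  then show ?case by (simp add: deriv.Hyp subset_iff)
next
  case (FalsumE H A)
  then show ?case by (simp add: deriv.FalsumE)
next
  case (ConjI H A B)
  then show ?case by (simp add: deriv.ConjI)
next
  case (ConjE1 H A B)
  then show ?case by (metis deriv.ConjE1)
next
  case (ConjE2 H A B)
  then show ?case by (metis deriv.ConjE2)
next
  case (DisjI1 H A B)
  then show ?case by (simp add: deriv.DisjI1)
next
  case (DisjI2 H B A)
  then show ?case by (simp add: deriv.DisjI2)
next
  case (ImplE H A B)
  then show ?case by (metis deriv.ImplE)
next
  case (AllE H A i)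
  then show ?case by (simp add: deriv.AllE)
next
  case (ExI H A i)
  then show ?case by (metis deriv.ExI)
next
  case (EqRefl H i)
  then show ?case by (simp add: deriv.EqRefl)
next
  case (EqSubst H i j A)
  then show ?case by (metis deriv.EqSubst)
qed

text \<open>With no hypotheses the eigenvariable condition of \<open>AllI\<close> is void, so a
  theorem may be generalised and then instantiated.\<close>

lemma theorem_inst: "deriv T {} A \<Longrightarrow> deriv T {} (inst A i)"
  using AllE AllI[where H="{}"] by force

text \<open>
  Iterated instantiation shifts the remaining variables down, so the \<open>k\<close>-th instance has to be
  chosen shifted up by the number of instantiations that follow it.
\<close>

lemma theorem_ren_shift: "deriv T {} A \<Longrightarrow> deriv T {} (ren (\<lambda>i. if i < n then r i else i - n) A)"
proof (induction n arbitrary: r A)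
  case 0
  then show ?case by (simp add: ren_ident)
next
  case (Suc n)
  have "deriv T {} (ren (\<lambda>i. if i < n then r (Suc i) else i - n) (inst A (r 0 + n)))"
    by (rule Suc.IH) (rule theorem_inst[OF Suc.prems])
  moreover have "(\<lambda>i. if i < n then r (Suc i) else i - n) \<circ> case_nat (r 0 + n) (\<lambda>j. j)
      = (\<lambda>i. if i < Suc n then r i else i - Suc n)"
    by (auto simp: fun_eq_iff split: nat.split)
  ultimately show ?case by (simp add: inst_def ren_ren)
qed

text \<open>A formula has finitely many free variables, and on these any renaming agrees with a
  finite iteration of instantiations.\<close>

lemma theorem_ren: "deriv T {} A \<Longrightarrow> deriv T {} (ren r A)"
proof -
  assume "deriv T {} A"
  obtain n where n: "\<And>i. i \<in> fv A \<Longrightarrow> i < n"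
    using finite_nat_set_iff_bounded[of "fv A"] by auto
  have "ren r A = ren (\<lambda>i. if i < n then r i else i - n) A"
    by (rule ren_cong) (simp add: n)
  then show ?thesis using theorem_ren_shift[OF \<open>deriv T {} A\<close>] by simp
qed

lemma ren_up_ren_Suc: "ren (up r) ` ren Suc ` H = ren Suc ` ren r ` H"
  by (force simp: image_image ren_ren comp_def)

lemma deriv_ren: "deriv T H A \<Longrightarrow> deriv T (ren r ` H) (ren r A)"
proof (induction arbitrary: r rule: deriv.induct)
  \<comment> \<open>\<open>T\<close> need not be closed under renaming; a renamed axiom is obtained
    as a theorem, by instantiation.\<close>
  case (Ax A H)
  then have "deriv T {} (ren r A)" by (intro theorem_ren deriv.Ax)
  then show ?case by (rule deriv_mono) simp
next
  case (Hyp A H)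
  then show ?case by (intro deriv.Hyp) simp
next
  case (DisjE H A B C)
  show ?case
    using deriv.DisjE[of T "ren r ` H" "ren r A" "ren r B"] DisjE.IH(1)[of r] DisjE.IH(2)[of r]
      DisjE.IH(3)[of r] by simp
next
  case (ImplI A H B)
  then show ?case using deriv.ImplI[of T "ren r A"] by simp
next
  case (ImplE H A B)
  then show ?case by (metis deriv.ImplE ren.simps(6))
next
  case (AllI H A)
  have "deriv T (ren Suc ` ren r ` H) (ren (up r) A)"
    using AllI.IH[of "up r"] by (simp add: ren_up_ren_Suc)
  then show ?case by (simp add: deriv.AllI)
next
  case (AllE H A i)
  then show ?case by (simp add: ren_inst deriv.AllE)
next
  case (ExI H A i)
  then show ?case by (metis ren_inst ren.simps(8) deriv.ExI)
next
  case (ExE H A B)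
  have "deriv T (insert (ren (up r) A) (ren Suc ` ren r ` H)) (ren (up r) (ren Suc B))"
    using ExE.IH(2)[of "up r"] by (simp add: ren_up_ren_Suc)
  moreover have "ren (up r) (ren Suc B) = ren Suc (ren r B)"
    by (simp add: ren_ren comp_def)
  ultimately show ?case using deriv.ExE[of T "ren r ` H" "ren (up r) A" "ren r B"] ExE.IH(1)[of r]
    by simp
next
  case (EqRefl H i)
  then show ?case by (simp add: deriv.EqRefl)
next
  case (EqSubst H i j A)
  then show ?case using deriv.EqSubst[of T "ren r ` H" "r i" "r j" "ren (up r) A"] by (simp add: ren_inst)
next
  case (FalsumE H A)
  then show ?case by (simp add: deriv.FalsumE)
next
  case (ConjI H A B)
  then show ?case by (simp add: deriv.ConjI)
next
  case (ConjE1 H A B)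
  then show ?case by (metis deriv.ConjE1 ren.simps(4))
next
  case (ConjE2 H A B)
  then show ?case by (metis deriv.ConjE2 ren.simps(4))
next
  case (DisjI1 H A B)
  then show ?case by (simp add: deriv.DisjI1)
next
  case (DisjI2 H B A)
  then show ?case by (simp add: deriv.DisjI2)
qed

text \<open>Compactness: it lets a derivation from the union of an increasing sequence of theories
  be moved to one member of the sequence. When a rule discharges a hypothesis, that hypothesis is
  removed from the finite set found for the subderivation.\<close>

lemma deriv_finite: "deriv T H A \<Longrightarrow> \<exists>K. finite K \<and> K \<subseteq> H \<and> deriv T K A"
proof (induction rule: deriv.induct)
  case (Ax A H)
  then show ?case using deriv.Ax by blast
next
  case (Hyp A H)
  then show ?case by (intro exI[of _ "{A}"]) (auto intro: deriv.Hyp)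
next
  case (FalsumE H A)
  then show ?case using deriv.FalsumE by blast
next
  case (ConjI H A B)
  then obtain K L where K: "finite K" "K \<subseteq> H" "deriv T K A" and L: "finite L" "L \<subseteq> H" "deriv T L B"
    by auto
  have "deriv T (K \<union> L) (Conj A B)"
    by (rule deriv.ConjI[OF deriv_mono[OF K(3)] deriv_mono[OF L(3)]]) simp_all
  then show ?case using K L by (intro exI[of _ "K \<union> L"]) simp
next
  case (ConjE1 H A B)
  then show ?case using deriv.ConjE1 by blast
next
  case (ConjE2 H A B)
  then show ?case using deriv.ConjE2 by blast
next
  case (DisjI1 H A B)
  then show ?case using deriv.DisjI1 by blast
next
  case (DisjI2 H B A)
  then show ?case using deriv.DisjI2 by blast
next
  case (DisjE H A B C)
  then obtain K L M where K: "finite K" "K \<subseteq> H" "deriv T K (Disj A B)"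
    and L: "finite L" "L \<subseteq> insert A H" "deriv T L C"
    and M: "finite M" "M \<subseteq> insert B H" "deriv T M C" by auto
  let ?N = "K \<union> (L - {A}) \<union> (M - {B})"
  have "deriv T ?N (Disj A B)" "deriv T (insert A ?N) C" "deriv T (insert B ?N) C"
    by (rule deriv_mono[OF K(3)], blast, rule deriv_mono[OF L(3)], use L(2) in blast,
        rule deriv_mono[OF M(3)], use M(2) in blast)
  then have "deriv T ?N C" by (rule deriv.DisjE)
  then show ?case using K L M by (intro exI[of _ ?N]) auto
next
  case (ImplI A H B)
  then obtain L where L: "finite L" "L \<subseteq> insert A H" "deriv T L B" by auto
  have "deriv T (insert A (L - {A})) B" by (rule deriv_mono[OF L(3)]) blast
  then have "deriv T (L - {A}) (Impl A B)" by (rule deriv.ImplI)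
  then show ?case using L by (intro exI[of _ "L - {A}"]) auto
next
  case (ImplE H A B)
  then obtain K L where K: "finite K" "K \<subseteq> H" "deriv T K (Impl A B)"
    and L: "finite L" "L \<subseteq> H" "deriv T L A" by auto
  have "deriv T (K \<union> L) B"
    by (rule deriv.ImplE[OF deriv_mono[OF K(3)] deriv_mono[OF L(3)]]) simp_all
  then show ?case using K L by (intro exI[of _ "K \<union> L"]) simp
next
  case (AllI H A)
  then obtain K where "finite K" "K \<subseteq> ren Suc ` H" "deriv T K A" by auto
  then obtain L where "finite L" "L \<subseteq> H" "K = ren Suc ` L"
    by (meson finite_subset_image)
  then show ?case using \<open>deriv T K A\<close> by (intro exI[of _ L]) (auto intro: deriv.AllI)
next
  case (AllE H A i)
  then show ?case using deriv.AllE by blast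
next
  case (ExI H A i)
  then show ?case using deriv.ExI by blast
next
  case (ExE H A B)
  then obtain K L where K: "finite K" "K \<subseteq> H" "deriv T K (Exists A)"
    and L: "finite L" "L \<subseteq> insert A (ren Suc ` H)" "deriv T L (ren Suc B)" by auto
  \<comment> \<open>Apart from the discharged witness hypothesis, the formulas used are shifted
    members of \<open>H\<close>, so they can be pulled back to a finite part of
    \<open>H\<close>.\<close>
  have "L - {A} \<subseteq> ren Suc ` H" using L by auto
  then obtain M where M: "finite M" "M \<subseteq> H" "L - {A} = ren Suc ` M"
    using L(1) by (meson finite_Diff finite_subset_image)
  let ?N = "K \<union> M"
  have "deriv T ?N (Exists A)" by (rule deriv_mono[OF K(3)]) simp
  moreover have "L \<subseteq> insert A (ren Suc ` ?N)" using M(3) by blast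
  then have "deriv T (insert A (ren Suc ` ?N)) (ren Suc B)" using L(3) deriv_mono by blast
  ultimately have "deriv T ?N B" by (rule deriv.ExE)
  then show ?case using K M by (intro exI[of _ ?N]) simp
next
  case (EqRefl H i)
  then show ?case using deriv.EqRefl by blast
next
  case (EqSubst H i j A)
  then obtain K L where K: "finite K" "K \<subseteq> H" "deriv T K (Eq i j)"
    and L: "finite L" "L \<subseteq> H" "deriv T L (inst A i)" by auto
  have "deriv T (K \<union> L) (inst A j)"
    by (rule deriv.EqSubst[OF deriv_mono[OF K(3)] deriv_mono[OF L(3)]]) simp_all
  then show ?case using K L by (intro exI[of _ "K \<union> L"]) simp
qed

lemma deriv_cut: "deriv T H A \<Longrightarrow> deriv T (insert A H) C \<Longrightarrow> deriv T H C"
  by (rule deriv.ImplE[OF deriv.ImplI])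

text \<open>The renaming \<open>fresh y\<close> turns the free variable \<open>y\<close> into the variable about to be bound.\<close>

definition fresh :: "nat \<Rightarrow> nat \<Rightarrow> nat" where
  "fresh y i = (if i = y then 0 else Suc i)"

lemma ren_fresh: "y \<notin> fv A \<Longrightarrow> ren (fresh y) A = ren Suc A"
  by (rule ren_cong) (auto simp: fresh_def)

lemma ren_fresh_image: "(\<And>A. A \<in> H \<Longrightarrow> y \<notin> fv A) \<Longrightarrow> ren (fresh y) ` H = ren Suc ` H"
  by (auto simp: ren_fresh intro!: image_cong)

lemma ren_fresh_inst: "y \<notin> fv (Forall A) \<Longrightarrow> ren (fresh y) (inst A y) = A"
  unfolding inst_def ren_ren by (rule ren_ident) (auto simp: fresh_def split: nat.split)

text \<open>The rule with a named eigenvariable, as needed for Henkin witnesses: renaming the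
  derivation by \<open>fresh y\<close> turns it into the premise of the de Bruijn rule.\<close>

lemma AllI_fresh:
  assumes "deriv T H (inst A y)" "\<And>B. B \<in> H \<Longrightarrow> y \<notin> fv B" "y \<notin> fv (Forall A)"
  shows "deriv T H (Forall A)"
  using deriv_ren[OF assms(1), of "fresh y"] ren_fresh_image[OF assms(2)] ren_fresh_inst[OF assms(3)]
  by (simp add: deriv.AllI)

lemma ExE_fresh:
  assumes "deriv T H (Exists A)" "deriv T (insert (inst A y) H) C"
    "\<And>B. B \<in> H \<Longrightarrow> y \<notin> fv B" "y \<notin> fv (Exists A)" "y \<notin> fv C"
  shows "deriv T H C"
  using deriv_ren[OF assms(2), of "fresh y"] ren_fresh_image[OF assms(3)] ren_fresh_inst[of y A] assms(4)
    ren_fresh[OF assms(5)] deriv.ExE[OF assms(1), of C]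
  by simp

section \<open>Prime theories\<close>

text \<open>\<open>Eq i i\<close> is derivable for every \<open>i\<close>; it is its membership in
  the theory, not its derivability, that marks the variable \<open>i\<close> as an existing
  individual.\<close>

definition dom_of :: "fm set \<Rightarrow> nat set" where
  "dom_of \<Gamma> = {i. Eq i i \<in> \<Gamma>}"

text \<open>The domain is kept co-infinite so that later worlds can still introduce new individuals.
  Deductive closure is demanded only for formulas over the domain, since otherwise every
  \<open>Eq i i\<close> would enter.\<close>

definition prime_theory :: "fm set \<Rightarrow> fm set \<Rightarrow> bool" where
  "prime_theory T \<Gamma> \<longleftrightarrow> infinite (- dom_of \<Gamma>) \<and> (\<forall>A\<in>\<Gamma>. fv A \<subseteq> dom_of \<Gamma>) \<and>
     (\<forall>A. deriv T \<Gamma> A \<longrightarrow> fv A \<subseteq> dom_of \<Gamma> \<longrightarrow> A \<in> \<Gamma>) \<and> Falsum \<notin> \<Gamma> \<and>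
     (\<forall>A B. Disj A B \<in> \<Gamma> \<longrightarrow> A \<in> \<Gamma> \<or> B \<in> \<Gamma>) \<and>
     (\<forall>A. Exists A \<in> \<Gamma> \<longrightarrow> (\<exists>i\<in>dom_of \<Gamma>. inst A i \<in> \<Gamma>))"

instance fm :: countable by countable_datatype

lemma infinite_fresh: "infinite K \<Longrightarrow> finite (K \<inter> X) \<Longrightarrow> \<exists>y. y \<in> K \<and> y \<notin> X"
  by (metis Int_absorb2 subsetI)

text \<open>The members with even position in the enumeration of \<open>N\<close> form
  \<open>K\<close>, those with odd position stay outside it.\<close>

lemma infinite_split:
  fixes N :: "nat set"
  assumes "infinite N"
  obtains K where "K \<subseteq> N" "infinite K" "infinite (N - K)"
proof -
  let ?f = "enumerate N"
  have inj: "inj_on ?f X" for X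
    using inj_enumerate[OF assms] by (rule inj_on_subset) simp
  have "infinite (range (\<lambda>n. 2 * n :: nat))" "infinite (range (\<lambda>n. Suc (2 * n)))"
    by (rule range_inj_infinite, simp add: inj_def)+
  then have ev: "infinite (?f ` range (\<lambda>n. 2 * n))" and od: "infinite (?f ` range (\<lambda>n. Suc (2 * n)))"
    using inj finite_imageD by blast+
  have sub: "?f ` range (\<lambda>n. 2 * n) \<subseteq> N" using assms by (auto simp: enumerate_in_set)
  have "?f ` range (\<lambda>n. Suc (2 * n)) \<subseteq> N - ?f ` range (\<lambda>n. 2 * n)"
  proof (clarsimp, intro conjI)
    fix n show "?f (Suc (2 * n)) \<in> N" using assms by (rule enumerate_in_set)
    show "?f (Suc (2 * n)) \<notin> ?f ` range (\<lambda>n. 2 * n)"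
      using inj[of UNIV] by (auto simp: inj_eq) presburger
  qed
  then have "infinite (N - ?f ` range (\<lambda>n. 2 * n))" using od finite_subset by blast
  with sub ev show thesis by (rule that)
qed

text \<open>
  Here \<open>V\<close> is the set of variables of the theory under construction, \<open>K\<close> the supply of witnesses
  for existential formulas, and \<open>C\<close> the formula that must remain underivable.
\<close>

definition ext_step :: "fm set \<Rightarrow> nat set \<Rightarrow> nat set \<Rightarrow> fm \<Rightarrow> fm \<Rightarrow> fm set \<Rightarrow> fm set" where
  "ext_step T V K C A H =
    (if fv A \<subseteq> V \<and> \<not> deriv T (insert A H) C
     then insert A H \<union>
       (case A of Exists B \<Rightarrow> {inst B (SOME y. y \<in> K \<and> y \<notin> \<Union>(fv ` insert C (insert A H)))} | _ \<Rightarrow> {})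
     else H)"

primrec ext_seq :: "fm set \<Rightarrow> nat set \<Rightarrow> nat set \<Rightarrow> fm \<Rightarrow> fm set \<Rightarrow> nat \<Rightarrow> fm set" where
  "ext_seq T V K C H 0 = H"
| "ext_seq T V K C H (Suc n) = ext_step T V K C (from_nat n) (ext_seq T V K C H n)"

text \<open>The Henkin-Lindenbaum construction in its intuitionistic form: what is preserved is
  underivability of one formula \<open>C\<close>, rather than consistency, and this is what makes
  the limit prime.\<close>

lemma prime_extension:
  assumes C: "\<not> deriv T H C" and V: "infinite (- V)" and fvH: "\<And>A. A \<in> H \<Longrightarrow> fv A \<subseteq> V"
    and fvC: "fv C \<subseteq> V"
  obtains \<Gamma> where "prime_theory T \<Gamma>" "H \<subseteq> \<Gamma>" "V \<subseteq> dom_of \<Gamma>" "C \<notin> \<Gamma>"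
proof -
  obtain K where K: "K \<subseteq> - V" "infinite K" "infinite (- V - K)" using infinite_split[OF V] .
  define W where "W = V \<union> K"
  let ?S = "ext_seq T W K C H"
  define \<Gamma> where "\<Gamma> = (\<Union>n. ?S n)"
  \<comment> \<open>The last conjunct guarantees a fresh witness at each stage although
    \<open>H\<close> may be infinite: \<open>H\<close> avoids \<open>K\<close>, and every stage adds
    only finitely many variables.\<close>
  have step: "\<not> deriv T (?S n) C \<and> (\<forall>A\<in>?S n. fv A \<subseteq> W) \<and> finite (K \<inter> \<Union>(fv ` ?S n))" for n
  proof (induction n)
    case 0
    have "K \<inter> \<Union>(fv ` H) = {}" using fvH K(1) by blast
    then show ?case using C fvH by (auto simp: W_def)
  next
    case (Suc n)
    let ?A = "from_nat n :: fm"
    show ?case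
    proof (cases "fv ?A \<subseteq> W \<and> \<not> deriv T (insert ?A (?S n)) C")
      case False
      then have "?S (Suc n) = ?S n" by (simp only: ext_seq.simps ext_step_def if_False)
      with Suc show ?thesis by presburger
    next
      case True
      have fin: "finite (K \<inter> \<Union>(fv ` insert C (insert ?A (?S n))))"
        using Suc by (simp add: Int_Un_distrib)
      show ?thesis
      proof (cases "\<exists>B. ?A = Exists B")
        case False
        then have "?S (Suc n) = insert ?A (?S n)"
          using True by (auto simp: ext_step_def split: fm.split)
        with Suc True show ?thesis by (simp add: Int_Un_distrib)
      next
        case ex: True
        then obtain B where B: "?A = Exists B" by auto
        define y where "y = (SOME y. y \<in> K \<and> y \<notin> \<Union>(fv ` insert C (insert ?A (?S n))))"
        have "\<exists>y. y \<in> K \<and> y \<notin> \<Union>(fv ` insert C (insert ?A (?S n)))"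
          by (rule infinite_fresh[OF K(2) fin])
        then have y: "y \<in> K" "y \<notin> \<Union>(fv ` insert C (insert ?A (?S n)))"
          unfolding y_def by (rule someI2_ex, blast)+
        have S: "?S (Suc n) = insert (inst B y) (insert ?A (?S n))"
          using True B by (simp add: ext_step_def y_def)
        \<comment> \<open>Adding the witness instance together with its existential formula is
          conservative, because \<open>y\<close> is fresh for everything involved.\<close>
        have "\<not> deriv T (?S (Suc n)) C"
        proof
          assume "deriv T (?S (Suc n)) C"
          then have "deriv T (insert ?A (?S n)) C"
            unfolding S by (rule ExE_fresh[where A=B and y=y, rotated]) (use y B in \<open>auto intro: deriv.Hyp\<close>)
          with True show False by simp
        qed
        moreover have "fv (inst B y) \<subseteq> W" using fv_inst[of B y] True B y(1) by (auto simp: W_def)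
        moreover have "finite (K \<inter> \<Union>(fv ` ?S (Suc n)))"
          unfolding S using fin by (simp add: Int_Un_distrib)
        ultimately show ?thesis using Suc True S by auto
      qed
    qed
  qed
  have mono: "?S m \<subseteq> ?S n" if "m \<le> n" for m n
    using that by (rule lift_Suc_mono_le[rotated]) (auto simp: ext_step_def)
  have ncons: "\<not> deriv T \<Gamma> C"
  proof
    assume "deriv T \<Gamma> C"
    from deriv_finite[OF this] obtain L where L: "finite L" "L \<subseteq> \<Gamma>" "deriv T L C" by blast
    have "\<exists>n. L \<subseteq> ?S n" using L(1,2)
    proof (induction L)
      case (insert A L)
      then obtain m n where mn: "L \<subseteq> ?S n" "A \<in> ?S m" by (auto simp: \<Gamma>_def)
      have "?S n \<subseteq> ?S (n + m)" "?S m \<subseteq> ?S (n + m)" by (rule mono, simp)+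
      with mn have "insert A L \<subseteq> ?S (n + m)" by blast
      then show ?case ..
    qed simp
    then obtain n where "L \<subseteq> ?S n" ..
    then show False using deriv_mono[OF L(3)] step[of n] by blast
  qed
  \<comment> \<open>The formula \<open>A\<close> is examined at stage \<open>to_nat A\<close>, where
    fewer hypotheses are present than in the limit, so it passes the test.\<close>
  have maxi: "A \<in> \<Gamma>" if "fv A \<subseteq> W" "\<not> deriv T (insert A \<Gamma>) C" for A
  proof -
    let ?n = "to_nat A"
    have "\<not> deriv T (insert A (?S ?n)) C"
      using that(2) deriv_mono[of T "insert A (?S ?n)" C "insert A \<Gamma>"] by (auto simp: \<Gamma>_def)
    then have "A \<in> ?S (Suc ?n)" using that(1) by (simp add: ext_step_def)
    then show ?thesis unfolding \<Gamma>_def by (rule UN_I[OF UNIV_I])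
  qed
  have closed: "A \<in> \<Gamma>" if "deriv T \<Gamma> A" "fv A \<subseteq> W" for A
    using maxi[OF that(2)] ncons deriv_cut[OF that(1)] by blast
  have fvG: "fv A \<subseteq> W" if "A \<in> \<Gamma>" for A using that step by (auto simp: \<Gamma>_def)
  have dom: "dom_of \<Gamma> = W"
  proof
    show "dom_of \<Gamma> \<subseteq> W" using fvG by (fastforce simp: dom_of_def)
    show "W \<subseteq> dom_of \<Gamma>" using closed[OF deriv.EqRefl] by (auto simp: dom_of_def)
  qed
  have "prime_theory T \<Gamma>"
    unfolding prime_theory_def dom
  proof (intro conjI ballI allI impI)
    show "infinite (- W)" using K(3) by (simp add: W_def Diff_eq)
    show "Falsum \<notin> \<Gamma>" using ncons deriv.FalsumE deriv.Hyp by blast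
  next
    fix A B assume AB: "Disj A B \<in> \<Gamma>"
    then have "fv A \<subseteq> W" "fv B \<subseteq> W" using fvG by fastforce+
    then show "A \<in> \<Gamma> \<or> B \<in> \<Gamma>" using maxi ncons AB by (meson deriv.DisjE deriv.Hyp)
  next
    fix A assume A: "Exists A \<in> \<Gamma>"
    let ?n = "to_nat (Exists A)"
    let ?y = "SOME y. y \<in> K \<and> y \<notin> \<Union>(fv ` insert C (insert (Exists A) (?S ?n)))"
    have nd: "\<not> deriv T (insert (Exists A) (?S ?n)) C"
      using ncons A deriv_mono[of T "insert (Exists A) (?S ?n)" C \<Gamma>] by (auto simp: \<Gamma>_def)
    then have "inst A ?y \<in> ?S (Suc ?n)" using fvG[OF A] by (simp add: ext_step_def)
    then have "inst A ?y \<in> \<Gamma>" unfolding \<Gamma>_def by (rule UN_I[OF UNIV_I])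
    moreover have "finite (K \<inter> \<Union>(fv ` insert C (insert (Exists A) (?S ?n))))"
      using step[of ?n] by (auto simp: Int_Un_distrib simp del: fv.simps)
    then have "\<exists>y. y \<in> K \<and> y \<notin> \<Union>(fv ` insert C (insert (Exists A) (?S ?n)))"
      by (rule infinite_fresh[OF K(2)])
    then have "?y \<in> K" by (rule someI2_ex) blast
    ultimately show "\<exists>i\<in>W. inst A i \<in> \<Gamma>" unfolding W_def by blast
  qed (use fvG closed in auto)
  moreover have "H \<subseteq> \<Gamma>" by (auto simp: \<Gamma>_def intro: UN_I[of 0])
  moreover have "C \<notin> \<Gamma>" using ncons deriv.Hyp by blast
  ultimately show thesis using that dom by (auto simp: W_def)
qed


section \<open>Kripke semantics\<close>

abbreviation cons_env :: "'d \<Rightarrow> (nat \<Rightarrow> 'd) \<Rightarrow> nat \<Rightarrow> 'd" (infixr "##" 65) where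
  "x ## e \<equiv> case_nat x e"

text \<open>
  Equality is interpreted by a partial equivalence relation, which at the same time encodes
  the growing domains: \<open>x\<close> exists at the world \<open>w\<close> iff \<open>E w x x\<close>.
\<close>

locale kripke =
  fixes le :: "'w \<Rightarrow> 'w \<Rightarrow> bool" (infix "\<sqsubseteq>" 50)
    and M E :: "'w \<Rightarrow> 'd \<Rightarrow> 'd \<Rightarrow> bool"
  assumes le_refl [simp]: "w \<sqsubseteq> w"
    and le_trans: "w \<sqsubseteq> w' \<Longrightarrow> w' \<sqsubseteq> w'' \<Longrightarrow> w \<sqsubseteq> w''"
    and M_mono: "M w x y \<Longrightarrow> w \<sqsubseteq> w' \<Longrightarrow> M w' x y"
    and E_mono: "E w x y \<Longrightarrow> w \<sqsubseteq> w' \<Longrightarrow> E w' x y"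
    and E_sym: "E w x y \<Longrightarrow> E w y x"
    and E_trans: "E w x y \<Longrightarrow> E w y z \<Longrightarrow> E w x z"
    and M_cong: "M w x y \<Longrightarrow> E w x x' \<Longrightarrow> E w y y' \<Longrightarrow> M w x' y'"
    and M_dom: "M w x y \<Longrightarrow> E w x x" "M w x y \<Longrightarrow> E w y y"
begin

primrec forces :: "'w \<Rightarrow> (nat \<Rightarrow> 'd) \<Rightarrow> fm \<Rightarrow> bool" where
  "forces w e Falsum = False"
| "forces w e (Mem i j) = M w (e i) (e j)"
| "forces w e (Eq i j) = E w (e i) (e j)"
| "forces w e (Conj A B) = (forces w e A \<and> forces w e B)"
| "forces w e (Disj A B) = (forces w e A \<or> forces w e B)"
| "forces w e (Impl A B) = (\<forall>w'. w \<sqsubseteq> w' \<longrightarrow> forces w' e A \<longrightarrow> forces w' e B)"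
| "forces w e (Forall A) = (\<forall>w' x. w \<sqsubseteq> w' \<longrightarrow> E w' x x \<longrightarrow> forces w' (x ## e) A)"
| "forces w e (Exists A) = (\<exists>x. E w x x \<and> forces w (x ## e) A)"

definition env :: "'w \<Rightarrow> (nat \<Rightarrow> 'd) \<Rightarrow> bool" where
  "env w e \<longleftrightarrow> (\<forall>i. E w (e i) (e i))"

lemma env_cons [simp]: "env w (x ## e) \<longleftrightarrow> E w x x \<and> env w e"
  unfolding env_def by (force split: nat.splits)

lemma env_mono: "env w e \<Longrightarrow> w \<sqsubseteq> w' \<Longrightarrow> env w' e"
  unfolding env_def by (blast intro: E_mono)

lemma forces_mono: "forces w e A \<Longrightarrow> w \<sqsubseteq> w' \<Longrightarrow> forces w' e A"
  by (induction A arbitrary: w e) (auto intro: M_mono E_mono le_trans)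

lemma forces_ren: "forces w e (ren r A) = forces w (e \<circ> r) A"
proof (induction A arbitrary: w e r)
  case (Forall A)
  have "x ## e \<circ> up r = x ## (e \<circ> r)" for x
    by (auto simp: fun_eq_iff split: nat.split)
  then show ?case by (simp only: ren.simps forces.simps Forall.IH)
next
  case (Exists A)
  have "x ## e \<circ> up r = x ## (e \<circ> r)" for x
    by (auto simp: fun_eq_iff split: nat.split)
  then show ?case by (simp only: ren.simps forces.simps Exists.IH)
qed auto

lemma forces_cong: "forces w e A \<Longrightarrow> (\<And>i. E w (e i) (e' i)) \<Longrightarrow> forces w e' A"
proof (induction A arbitrary: w e e')
  case (Mem i j)
  then show ?case by (simp add: M_cong[where x="e i" and y="e j"])
next
  case (Eq i j)
  then show ?case by simp (metis E_sym E_trans)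
next
  case (Impl A B)
  show ?case
    unfolding forces.simps
  proof (intro allI impI)
    fix w' assume w': "w \<sqsubseteq> w'" "forces w' e' A"
    have E: "E w' (e i) (e' i)" for i using Impl.prems(2) w'(1) by (rule E_mono)
    then have "forces w' e A" using Impl.IH(1)[OF w'(2)] E_sym by blast
    then have "forces w' e B" using Impl.prems(1) w'(1) by simp
    then show "forces w' e' B" using Impl.IH(2) E by blast
  qed
next
  case (Forall A)
  show ?case
    unfolding forces.simps
  proof (intro allI impI)
    fix w' x assume w': "w \<sqsubseteq> w'" "E w' x x"
    then have "forces w' (x ## e) A" using Forall.prems(1) by simp
    moreover have "E w' ((x ## e) i) ((x ## e') i)" for i
      using w'(2) E_mono[OF Forall.prems(2) w'(1)] by (auto split: nat.split)
    ultimately show "forces w' (x ## e') A" by (rule Forall.IH)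
  qed
next
  case (Exists A)
  then obtain x where x: "E w x x" "forces w (x ## e) A" by auto
  have "E w ((x ## e) i) ((x ## e') i)" for i
    using x(1) Exists.prems(2) by (auto split: nat.split)
  with x show ?case using Exists.IH by auto
qed auto

end

section \<open>The canonical model and completeness\<close>

context
  fixes T :: "fm set"
begin

text \<open>Sets of formulas that are not prime theories become worlds with an empty domain.\<close>

definition can_le :: "fm set \<Rightarrow> fm set \<Rightarrow> bool" where
  "can_le \<Gamma> \<Delta> \<longleftrightarrow> \<Gamma> \<subseteq> \<Delta> \<and> (prime_theory T \<Gamma> \<longrightarrow> prime_theory T \<Delta>)"

definition can_M :: "fm set \<Rightarrow> nat \<Rightarrow> nat \<Rightarrow> bool" where
  "can_M \<Gamma> x y \<longleftrightarrow> prime_theory T \<Gamma> \<and> Mem x y \<in> \<Gamma>"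

definition can_E :: "fm set \<Rightarrow> nat \<Rightarrow> nat \<Rightarrow> bool" where
  "can_E \<Gamma> x y \<longleftrightarrow> prime_theory T \<Gamma> \<and> Eq x y \<in> \<Gamma>"

lemma prime_closed: "prime_theory T \<Gamma> \<Longrightarrow> deriv T \<Gamma> A \<Longrightarrow> fv A \<subseteq> dom_of \<Gamma> \<Longrightarrow> A \<in> \<Gamma>"
  by (simp add: prime_theory_def)

lemma prime_fv: "prime_theory T \<Gamma> \<Longrightarrow> A \<in> \<Gamma> \<Longrightarrow> fv A \<subseteq> dom_of \<Gamma>"
  by (simp add: prime_theory_def)

lemma prime_Eq_subst:
  assumes \<Gamma>: "prime_theory T \<Gamma>" and "Eq x y \<in> \<Gamma>" "inst A x \<in> \<Gamma>" "fv (inst A y) \<subseteq> dom_of \<Gamma>"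
  shows "inst A y \<in> \<Gamma>"
  using assms by (intro prime_closed[OF \<Gamma>]) (auto intro: deriv.EqSubst[of T \<Gamma> x y A] deriv.Hyp)

interpretation canonical: kripke can_le can_M can_E
proof
  fix w w' w'' :: "fm set" and x y z x' y' :: nat
  show "can_le w w" by (simp add: can_le_def)
  show "can_le w w' \<Longrightarrow> can_le w' w'' \<Longrightarrow> can_le w w''" by (auto simp: can_le_def)
  show "can_M w x y \<Longrightarrow> can_le w w' \<Longrightarrow> can_M w' x y" by (auto simp: can_le_def can_M_def)
  show "can_E w x y \<Longrightarrow> can_le w w' \<Longrightarrow> can_E w' x y" by (auto simp: can_le_def can_E_def)
  show "can_M w x y \<Longrightarrow> can_E w x x" "can_M w x y \<Longrightarrow> can_E w y y"
    using prime_fv[of w "Mem x y"] by (auto simp: can_M_def can_E_def dom_of_def)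
  \<comment> \<open>Congruence properties are substitutions into a formula with hole 0; the shift
    \<open>Suc x\<close> protects the other variable from the instantiation.\<close>
  show sym: "can_E w x y \<Longrightarrow> can_E w y x" for w x y
    using prime_Eq_subst[of w x y "Eq 0 (Suc x)"] prime_fv[of w "Eq x y"]
    by (auto simp: can_E_def inst_def dom_of_def)
  show "can_E w x y \<Longrightarrow> can_E w y z \<Longrightarrow> can_E w x z"
    using prime_Eq_subst[of w y z "Eq (Suc x) 0"] prime_fv[of w "Eq x y"] prime_fv[of w "Eq y z"]
    by (auto simp: can_E_def inst_def)
  show "can_M w x y \<Longrightarrow> can_E w x x' \<Longrightarrow> can_E w y y' \<Longrightarrow> can_M w x' y'"
    using prime_Eq_subst[of w x x' "Mem 0 (Suc y)"] prime_Eq_subst[of w y y' "Mem (Suc x') 0"]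
      prime_fv[of w "Eq x x'"] prime_fv[of w "Eq y y'"]
    by (auto simp: can_M_def can_E_def inst_def)
qed

lemma can_E_refl: "prime_theory T \<Gamma> \<Longrightarrow> can_E \<Gamma> x x \<longleftrightarrow> x \<in> dom_of \<Gamma>"
  by (simp add: can_E_def dom_of_def)

text \<open>Individuals of the canonical model are variables, so an environment into the domain acts
  as a renaming. Only implication and universal quantification need new worlds; the other
  connectives follow from primeness and closure of the theory at hand.\<close>

lemma truth:
  "prime_theory T \<Gamma> \<Longrightarrow> (\<And>i. e i \<in> dom_of \<Gamma>) \<Longrightarrow> canonical.forces \<Gamma> e A \<longleftrightarrow> ren e A \<in> \<Gamma>"
proof (induction A arbitrary: \<Gamma> e)
  case Falsum
  then show ?case by (simp add: prime_theory_def)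
next
  case (Mem i j)
  then show ?case unfolding canonical.forces.simps by (simp add: can_M_def)
next
  case (Eq i j)
  then show ?case unfolding canonical.forces.simps by (simp add: can_E_def)
next
  case (Conj A B)
  have fv: "fv (ren e C) \<subseteq> dom_of \<Gamma>" for C using Conj.prems(2) by (auto simp: fv_ren)
  note c = prime_closed[OF Conj.prems(1)]
  have "Conj (ren e A) (ren e B) \<in> \<Gamma> \<longleftrightarrow> ren e A \<in> \<Gamma> \<and> ren e B \<in> \<Gamma>"
    using c[of "ren e A"] c[of "ren e B"] c[of "Conj (ren e A) (ren e B)"] fv
      deriv.ConjE1 deriv.ConjE2 deriv.ConjI deriv.Hyp by (metis Un_subset_iff fv.simps(4))
  with Conj show ?case by simp
next
  case (Disj A B)
  have fv: "fv (ren e C) \<subseteq> dom_of \<Gamma>" for C using Disj.prems(2) by (auto simp: fv_ren)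
  note c = prime_closed[OF Disj.prems(1)]
  have "Disj (ren e A) (ren e B) \<in> \<Gamma> \<longleftrightarrow> ren e A \<in> \<Gamma> \<or> ren e B \<in> \<Gamma>"
  proof
    assume "Disj (ren e A) (ren e B) \<in> \<Gamma>"
    then show "ren e A \<in> \<Gamma> \<or> ren e B \<in> \<Gamma>" using Disj.prems(1) by (simp add: prime_theory_def)
  next
    assume "ren e A \<in> \<Gamma> \<or> ren e B \<in> \<Gamma>"
    then have "deriv T \<Gamma> (Disj (ren e A) (ren e B))" using deriv.DisjI1 deriv.DisjI2 deriv.Hyp by blast
    then show "Disj (ren e A) (ren e B) \<in> \<Gamma>" using c fv by simp
  qed
  with Disj show ?case by simp
next
  case (Impl A B)
  have fv: "fv (ren e C) \<subseteq> dom_of \<Gamma>" for C using Impl.prems(2) by (auto simp: fv_ren)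
  show ?case
  proof
    assume l: "canonical.forces \<Gamma> e (Impl A B)"
    show "ren e (Impl A B) \<in> \<Gamma>"
    proof (rule ccontr)
      assume "ren e (Impl A B) \<notin> \<Gamma>"
      then have "\<not> deriv T \<Gamma> (ren e (Impl A B))" using prime_closed[OF Impl.prems(1)] fv by blast
      then have "\<not> deriv T (insert (ren e A) \<Gamma>) (ren e B)" using deriv.ImplI by auto
      moreover have "infinite (- dom_of \<Gamma>)" using Impl.prems(1) by (simp add: prime_theory_def)
      moreover have "fv C \<subseteq> dom_of \<Gamma>" if "C \<in> insert (ren e A) \<Gamma>" for C
        using that fv prime_fv[OF Impl.prems(1)] by blast
      ultimately obtain \<Delta> where \<Delta>: "prime_theory T \<Delta>" "insert (ren e A) \<Gamma> \<subseteq> \<Delta>" "dom_of \<Gamma> \<subseteq> dom_of \<Delta>"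
        "ren e B \<notin> \<Delta>" using prime_extension[of T "insert (ren e A) \<Gamma>"] fv by metis
      have e: "e i \<in> dom_of \<Delta>" for i using \<Delta>(3) Impl.prems(2) by blast
      have "can_le \<Gamma> \<Delta>" using \<Delta> by (simp add: can_le_def)
      then show False using l Impl.IH(1)[of \<Delta> e, OF \<Delta>(1) e] Impl.IH(2)[of \<Delta> e, OF \<Delta>(1) e] \<Delta>(2,4) by simp
    qed
  next
    assume r: "ren e (Impl A B) \<in> \<Gamma>"
    show "canonical.forces \<Gamma> e (Impl A B)"
      unfolding canonical.forces.simps
    proof (intro allI impI)
      fix \<Delta> assume \<Delta>: "can_le \<Gamma> \<Delta>" "canonical.forces \<Delta> e A"
      then have p: "prime_theory T \<Delta>" and s: "\<Gamma> \<subseteq> \<Delta>" using Impl.prems(1) by (auto simp: can_le_def)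
      have e: "e i \<in> dom_of \<Delta>" for i using s Impl.prems(2)[of i] by (auto simp: dom_of_def)
      have "ren e A \<in> \<Delta>" using \<Delta>(2) Impl.IH(1)[of \<Delta> e, OF p e] by simp
      then have "deriv T \<Delta> (ren e B)" using r s deriv.ImplE[of T \<Delta> "ren e A" "ren e B"] deriv.Hyp by auto
      then have "ren e B \<in> \<Delta>" by (rule prime_closed[OF p]) (use e in \<open>auto simp: fv_ren\<close>)
      then show "canonical.forces \<Delta> e B" using Impl.IH(2)[of \<Delta> e, OF p e] by simp
    qed
  qed
next
  case (Forall A)
  show ?case
  proof
    assume l: "canonical.forces \<Gamma> e (Forall A)"
    show "ren e (Forall A) \<in> \<Gamma>"
    proof (rule ccontr)
      assume "ren e (Forall A) \<notin> \<Gamma>"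
      moreover have fv: "fv (ren e (Forall A)) \<subseteq> dom_of \<Gamma>" using Forall.prems(2) by (auto simp: fv_ren simp del: ren.simps)
      ultimately have nd: "\<not> deriv T \<Gamma> (Forall (ren (up e) A))"
        using prime_closed[OF Forall.prems(1)] by auto
      have inf: "infinite (- dom_of \<Gamma>)" using Forall.prems(1) by (simp add: prime_theory_def)
      \<comment> \<open>A variable outside the current domain serves as the generic counterexample;
        it comes into existence only in the extension.\<close>
      then obtain y where y: "y \<notin> dom_of \<Gamma>" by (metis ComplD finite.emptyI equals0I)
      have "\<not> deriv T \<Gamma> (inst (ren (up e) A) y)"
        using nd AllI_fresh[of T \<Gamma> "ren (up e) A" y] y fv prime_fv[OF Forall.prems(1)] by auto
      moreover have "infinite (- insert y (dom_of \<Gamma>))"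
        using inf by (simp add: Compl_insert)
      moreover have "fv C \<subseteq> insert y (dom_of \<Gamma>)" if "C \<in> \<Gamma>" for C
        using that prime_fv[OF Forall.prems(1)] by blast
      moreover have "fv (inst (ren (up e) A) y) \<subseteq> insert y (dom_of \<Gamma>)"
        using fv_inst[of "ren (up e) A" y] fv by auto
      ultimately obtain \<Delta> where \<Delta>: "prime_theory T \<Delta>" "\<Gamma> \<subseteq> \<Delta>" "insert y (dom_of \<Gamma>) \<subseteq> dom_of \<Delta>"
        "inst (ren (up e) A) y \<notin> \<Delta>" using prime_extension[of T \<Gamma>] by metis
      have e: "(y ## e) i \<in> dom_of \<Delta>" for i using \<Delta>(3) Forall.prems(2) by (auto split: nat.split)
      have "can_le \<Gamma> \<Delta>" using \<Delta> by (simp add: can_le_def)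
      moreover have "can_E \<Delta> y y" using can_E_refl[OF \<Delta>(1)] \<Delta>(3) by simp
      ultimately show False using l Forall.IH[of \<Delta> "y ## e", OF \<Delta>(1) e] \<Delta>(4) by (simp add: inst_ren_up)
    qed
  next
    assume r: "ren e (Forall A) \<in> \<Gamma>"
    show "canonical.forces \<Gamma> e (Forall A)"
      unfolding canonical.forces.simps
    proof (intro allI impI)
      fix \<Delta> x assume \<Delta>: "can_le \<Gamma> \<Delta>" "can_E \<Delta> x x"
      then have p: "prime_theory T \<Delta>" and s: "\<Gamma> \<subseteq> \<Delta>" using Forall.prems(1) by (auto simp: can_le_def)
      have e: "(x ## e) i \<in> dom_of \<Delta>" for i
        using s Forall.prems(2)[of "i - 1"] \<Delta>(2) can_E_refl[OF p] by (cases i) (auto simp: dom_of_def)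
      have "deriv T \<Delta> (inst (ren (up e) A) x)" using r s deriv.AllE deriv.Hyp by auto
      then have "ren (x ## e) A \<in> \<Delta>" unfolding inst_ren_up by (rule prime_closed[OF p]) (use e in \<open>auto simp: fv_ren\<close>)
      then show "canonical.forces \<Delta> (x ## e) A" using Forall.IH[of \<Delta> "x ## e", OF p e] by simp
    qed
  qed
next
  case (Exists A)
  have e: "(x ## e) i \<in> dom_of \<Gamma>" if "x \<in> dom_of \<Gamma>" for x i
    using that Exists.prems(2) by (auto split: nat.split)
  have IH: "canonical.forces \<Gamma> (x ## e) A \<longleftrightarrow> inst (ren (up e) A) x \<in> \<Gamma>" if "x \<in> dom_of \<Gamma>" for x
    using Exists.IH[of \<Gamma> "x ## e", OF Exists.prems(1) e[OF that]] by (simp add: inst_ren_up)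
  show ?case
  proof
    assume "canonical.forces \<Gamma> e (Exists A)"
    then have "deriv T \<Gamma> (ren e (Exists A))"
      using IH can_E_refl[OF Exists.prems(1)] deriv.Hyp deriv.ExI by fastforce
    moreover have "fv (ren e (Exists A)) \<subseteq> dom_of \<Gamma>"
      using Exists.prems(2) by (auto simp: fv_ren simp del: ren.simps)
    ultimately show "ren e (Exists A) \<in> \<Gamma>" using prime_closed[OF Exists.prems(1)] by blast
  next
    assume "ren e (Exists A) \<in> \<Gamma>"
    then obtain x where "x \<in> dom_of \<Gamma>" "inst (ren (up e) A) x \<in> \<Gamma>"
      using Exists.prems(1) by (auto simp: prime_theory_def)
    then show "canonical.forces \<Gamma> e (Exists A)"
      using IH can_E_refl[OF Exists.prems(1)] by auto
  qed
qed

text \<open>HOL cannot quantify over types, so validity is required only in models of the types used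
  by the canonical one, with sets of formulas as worlds and variables as individuals.\<close>

theorem kripke_complete:
  assumes valid: "\<And>(le :: fm set \<Rightarrow> fm set \<Rightarrow> bool) M (E :: fm set \<Rightarrow> nat \<Rightarrow> nat \<Rightarrow> bool) w e.
      kripke le M E \<Longrightarrow>
      (\<And>B w e. B \<in> T \<Longrightarrow> kripke.env E w e \<Longrightarrow> kripke.forces le M E w e B) \<Longrightarrow>
      kripke.env E w e \<Longrightarrow> kripke.forces le M E w e A"
  shows "deriv T {} A"
proof (rule ccontr)
  assume nd: "\<not> deriv T {} A"
  let ?e = "\<lambda>i::nat. 2 * i" and ?V = "range (\<lambda>i::nat. 2 * i)"
  have "ren (\<lambda>i. i div 2) (ren ?e A) = A"
    unfolding ren_ren by (rule ren_ident) simp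
  then have "\<not> deriv T {} (ren ?e A)" using nd theorem_ren[of T "ren ?e A"] by metis
  moreover have "infinite (- ?V)"
  proof -
    have "infinite (range (\<lambda>i::nat. Suc (2 * i)))" by (rule range_inj_infinite) (simp add: inj_def)
    moreover have "range (\<lambda>i::nat. Suc (2 * i)) \<subseteq> - ?V" by (auto, presburger)
    ultimately show ?thesis using finite_subset by blast
  qed
  ultimately obtain \<Gamma> where \<Gamma>: "prime_theory T \<Gamma>" "?V \<subseteq> dom_of \<Gamma>" "ren ?e A \<notin> \<Gamma>"
    using prime_extension[of T "{}" "ren ?e A" ?V] by (auto simp: fv_ren)
  have "canonical.forces \<Gamma> ?e A"
  proof (rule valid)
    show "kripke can_le can_M can_E" by (rule canonical.kripke_axioms)
    show "canonical.env \<Gamma> ?e" using \<Gamma>(2) can_E_refl[OF \<Gamma>(1)] by (auto simp: canonical.env_def)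
  next
    fix B \<Delta> e assume B: "B \<in> T" and e: "canonical.env \<Delta> e"
    then have p: "prime_theory T \<Delta>" by (auto simp: canonical.env_def can_E_def)
    then have e: "e i \<in> dom_of \<Delta>" for i using e can_E_refl by (auto simp: canonical.env_def)
    have "deriv T \<Delta> (ren e B)" using deriv_mono[OF theorem_ren[OF deriv.Ax[OF B]]] by simp
    then have "ren e B \<in> \<Delta>" by (rule prime_closed[OF p]) (use e in \<open>auto simp: fv_ren\<close>)
    then show "canonical.forces \<Delta> e B" using truth[of \<Delta> e, OF p e] by simp
  qed
  then show False using truth[OF \<Gamma>(1), of ?e A] \<Gamma>(2,3) by auto
qed

end

section \<open>Forcing of formulas with named variables\<close>

text \<open>
  A variable is stable from depth \<open>n\<close> on if it denotes there the same binder at all depths.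
\<close>

definition stable :: "nat \<Rightarrow> var \<Rightarrow> bool" where
  "stable n v \<longleftrightarrow> (\<forall>m\<ge>n. v (Suc m) = Suc (v m))"

lemma stable_step: "stable n v \<Longrightarrow> v (Suc n) = Suc (v n)"
  by (simp add: stable_def)

lemma stable_Suc: "stable n v \<Longrightarrow> stable (Suc n) v"
  by (simp add: stable_def)

lemma stable_bound [simp]: "k < n \<Longrightarrow> stable n (\<lambda>m. m - Suc k)"
  by (auto simp: stable_def)

text \<open>The variable that denotes entry \<open>k\<close> of the environment at depth 0; it is
  shifted under binders so that concrete formulas with parameters can be written in the named
  notation.\<close>

definition free_var :: "nat \<Rightarrow> var" ("\<^bold>v") where
  "\<^bold>v k = (\<lambda>m. m + k)"

lemma stable_free_var [simp]: "stable n (\<^bold>v k)"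
  by (simp add: stable_def free_var_def)

lemma free_var_apply [simp]: "\<^bold>v k m = m + k"
  by (simp add: free_var_def)

context kripke
begin

text \<open>This and the next definitions say in HOL what the corresponding formulas force, so that
  the simplifier can eliminate the formulas altogether.\<close>

definition sub :: "'w \<Rightarrow> 'd \<Rightarrow> 'd \<Rightarrow> bool" where
  "sub w a b \<longleftrightarrow> (\<forall>w' x. w \<sqsubseteq> w' \<longrightarrow> M w' x a \<longrightarrow> M w' x b)"

definition upr :: "'w \<Rightarrow> 'd \<Rightarrow> 'd \<Rightarrow> 'd \<Rightarrow> bool" where
  "upr w c a b \<longleftrightarrow> (\<forall>w' x. w \<sqsubseteq> w' \<longrightarrow> E w' x x \<longrightarrow> (M w' x c \<longleftrightarrow> E w' x a \<or> E w' x b))"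

definition opr :: "'w \<Rightarrow> 'd \<Rightarrow> 'd \<Rightarrow> 'd \<Rightarrow> bool" where
  "opr w c a b \<longleftrightarrow> (\<forall>w' x. w \<sqsubseteq> w' \<longrightarrow> E w' x x \<longrightarrow> (M w' x c \<longleftrightarrow> upr w' x a a \<or> upr w' x a b))"

definition rl :: "'w \<Rightarrow> 'd \<Rightarrow> 'd \<Rightarrow> 'd \<Rightarrow> bool" where
  "rl w r a b \<longleftrightarrow> (\<exists>c. M w c r \<and> opr w c a b)"

definition rset :: "'w \<Rightarrow> 'd \<Rightarrow> 'd \<Rightarrow> bool" where
  "rset w X R \<longleftrightarrow> (\<forall>w' r. w \<sqsubseteq> w' \<longrightarrow> M w' r R \<longrightarrow>
     (\<exists>a. E w' a a \<and> sub w' a X \<and> (\<exists>b. E w' b b \<and> sub w' b X \<and> opr w' r a b)))"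

definition clo :: "'w \<Rightarrow> 'd \<Rightarrow> 'd \<Rightarrow> bool" where
  "clo w R Y \<longleftrightarrow> (\<forall>w' a b. w \<sqsubseteq> w' \<longrightarrow> E w' a a \<longrightarrow> E w' b b \<longrightarrow> rl w' R a b \<longrightarrow> sub w' a Y \<longrightarrow>
     (\<exists>x. M w' x b \<and> M w' x Y))"

lemma sub_mono: "sub w a b \<Longrightarrow> w \<sqsubseteq> w' \<Longrightarrow> sub w' a b"
  unfolding sub_def by (meson le_trans)

lemma sub_D: "sub w a b \<Longrightarrow> M w x a \<Longrightarrow> M w x b"
  unfolding sub_def by (meson le_refl)

lemma upr_mono: "upr w c a b \<Longrightarrow> w \<sqsubseteq> w' \<Longrightarrow> upr w' c a b"
  unfolding upr_def by (meson le_trans)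

lemma opr_mono: "opr w c a b \<Longrightarrow> w \<sqsubseteq> w' \<Longrightarrow> opr w' c a b"
  unfolding opr_def by (meson le_trans)

lemma rl_mono: "rl w r a b \<Longrightarrow> w \<sqsubseteq> w' \<Longrightarrow> rl w' r a b"
  unfolding rl_def by (meson M_mono opr_mono)

lemma forces_fMem [simp]: "forces w e ((x \<^bold>\<in> y) n) \<longleftrightarrow> M w (e (x n)) (e (y n))"
  and forces_fEq [simp]: "forces w e ((x \<^bold>= y) n) \<longleftrightarrow> E w (e (x n)) (e (y n))"
  and forces_fConj [simp]: "forces w e ((A \<^bold>\<and> B) n) \<longleftrightarrow> forces w e (A n) \<and> forces w e (B n)"
  and forces_fDisj [simp]: "forces w e ((A \<^bold>\<or> B) n) \<longleftrightarrow> forces w e (A n) \<or> forces w e (B n)"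
  and forces_fImpl [simp]: "forces w e ((A \<^bold>\<longrightarrow> B) n) \<longleftrightarrow>
     (\<forall>w'. w \<sqsubseteq> w' \<longrightarrow> forces w' e (A n) \<longrightarrow> forces w' e (B n))"
  and forces_fIff [simp]: "forces w e ((A \<^bold>\<longleftrightarrow> B) n) \<longleftrightarrow>
     (\<forall>w'. w \<sqsubseteq> w' \<longrightarrow> (forces w' e (A n) \<longleftrightarrow> forces w' e (B n)))"
  and forces_fEx [simp]: "forces w e (fEx C n) \<longleftrightarrow>
     (\<exists>x. E w x x \<and> forces w (x ## e) (C (\<lambda>m. m - Suc n) (Suc n)))"
  and forces_fAll: "forces w e (fAll C n) \<longleftrightarrow>
     (\<forall>w' x. w \<sqsubseteq> w' \<longrightarrow> E w' x x \<longrightarrow> forces w' (x ## e) (C (\<lambda>m. m - Suc n) (Suc n)))"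
  by (auto simp: fMem_def fEq_def fConj_def fDisj_def fImpl_def fIff_def fAll_def fEx_def)

lemma forces_AllD: "forces w e (fAll C n) \<Longrightarrow> E w x x \<Longrightarrow>
    forces w (x ## e) (C (\<lambda>m. m - Suc n) (Suc n))"
  using le_refl unfolding forces_fAll by blast

lemma forces_ImplD: "forces w e ((A \<^bold>\<longrightarrow> B) n) \<Longrightarrow> forces w e (A n) \<Longrightarrow> forces w e (B n)"
  using le_refl unfolding forces_fImpl by blast

text \<open>
  A universal quantifier followed by an implication ranges over one future world only: the second
  one can be absorbed into the first.
\<close>

lemma forces_All_Impl [simp]: "forces w e ((\<^bold>\<forall>x. A x \<^bold>\<longrightarrow> B x) n) \<longleftrightarrow>
    (\<forall>w' x. w \<sqsubseteq> w' \<longrightarrow> E w' x x \<longrightarrow> forces w' (x ## e) (A (\<lambda>m. m - Suc n) (Suc n)) \<longrightarrow>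
      forces w' (x ## e) (B (\<lambda>m. m - Suc n) (Suc n)))"
  unfolding forces_fAll forces_fImpl by (meson le_refl le_trans E_mono)

lemma forces_All_Iff [simp]: "forces w e ((\<^bold>\<forall>x. A x \<^bold>\<longleftrightarrow> B x) n) \<longleftrightarrow>
    (\<forall>w' x. w \<sqsubseteq> w' \<longrightarrow> E w' x x \<longrightarrow> (forces w' (x ## e) (A (\<lambda>m. m - Suc n) (Suc n)) \<longleftrightarrow>
      forces w' (x ## e) (B (\<lambda>m. m - Suc n) (Suc n))))"
  unfolding forces_fAll forces_fIff by (meson le_refl le_trans E_mono)

lemma forces_Ball [simp]: "stable n a \<Longrightarrow> forces w e (fBall a A n) \<longleftrightarrow>
    (\<forall>w' x. w \<sqsubseteq> w' \<longrightarrow> M w' x (e (a n)) \<longrightarrow> forces w' (x ## e) (A (\<lambda>m. m - Suc n) (Suc n)))"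
  unfolding fBall_def forces_All_Impl by (auto simp: stable_step dest: M_dom)

lemma forces_Bex [simp]: "stable n a \<Longrightarrow> forces w e (fBex a A n) \<longleftrightarrow>
    (\<exists>x. M w x (e (a n)) \<and> forces w (x ## e) (A (\<lambda>m. m - Suc n) (Suc n)))"
  unfolding fBex_def by (auto simp: stable_step dest: M_dom)

lemma forces_fSub [simp]: "stable n a \<Longrightarrow> stable n b \<Longrightarrow>
    forces w e ((a \<^bold>\<subseteq> b) n) \<longleftrightarrow> sub w (e (a n)) (e (b n))"
  unfolding fSub_def forces_All_Impl sub_def by (auto simp: stable_step dest: M_dom)

lemma forces_AllSub [simp]: "stable n a \<Longrightarrow> forces w e (fAllSub a A n) \<longleftrightarrow>
    (\<forall>w' x. w \<sqsubseteq> w' \<longrightarrow> E w' x x \<longrightarrow> sub w' x (e (a n)) \<longrightarrow>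
      forces w' (x ## e) (A (\<lambda>m. m - Suc n) (Suc n)))"
  unfolding fAllSub_def forces_All_Impl by (simp add: stable_step stable_Suc)

lemma forces_ExSub [simp]: "stable n a \<Longrightarrow> forces w e (fExSub a A n) \<longleftrightarrow>
    (\<exists>x. E w x x \<and> sub w x (e (a n)) \<and> forces w (x ## e) (A (\<lambda>m. m - Suc n) (Suc n)))"
  unfolding fExSub_def by (simp add: stable_step stable_Suc)

lemma forces_is_upair [simp]: "stable n c \<Longrightarrow> stable n a \<Longrightarrow> stable n b \<Longrightarrow>
    forces w e (is_upair c a b n) \<longleftrightarrow> upr w (e (c n)) (e (a n)) (e (b n))"
  by (simp add: is_upair_def upr_def stable_step)

lemma forces_is_pair [simp]: "stable n c \<Longrightarrow> stable n a \<Longrightarrow> stable n b \<Longrightarrow>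
    forces w e (is_pair c a b n) \<longleftrightarrow> opr w (e (c n)) (e (a n)) (e (b n))"
  by (simp add: is_pair_def opr_def stable_step stable_Suc)

lemma forces_rel [simp]: "stable n r \<Longrightarrow> stable n a \<Longrightarrow> stable n b \<Longrightarrow>
    forces w e (rel r a b n) \<longleftrightarrow> rl w (e (r n)) (e (a n)) (e (b n))"
  by (simp add: rel_def rl_def stable_step stable_Suc)

lemma forces_rule_set [simp]: "stable n X \<Longrightarrow> stable n R \<Longrightarrow>
    forces w e (rule_set X R n) \<longleftrightarrow> rset w (e (X n)) (e (R n))"
  by (simp add: rule_set_def rset_def stable_step stable_Suc)

text \<open>Two quantifiers and the implications lead through several successive worlds. By
  persistence of existence and of \<open>rl\<close> they can all be replaced by the last
  one.\<close>

lemma forces_closed_under [simp]: "stable n R \<Longrightarrow> stable n Y \<Longrightarrow>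
    forces w e (closed_under R Y n) \<longleftrightarrow> clo w (e (R n)) (e (Y n))"
proof (simp add: closed_under_def clo_def forces_fAll stable_step stable_Suc, intro iffI allI impI)
  fix w' a b
  assume "\<forall>w'. w \<sqsubseteq> w' \<longrightarrow> (\<forall>x. E w' x x \<longrightarrow> (\<forall>w'a. w' \<sqsubseteq> w'a \<longrightarrow> (\<forall>xa. E w'a xa xa \<longrightarrow>
      rl w'a (e (R n)) x xa \<longrightarrow> (\<forall>w'. w'a \<sqsubseteq> w' \<longrightarrow> sub w' x (e (Y n)) \<longrightarrow>
      (\<exists>x. E w' x x \<and> M w' x xa \<and> M w' x (e (Y n)))))))"
    and "w \<sqsubseteq> w'" "E w' a a" "E w' b b" "rl w' (e (R n)) a b" "sub w' a (e (Y n))"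
  then show "\<exists>x. M w' x b \<and> M w' x (e (Y n))" using le_refl by blast
next
  fix w1 a w2 b w3
  assume *: "\<forall>w'. w \<sqsubseteq> w' \<longrightarrow> (\<forall>a. E w' a a \<longrightarrow> (\<forall>b. E w' b b \<longrightarrow> rl w' (e (R n)) a b \<longrightarrow>
      sub w' a (e (Y n)) \<longrightarrow> (\<exists>x. M w' x b \<and> M w' x (e (Y n)))))"
    and w: "w \<sqsubseteq> w1" "w1 \<sqsubseteq> w2" "w2 \<sqsubseteq> w3"
    and "E w1 a a" "E w2 b b" "rl w2 (e (R n)) a b" "sub w3 a (e (Y n))"
  moreover have "w \<sqsubseteq> w3" "w1 \<sqsubseteq> w3" using w le_trans by blast+
  ultimately have "\<exists>x. M w3 x b \<and> M w3 x (e (Y n))" using E_mono rl_mono by meson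
  then show "\<exists>x. E w3 x x \<and> M w3 x b \<and> M w3 x (e (Y n))" using M_dom by blast
qed

lemma forces_app1 [simp]: "forces w e (app A [x] n) \<longleftrightarrow> forces w (e (x n) ## (\<lambda>i. e (i + n))) A"
  unfolding app_def forces_ren
  by (rule arg_cong[where f="\<lambda>e. forces w e A"]) (auto simp: fun_eq_iff split: nat.split)

lemma forces_app2 [simp]: "forces w e (app A [x, y] n) \<longleftrightarrow>
    forces w (e (x n) ## e (y n) ## (\<lambda>i. e (i + n))) A"
  unfolding app_def forces_ren
  by (rule arg_cong[where f="\<lambda>e. forces w e A"]) (auto simp: fun_eq_iff split: nat.split)

end

section \<open>Consequences of the axioms\<close>

locale czf = kripke +
  assumes valid: "A \<in> CZF \<union> {NID} \<Longrightarrow> env w e \<Longrightarrow> forces w e A"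
begin

lemma env_const [simp]: "env w (\<lambda>_. x) \<longleftrightarrow> E w x x"
  by (simp add: env_def)

lemma ext:
  assumes "E w a a" "E w b b" "\<And>w' x. w \<sqsubseteq> w' \<Longrightarrow> M w' x a \<longleftrightarrow> M w' x b"
  shows "E w a b"
proof -
  \<comment> \<open>The axiom is closed, so any environment of existing individuals will do; the
    constant one is at hand.\<close>
  have "forces w (\<lambda>_. a) extensionality"
    using assms(1) by (intro valid) (auto simp: CZF_def)
  then have "forces w (\<lambda>_. a) (fAll (\<lambda>a. \<^bold>\<forall>b. (\<^bold>\<forall>x. x \<^bold>\<in> a \<^bold>\<longleftrightarrow> x \<^bold>\<in> b) \<^bold>\<longrightarrow> a \<^bold>= b) 0)"
    by (simp only: extensionality_def)
  from forces_ImplD[OF forces_AllD[OF forces_AllD[OF this assms(1)] assms(2)]] assms(3)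
  show ?thesis by simp
qed

lemma upair_ex:
  assumes "E w a a" "E w b b"
  obtains c where "E w c c" "upr w c a b"
proof -
  have "forces w (\<lambda>_. a) pairing"
    using assms(1) by (intro valid) (auto simp: CZF_def)
  from forces_AllD[OF forces_AllD[OF this[unfolded pairing_def] assms(1)] assms(2)]
  have "\<exists>c. E w c c \<and> upr w c a b" by (simp add: upr_def)
  then show thesis using that by blast
qed

lemma union_ex:
  assumes "E w a a"
  obtains b where "E w b b" "\<And>w' x. w \<sqsubseteq> w' \<Longrightarrow> M w' x b \<longleftrightarrow> (\<exists>y. M w' y a \<and> M w' x y)"
proof -
  have "forces w (\<lambda>_. a) union_ax"
    using assms(1) by (intro valid) (auto simp: CZF_def)
  from forces_AllD[OF this[unfolded union_ax_def] assms]
  have "\<exists>b. E w b b \<and> (\<forall>w' x. w \<sqsubseteq> w' \<longrightarrow> E w' x x \<longrightarrow> M w' x b \<longleftrightarrow> (\<exists>y. M w' y a \<and> M w' x y))"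
    by simp
  then obtain b where "E w b b"
    "\<And>w' x. w \<sqsubseteq> w' \<Longrightarrow> E w' x x \<Longrightarrow> M w' x b \<longleftrightarrow> (\<exists>y. M w' y a \<and> M w' x y)" by blast
  then show thesis using M_dom(1) by (intro that[of b]) blast+
qed

lemma separation_ex:
  assumes "bounded_fm A" "env w e" "E w a a"
  obtains b where "E w b b" "\<And>w' x. w \<sqsubseteq> w' \<Longrightarrow> M w' x b \<longleftrightarrow> M w' x a \<and> forces w' (x ## e) A"
proof -
  have "forces w e (separation A)"
    using assms by (intro valid) (auto simp: CZF_def)
  from forces_AllD[OF this[unfolded separation_def] assms(3)]
  have "\<exists>b. E w b b \<and> (\<forall>w' x. w \<sqsubseteq> w' \<longrightarrow> E w' x x \<longrightarrow>
      M w' x b \<longleftrightarrow> M w' x a \<and> forces w' (x ## e) A)"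
    by simp
  then obtain b where "E w b b"
    "\<And>w' x. w \<sqsubseteq> w' \<Longrightarrow> E w' x x \<Longrightarrow> M w' x b \<longleftrightarrow> M w' x a \<and> forces w' (x ## e) A" by blast
  then show thesis using M_dom(1) by (intro that[of b]) blast+
qed

lemma strong_collection_ex:
  assumes "env w e" "E w a a"
    and "\<forall>w' x. w \<sqsubseteq> w' \<longrightarrow> M w' x a \<longrightarrow> (\<exists>y. E w' y y \<and> forces w' (x ## y ## e) A)"
  shows "\<exists>b. E w b b \<and>
    (\<forall>w' x. w \<sqsubseteq> w' \<longrightarrow> M w' x a \<longrightarrow> (\<exists>y. M w' y b \<and> forces w' (x ## y ## e) A)) \<and>
    (\<forall>w' y. w \<sqsubseteq> w' \<longrightarrow> M w' y b \<longrightarrow> (\<exists>x. M w' x a \<and> forces w' (x ## y ## e) A))"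
proof -
  have "forces w e (strong_collection A)"
    using assms by (intro valid) (auto simp: CZF_def)
  from forces_ImplD[OF forces_AllD[OF this[unfolded strong_collection_def] assms(2)]] assms(3)
  show ?thesis by simp
qed

lemma NID_ex:
  assumes "E w X X" "E w R R" "rset w X R"
  obtains G where "E w G G" "\<And>w' Y. w \<sqsubseteq> w' \<Longrightarrow> M w' Y G \<Longrightarrow> sub w' Y X \<and> clo w' R Y"
    "\<And>w' Y x. w \<sqsubseteq> w' \<Longrightarrow> E w' Y Y \<Longrightarrow> sub w' Y X \<Longrightarrow> clo w' R Y \<Longrightarrow> M w' x Y \<Longrightarrow>
      \<exists>Z. M w' Z G \<and> M w' x Z \<and> sub w' Z Y"
proof -
  have "forces w (\<lambda>_. X) NID"
    using assms by (intro valid) auto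
  from forces_ImplD[OF forces_AllD[OF forces_AllD[OF this[unfolded NID_def] assms(1)] assms(2)]] assms(3)
  have "\<exists>G. E w G G \<and> (\<forall>w' Y. w \<sqsubseteq> w' \<longrightarrow> M w' Y G \<longrightarrow> sub w' Y X \<and> clo w' R Y) \<and>
    (\<forall>w' Y. w \<sqsubseteq> w' \<longrightarrow> E w' Y Y \<longrightarrow> sub w' Y X \<and> clo w' R Y \<longrightarrow>
      (\<forall>w'' x. w' \<sqsubseteq> w'' \<longrightarrow> M w'' x Y \<longrightarrow> (\<exists>Z. M w'' Z G \<and> M w'' x Z \<and> sub w'' Z Y)))"
    by (simp add: set_generated_def stable_Suc)
  then obtain G where G: "E w G G" "\<forall>w' Y. w \<sqsubseteq> w' \<longrightarrow> M w' Y G \<longrightarrow> sub w' Y X \<and> clo w' R Y"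
    "\<forall>w' Y. w \<sqsubseteq> w' \<longrightarrow> E w' Y Y \<longrightarrow> sub w' Y X \<and> clo w' R Y \<longrightarrow>
      (\<forall>w'' x. w' \<sqsubseteq> w'' \<longrightarrow> M w'' x Y \<longrightarrow> (\<exists>Z. M w'' Z G \<and> M w'' x Z \<and> sub w'' Z Y))" by blast
  show thesis by (rule that[OF G(1)]) (use G(2,3) le_refl in blast)+
qed


text \<open>The definition unfolds to a forced formula, so invariance under \<open>E\<close> is an
  instance of \<open>forces_cong\<close>.\<close>

lemma upr_cong: "upr w c a b \<Longrightarrow> E w c c' \<Longrightarrow> E w a a' \<Longrightarrow> E w b b' \<Longrightarrow> upr w c' a' b'"
  using forces_cong[of w "c ## a ## (\<lambda>_. b)" "is_upair (\<^bold>v 0) (\<^bold>v 1) (\<^bold>v 2) 0"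
      "c' ## a' ## (\<lambda>_. b')"]
  by (simp split: nat.split add: numeral_2_eq_2)

lemma opr_cong: "opr w c a b \<Longrightarrow> E w c c' \<Longrightarrow> E w a a' \<Longrightarrow> E w b b' \<Longrightarrow> opr w c' a' b'"
  using forces_cong[of w "c ## a ## (\<lambda>_. b)" "is_pair (\<^bold>v 0) (\<^bold>v 1) (\<^bold>v 2) 0"
      "c' ## a' ## (\<lambda>_. b')"]
  by (simp split: nat.split add: numeral_2_eq_2)

lemma rl_cong: "rl w r a b \<Longrightarrow> E w r r' \<Longrightarrow> E w a a' \<Longrightarrow> E w b b' \<Longrightarrow> rl w r' a' b'"
  using forces_cong[of w "r ## a ## (\<lambda>_. b)" "rel (\<^bold>v 0) (\<^bold>v 1) (\<^bold>v 2) 0"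
      "r' ## a' ## (\<lambda>_. b')"]
  by (simp split: nat.split add: numeral_2_eq_2)

lemma upr_M:
  assumes "E w a a" "E w b b" "upr w c a b"
  shows "M w a c" "M w b c"
  using assms le_refl unfolding upr_def by blast+

lemma upr_cases:
  assumes "upr w c a b" "M w x c"
  shows "E w x a \<or> E w x b"
  using assms le_refl M_dom unfolding upr_def by blast

lemma upr_unique:
  assumes "upr w c a b" "upr w c' a b" "E w c c" "E w c' c'"
  shows "E w c c'"
proof (rule ext[OF assms(3,4)])
  fix w' x assume "w \<sqsubseteq> w'"
  then show "M w' x c \<longleftrightarrow> M w' x c'" using assms(1,2) M_dom(1) unfolding upr_def by metis
qed

lemma opr_members:
  assumes "E w a a" "E w b b" "opr w c a b"
  obtains s t where "M w s c" "upr w s a a" "M w t c" "upr w t a b"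
proof -
  obtain s where s: "E w s s" "upr w s a a" using upair_ex assms by blast
  obtain t where t: "E w t t" "upr w t a b" using upair_ex assms by blast
  have "M w s c" "M w t c" using assms(3) s t le_refl unfolding opr_def by blast+
  with s t that show thesis by blast
qed

lemma opr_cases:
  assumes "opr w c a b" "M w x c"
  shows "upr w x a a \<or> upr w x a b"
  using assms le_refl M_dom unfolding opr_def by blast

lemma opr_unique:
  assumes "opr w c a b" "opr w c' a b" "E w c c" "E w c' c'"
  shows "E w c c'"
proof (rule ext[OF assms(3,4)])
  fix w' x assume "w \<sqsubseteq> w'"
  then show "M w' x c \<longleftrightarrow> M w' x c'" using assms(1,2) M_dom(1) unfolding opr_def by metis
qed

lemma opr_ex:
  assumes a: "E w a a" and b: "E w b b"
  obtains c where "E w c c" "opr w c a b"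
proof -
  obtain s where s: "E w s s" "upr w s a a" using upair_ex[OF a a] by blast
  obtain t where t: "E w t t" "upr w t a b" using upair_ex[OF a b] by blast
  obtain c where c: "E w c c" "upr w c s t" using upair_ex[OF s(1) t(1)] by blast
  have "M w' x c \<longleftrightarrow> upr w' x a a \<or> upr w' x a b" if w': "w \<sqsubseteq> w'" "E w' x x" for w' x
  proof -
    note up = E_mono[OF a w'(1)] E_mono[OF b w'(1)] E_mono[OF s(1) w'(1)] E_mono[OF t(1) w'(1)]
      upr_mono[OF s(2) w'(1)] upr_mono[OF t(2) w'(1)]
    have "M w' x c \<longleftrightarrow> E w' x s \<or> E w' x t" using c(2) w' unfolding upr_def by blast
    also have "E w' x s \<longleftrightarrow> upr w' x a a"
      using up upr_cong[of w' s a a x] upr_unique[of w' x a a s] E_sym w'(2) by blast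
    also have "E w' x t \<longleftrightarrow> upr w' x a b"
      using up upr_cong[of w' t a b x] upr_unique[of w' x a b t] E_sym w'(2) by blast
    finally show ?thesis .
  qed
  then have "opr w c a b" unfolding opr_def by blast
  with c(1) show thesis by (rule that)
qed

text \<open>The usual Kuratowski argument without deciding whether \<open>a\<close> equals
  \<open>b\<close>. The member {a} of \<open>c\<close> contains \<open>a'\<close> in either case, so
  \<open>a = a'\<close>. Then \<open>b'\<close> is \<open>a\<close> or \<open>b\<close>, and
  \<open>b\<close> is \<open>a'\<close> or \<open>b'\<close>, and each combination yields
  \<open>b = b'\<close>.\<close>

lemma opr_inj:
  assumes "opr w c a b" "opr w c a' b'" and D: "E w a a" "E w b b" "E w a' a'" "E w b' b'"
  shows "E w a a'" "E w b b'"
proof -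
  obtain s t where st: "M w s c" "upr w s a a" "M w t c" "upr w t a b"
    using opr_members[OF D(1,2) assms(1)] .
  obtain s' t' where st': "M w s' c" "upr w s' a' a'" "M w t' c" "upr w t' a' b'"
    using opr_members[OF D(3,4) assms(2)] .
  have "M w a' s" using opr_cases[OF assms(2) st(1)] upr_M D by blast
  then show aa: "E w a a'" using upr_cases[OF st(2)] E_sym by blast
  have "M w b t" using upr_M(2)[OF D(1,2) st(4)] .
  have "M w b' t'" using upr_M(2)[OF D(3,4) st'(4)] .
  have "E w b' a \<or> E w b' b"
    using opr_cases[OF assms(1) st'(3)] \<open>M w b' t'\<close> upr_cases by blast
  moreover have "E w b a' \<or> E w b b'"
    using opr_cases[OF assms(2) st(3)] \<open>M w b t\<close> upr_cases by blast
  ultimately show "E w b b'" using aa E_sym E_trans by meson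
qed

lemma rl_M:
  assumes "rl w r a b" "opr w c a b" "E w c c"
  shows "M w c r"
  using assms opr_unique M_cong M_dom unfolding rl_def by meson

end

section \<open>Bounded variants of the formulas for pairs\<close>

text \<open>
  The quantifiers in \<open>is_upair\<close> and \<open>is_pair\<close> are unbounded, which rules them out in instances of
  separation.
\<close>

definition b_upair :: "var \<Rightarrow> var \<Rightarrow> var \<Rightarrow> form" where
  "b_upair c a b = (a \<^bold>\<in> c \<^bold>\<and> b \<^bold>\<in> c \<^bold>\<and> (\<^bold>\<forall>x\<^bold>\<in>c. x \<^bold>= a \<^bold>\<or> x \<^bold>= b))"

definition b_pair :: "var \<Rightarrow> var \<Rightarrow> var \<Rightarrow> form" where
  "b_pair c a b = ((\<^bold>\<forall>x\<^bold>\<in>c. b_upair x a a \<^bold>\<or> b_upair x a b) \<^bold>\<and>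
     (\<^bold>\<exists>x\<^bold>\<in>c. b_upair x a a) \<^bold>\<and> (\<^bold>\<exists>x\<^bold>\<in>c. b_upair x a b))"

definition b_rel :: "var \<Rightarrow> var \<Rightarrow> var \<Rightarrow> form" where
  "b_rel r a b = (\<^bold>\<exists>c\<^bold>\<in>r. b_pair c a b)"

lemma bounded_basic [simp]:
  "bounded_fm ((x \<^bold>\<in> y) n)" "bounded_fm ((x \<^bold>= y) n)"
  "bounded_fm (A n) \<Longrightarrow> bounded_fm (B n) \<Longrightarrow> bounded_fm ((A \<^bold>\<and> B) n)"
  "bounded_fm (A n) \<Longrightarrow> bounded_fm (B n) \<Longrightarrow> bounded_fm ((A \<^bold>\<or> B) n)"
  "bounded_fm (A n) \<Longrightarrow> bounded_fm (B n) \<Longrightarrow> bounded_fm ((A \<^bold>\<longrightarrow> B) n)"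
  by (simp_all add: fMem_def fEq_def fConj_def fDisj_def fImpl_def bounded_fm.intros)

lemma bounded_Ball [simp]: "stable n a \<Longrightarrow> bounded_fm (C (\<lambda>m. m - Suc n) (Suc n)) \<Longrightarrow> bounded_fm (fBall a C n)"
  by (simp add: fBall_def fAll_def fImpl_def fMem_def stable_step bounded_fm.intros)

lemma bounded_Bex [simp]: "stable n a \<Longrightarrow> bounded_fm (C (\<lambda>m. m - Suc n) (Suc n)) \<Longrightarrow> bounded_fm (fBex a C n)"
  by (simp add: fBex_def fEx_def fConj_def fMem_def stable_step bounded_fm.intros)

lemma bounded_b_upair [simp]: "stable n c \<Longrightarrow> bounded_fm (b_upair c a b n)"
  by (simp add: b_upair_def)

lemma bounded_b_pair [simp]: "stable n c \<Longrightarrow> bounded_fm (b_pair c a b n)"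
  by (simp add: b_pair_def)

lemma bounded_b_rel [simp]: "stable n r \<Longrightarrow> bounded_fm (b_rel r a b n)"
  by (simp add: b_rel_def)

context czf
begin

text \<open>Members exist at their world, so the bounded formula also asserts existence of its
  arguments; this accounts for the extra \<open>E\<close> conjuncts compared with
  \<open>upr\<close>.\<close>

lemma forces_b_upair [simp]: "stable n c \<Longrightarrow> stable n a \<Longrightarrow> stable n b \<Longrightarrow>
    forces w e (b_upair c a b n) \<longleftrightarrow> E w (e (c n)) (e (c n)) \<and> E w (e (a n)) (e (a n)) \<and>
      E w (e (b n)) (e (b n)) \<and> upr w (e (c n)) (e (a n)) (e (b n))"
proof -
  have "M w a c \<and> M w b c \<and> (\<forall>w' x. w \<sqsubseteq> w' \<longrightarrow> M w' x c \<longrightarrow> E w' x a \<or> E w' x b) \<longleftrightarrow>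
      E w c c \<and> E w a a \<and> E w b b \<and> upr w c a b" (is "?l \<longleftrightarrow> ?r") for a b c
  proof
    assume l: ?l
    have "M w' x c \<longleftrightarrow> E w' x a \<or> E w' x b" if "w \<sqsubseteq> w'" "E w' x x" for w' x
    proof -
      have "M w' a c" "M w' b c" using l that(1) M_mono by blast+
      then show ?thesis using l that M_cong[of w' a c x c] M_cong[of w' b c x c] E_sym M_dom(2) by blast
    qed
    then show ?r using l M_dom unfolding upr_def by blast
  next
    assume ?r
    then show ?l using upr_M upr_cases upr_mono by blast
  qed
  moreover assume "stable n c" "stable n a" "stable n b"
  ultimately show ?thesis by (simp add: b_upair_def stable_step)
qed

lemma forces_b_pair [simp]: "stable n c \<Longrightarrow> stable n a \<Longrightarrow> stable n b \<Longrightarrow>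
    forces w e (b_pair c a b n) \<longleftrightarrow> E w (e (c n)) (e (c n)) \<and> E w (e (a n)) (e (a n)) \<and>
      E w (e (b n)) (e (b n)) \<and> opr w (e (c n)) (e (a n)) (e (b n))"
proof -
  have "(\<forall>w' x. w \<sqsubseteq> w' \<longrightarrow> M w' x c \<longrightarrow>
        E w' x x \<and> E w' a a \<and> upr w' x a a \<or> E w' x x \<and> E w' a a \<and> E w' b b \<and> upr w' x a b) \<and>
      (\<exists>x. M w x c \<and> E w x x \<and> E w a a \<and> upr w x a a) \<and>
      (\<exists>x. M w x c \<and> E w x x \<and> E w a a \<and> E w b b \<and> upr w x a b) \<longleftrightarrow>
      E w c c \<and> E w a a \<and> E w b b \<and> opr w c a b" (is "?l \<longleftrightarrow> ?r") for a b c
  proof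
    assume l: ?l
    then obtain s t where s: "M w s c" "E w a a" "upr w s a a" and t: "M w t c" "E w b b" "upr w t a b"
      by blast
    have "M w' x c \<longleftrightarrow> upr w' x a a \<or> upr w' x a b" if w': "w \<sqsubseteq> w'" "E w' x x" for w' x
    proof -
      note up = M_mono[OF s(1) w'(1)] M_mono[OF t(1) w'(1)] upr_mono[OF s(3) w'(1)] upr_mono[OF t(3) w'(1)]
      have "E w' s x" if "upr w' x a a" using upr_unique[OF up(3) that] M_dom up w' by blast
      moreover have "E w' t x" if "upr w' x a b" using upr_unique[OF up(4) that] M_dom up w' by blast
      ultimately show ?thesis using l w' up(1,2) M_cong[of w' s c x c] M_cong[of w' t c x c] M_dom(2) by blast
    qed
    then show ?r using s t M_dom unfolding opr_def by blast
  next
    assume r: ?r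
    then obtain s t where st: "M w s c" "upr w s a a" "M w t c" "upr w t a b" using opr_members by blast
    have "upr w' x a a \<or> upr w' x a b" if "w \<sqsubseteq> w'" "M w' x c" for w' x
      using r that opr_mono opr_cases by blast
    then show ?l using r st M_dom(1) E_mono by blast
  qed
  moreover assume "stable n c" "stable n a" "stable n b"
  ultimately show ?thesis by (simp add: b_pair_def stable_step stable_Suc)
qed

lemma forces_b_rel [simp]: "stable n r \<Longrightarrow> stable n a \<Longrightarrow> stable n b \<Longrightarrow>
    forces w e (b_rel r a b n) \<longleftrightarrow> E w (e (a n)) (e (a n)) \<and>
      E w (e (b n)) (e (b n)) \<and> rl w (e (r n)) (e (a n)) (e (b n))"
  by (simp add: b_rel_def rl_def stable_step stable_Suc) (use M_dom(1) in blast)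

end

section \<open>Collection and definable families of rules\<close>

lemma bounded_fm_ren: "bounded_fm A \<Longrightarrow> bounded_fm (ren r A)"
proof (induction arbitrary: r rule: bounded_fm.induct)
  case (7 A j)
  then show ?case by (simp add: bounded_fm.intros)
next
  case (8 A j)
  then show ?case by (simp add: bounded_fm.intros)
qed (simp_all add: bounded_fm.intros)

text \<open>
  The condition that a set \<open>Y\<close> is closed under all rules \<open>({x \<in> X. \<alpha>}, {x \<in> X. \<beta>})\<close>, where \<open>\<alpha>\<close> and
  \<open>\<beta>\<close> have \<open>n\<close> parameters from \<open>U\<close> subject to the condition \<open>C\<close>. The first variables are
  \<open>Y\<close>, \<open>X\<close>, \<open>U\<close>.
\<close>

primrec rules_fm :: "fm \<Rightarrow> fm \<Rightarrow> fm \<Rightarrow> nat \<Rightarrow> fm" where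
  "rules_fm C \<alpha> \<beta> 0 =
    ((\<lambda>_. ren (\<lambda>i. i + 3) C) \<^bold>\<longrightarrow>
     (\<^bold>\<forall>x\<^bold>\<in>\<^bold>v 1. (\<lambda>_. ren (0 ## (\<lambda>i. i + 4)) \<alpha>) \<^bold>\<longrightarrow> x \<^bold>\<in> \<^bold>v 0) \<^bold>\<longrightarrow>
     (\<^bold>\<exists>x\<^bold>\<in>\<^bold>v 1. (\<lambda>_. ren (0 ## (\<lambda>i. i + 4)) \<beta>) \<^bold>\<and> x \<^bold>\<in> \<^bold>v 0)) 0"
| "rules_fm C \<alpha> \<beta> (Suc n) =
    (\<^bold>\<forall>k\<^bold>\<in>\<^bold>v 2. (\<lambda>_. ren (1 ## 2 ## 3 ## 0 ## (\<lambda>i. i + 4)) (rules_fm C \<alpha> \<beta> n))) 0"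

context kripke
begin

lemma forces_ren_eq: "e \<circ> r = e' \<Longrightarrow> forces w e (ren r A) \<longleftrightarrow> forces w e' A"
  by (simp add: forces_ren)

text \<open>The renaming in \<open>rules_fm\<close> moves the newly bound parameter from the front
  to the place after \<open>Y\<close>, \<open>X\<close>, \<open>U\<close>, where the formula for
  fewer parameters expects it. Hence parameters bound later get smaller indices in the rule.\<close>

lemma forces_rules_fm_Suc: "forces w (Y ## X ## U ## e) (rules_fm C \<alpha> \<beta> (Suc n)) \<longleftrightarrow>
    (\<forall>w' k. w \<sqsubseteq> w' \<longrightarrow> M w' k U \<longrightarrow>
      forces w' (Y ## X ## U ## k ## e) (rules_fm C \<alpha> \<beta> n))"
proof -
  have "k ## Y ## X ## U ## e \<circ>
      (1 ## 2 ## 3 ## 0 ## (\<lambda>i. i + 4)) =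
      Y ## X ## U ## k ## e" for k
    by (auto simp: fun_eq_iff eval_nat_numeral split: nat.split)
  note forces_ren_eq[OF this]
  then show ?thesis by (simp del: One_nat_def)
qed

lemma forces_rules_fm_0: "forces w (Y ## X ## U ## e) (rules_fm C \<alpha> \<beta> 0) \<longleftrightarrow>
    (\<forall>w'. w \<sqsubseteq> w' \<longrightarrow> forces w' e C \<longrightarrow>
      (\<forall>w'' x. w' \<sqsubseteq> w'' \<longrightarrow> M w'' x X \<longrightarrow> forces w'' (x ## e) \<alpha> \<longrightarrow> M w'' x Y) \<longrightarrow>
      (\<exists>x. M w' x X \<and> forces w' (x ## e) \<beta> \<and> M w' x Y))" (is "?l \<longleftrightarrow> ?r")
proof -
  have *: "x ## Y ## X ## U ## e \<circ> (0 ## (\<lambda>i. i + 4)) = x ## e" for x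
    by (auto simp: fun_eq_iff eval_nat_numeral split: nat.split)
  have **: "Y ## X ## U ## e \<circ> (\<lambda>i. i + 3) = e"
    by (auto simp: fun_eq_iff eval_nat_numeral)
  have "?l \<longleftrightarrow> (\<forall>w'. w \<sqsubseteq> w' \<longrightarrow> forces w' e C \<longrightarrow> (\<forall>w''. w' \<sqsubseteq> w'' \<longrightarrow>
      (\<forall>w3 x. w'' \<sqsubseteq> w3 \<longrightarrow> M w3 x X \<longrightarrow> (\<forall>w4. w3 \<sqsubseteq> w4 \<longrightarrow> forces w4 (x ## e) \<alpha> \<longrightarrow> M w4 x Y)) \<longrightarrow>
      (\<exists>x. M w'' x X \<and> forces w'' (x ## e) \<beta> \<and> M w'' x Y)))"
    by (simp add: forces_ren_eq[OF *] forces_ren_eq[OF **])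
  also have "\<dots> \<longleftrightarrow> ?r" (is "?m \<longleftrightarrow> ?r")
  proof
    assume m: ?m
    show ?r
    proof (intro allI impI)
      fix w' assume "w \<sqsubseteq> w'" "forces w' e C"
        "\<forall>w'' x. w' \<sqsubseteq> w'' \<longrightarrow> M w'' x X \<longrightarrow> forces w'' (x ## e) \<alpha> \<longrightarrow> M w'' x Y"
      moreover from this(3) have
        "\<forall>w3 x. w' \<sqsubseteq> w3 \<longrightarrow> M w3 x X \<longrightarrow> (\<forall>w4. w3 \<sqsubseteq> w4 \<longrightarrow> forces w4 (x ## e) \<alpha> \<longrightarrow> M w4 x Y)"
        using M_mono le_trans by blast
      ultimately show "\<exists>x. M w' x X \<and> forces w' (x ## e) \<beta> \<and> M w' x Y" using m le_refl by blast
    qed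
  next
    assume r: ?r
    show ?m
    proof (intro allI impI)
      fix w' w'' assume "w \<sqsubseteq> w'" "forces w' e C" "w' \<sqsubseteq> w''"
        "\<forall>w3 x. w'' \<sqsubseteq> w3 \<longrightarrow> M w3 x X \<longrightarrow> (\<forall>w4. w3 \<sqsubseteq> w4 \<longrightarrow> forces w4 (x ## e) \<alpha> \<longrightarrow> M w4 x Y)"
      moreover from this have "w \<sqsubseteq> w''" "forces w'' e C" using le_trans forces_mono by blast+
      ultimately show "\<exists>x. M w'' x X \<and> forces w'' (x ## e) \<beta> \<and> M w'' x Y" using r le_refl by blast
    qed
  qed
  finally show ?thesis .
qed

end

context czf
begin

lemma binary_union_ex:
  assumes "E w a a" "E w b b"
  obtains c where "E w c c" "\<And>w' x. w \<sqsubseteq> w' \<Longrightarrow> M w' x c \<longleftrightarrow> M w' x a \<or> M w' x b"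
proof -
  obtain d where d: "E w d d" "upr w d a b" using upair_ex[OF assms] .
  obtain c where c: "E w c c" "\<And>w' x. w \<sqsubseteq> w' \<Longrightarrow> M w' x c \<longleftrightarrow> (\<exists>y. M w' y d \<and> M w' x y)"
    using union_ex[OF d(1)] by blast
  have "M w' x c \<longleftrightarrow> M w' x a \<or> M w' x b" if w': "w \<sqsubseteq> w'" for w' x
  proof
    assume "M w' x c"
    then obtain y where y: "M w' y d" "M w' x y" using c(2)[OF w'] by blast
    then show "M w' x a \<or> M w' x b"
      using upr_cases[OF upr_mono[OF d(2) w'] y(1)] M_cong M_dom(1) by blast
  next
    assume "M w' x a \<or> M w' x b"
    then show "M w' x c"
      using c(2)[OF w'] upr_M[OF _ _ upr_mono[OF d(2) w']] E_mono[OF _ w'] assms by blast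
  qed
  with c(1) show thesis by (rule that)
qed

text \<open>Strong collection is applied twice: for fixed \<open>x\<close> over \<open>y\<close>,
  which gives a set for that \<open>x\<close>, and then over \<open>x\<close> to collect these sets.
  The union of the outcome is the required bound.\<close>

lemma collection2:
  assumes e: "env w e" and a: "E w a a" and b: "E w b b"
    and ex: "\<And>w' x y. w \<sqsubseteq> w' \<Longrightarrow> M w' x a \<Longrightarrow> M w' y b \<Longrightarrow>
      \<exists>z. E w' z z \<and> forces w' (z ## y ## x ## e) A"
  obtains c where "E w c c"
    "\<And>w' x y. w \<sqsubseteq> w' \<Longrightarrow> M w' x a \<Longrightarrow> M w' y b \<Longrightarrow>
      \<exists>z. M w' z c \<and> forces w' (z ## y ## x ## e) A"
proof -
  define B where "B = (\<^bold>\<forall>y\<^bold>\<in>\<^bold>v 2. \<^bold>\<exists>z\<^bold>\<in>\<^bold>v 1. (\<lambda>_. ren (0 ## 1 ## 2 ## (\<lambda>i. i + 5)) A)) 0"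
  have "z ## y ## x ## c ## b ## e \<circ>
      (0 ## 1 ## 2 ## (\<lambda>i. i + 5)) = z ## y ## x ## e" for x y z c
    by (auto simp: fun_eq_iff eval_nat_numeral split: nat.split)
  note forces_ren_eq[OF this]
  then have B: "forces w (x ## c ## b ## e) B \<longleftrightarrow>
      (\<forall>w' y. w \<sqsubseteq> w' \<longrightarrow> M w' y b \<longrightarrow> (\<exists>z. M w' z c \<and> forces w' (z ## y ## x ## e) A))"
    for w x c
    unfolding B_def by (simp add: eval_nat_numeral)
  have "\<forall>w' x. w \<sqsubseteq> w' \<longrightarrow> M w' x a \<longrightarrow> (\<exists>c. E w' c c \<and> forces w' (x ## c ## b ## e) B)"
  proof (intro allI impI)
    fix w' x assume w': "w \<sqsubseteq> w'" "M w' x a"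
    \<comment> \<open>Strong collection puts the given element at index 0 and the one sought at
      index 1; \<open>A\<close> has them in the opposite order.\<close>
    let ?s = "1 ## 0 ## (\<lambda>i. i + 2) :: nat \<Rightarrow> nat"
    have "y ## z ## f \<circ> ?s = z ## y ## f" for y z and f :: "nat \<Rightarrow> 'b"
      by (auto simp: fun_eq_iff eval_nat_numeral split: nat.split)
    note s = forces_ren_eq[OF this]
    have D: "env w' (x ## e)" "E w' b b"
      using env_mono[OF e w'(1)] w'(2) M_dom E_mono[OF b w'(1)] by auto
    have "\<forall>w'' y. w' \<sqsubseteq> w'' \<longrightarrow> M w'' y b \<longrightarrow>
      (\<exists>z. E w'' z z \<and> forces w'' (y ## z ## x ## e) (ren ?s A))"
      unfolding s using ex[OF le_trans[OF w'(1)] M_mono[OF w'(2)]] by blast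
    from strong_collection_ex[OF D this] show "\<exists>c. E w' c c \<and> forces w' (x ## c ## b ## e) B"
      unfolding B s by (elim exE conjE, intro exI conjI)
  qed
  from strong_collection_ex[OF _ a this] e b obtain d where d: "E w d d"
    "\<forall>w' x. w \<sqsubseteq> w' \<longrightarrow> M w' x a \<longrightarrow> (\<exists>c. M w' c d \<and> forces w' (x ## c ## b ## e) B)"
    by auto
  obtain c where c: "E w c c" "\<And>w' x. w \<sqsubseteq> w' \<Longrightarrow> M w' x c \<longleftrightarrow> (\<exists>y. M w' y d \<and> M w' x y)"
    using union_ex[OF d(1)] by blast
  have "\<exists>z. M w' z c \<and> forces w' (z ## y ## x ## e) A"
    if w': "w \<sqsubseteq> w'" "M w' x a" "M w' y b" for w' x y
  proof -
    obtain u where "M w' u d" "forces w' (x ## u ## b ## e) B" using d(2) w' by blast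
    then show ?thesis using c(2)[OF w'(1)] w'(3) le_refl unfolding B by blast
  qed
  with c(1) show thesis by (rule that)
qed

text \<open>The predicates on subsets of \<open>X\<close> to which NID applies. The rule set has to
  work at all later worlds as well, since generation is used there.\<close>

definition rulable :: "'a \<Rightarrow> 'b \<Rightarrow> ('a \<Rightarrow> 'b \<Rightarrow> bool) \<Rightarrow> bool" where
  "rulable w X K \<longleftrightarrow> (\<exists>R. E w R R \<and> rset w X R \<and>
     (\<forall>w' Y. w \<sqsubseteq> w' \<longrightarrow> E w' Y Y \<longrightarrow> sub w' Y X \<longrightarrow> (clo w' R Y \<longleftrightarrow> K w' Y)))"

lemma rl_union:
  "(\<And>c. M w c R \<Longrightarrow> M w c R') \<Longrightarrow> rl w R a b \<Longrightarrow> rl w R' a b"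
  unfolding rl_def by blast

text \<open>The union of two rule sets imposes both closure conditions.\<close>

lemma rulable_conj:
  assumes "rulable w X K" "rulable w X L"
  shows "rulable w X (\<lambda>w Y. K w Y \<and> L w Y)"
proof -
  obtain R where R: "E w R R" "rset w X R"
    "\<And>w' Y. w \<sqsubseteq> w' \<Longrightarrow> E w' Y Y \<Longrightarrow> sub w' Y X \<Longrightarrow> clo w' R Y \<longleftrightarrow> K w' Y"
    using assms(1) unfolding rulable_def by blast
  obtain S where S: "E w S S" "rset w X S"
    "\<And>w' Y. w \<sqsubseteq> w' \<Longrightarrow> E w' Y Y \<Longrightarrow> sub w' Y X \<Longrightarrow> clo w' S Y \<longleftrightarrow> L w' Y"
    using assms(2) unfolding rulable_def by blast
  obtain T where T: "E w T T" "\<And>w' x. w \<sqsubseteq> w' \<Longrightarrow> M w' x T \<longleftrightarrow> M w' x R \<or> M w' x S"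
    using binary_union_ex[OF R(1) S(1)] by blast
  have "rset w X T" using R(2) S(2) T(2) unfolding rset_def by blast
  moreover have "rl w' T a b \<longleftrightarrow> rl w' R a b \<or> rl w' S a b" if "w \<sqsubseteq> w'" for w' a b
    using T(2)[OF that] unfolding rl_def by blast
  then have "clo w' T Y \<longleftrightarrow> clo w' R Y \<and> clo w' S Y" if "w \<sqsubseteq> w'" for w' Y
    using le_trans[OF that] unfolding clo_def by blast
  ultimately show ?thesis using R(3) S(3) T(1) unfolding rulable_def by blast
qed

lemma rulable_rules_fm_0:
  assumes e: "env w e" and X: "E w X X" and bd: "bounded_fm C" "bounded_fm \<alpha>" "bounded_fm \<beta>"
  shows "rulable w X (\<lambda>w Y. forces w (Y ## X ## U ## e) (rules_fm C \<alpha> \<beta> 0))"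
proof -
  obtain a where a: "E w a a" "\<And>w' x. w \<sqsubseteq> w' \<Longrightarrow> M w' x a \<longleftrightarrow> M w' x X \<and> forces w' (x ## e) \<alpha>"
    using separation_ex[OF bd(2) e X] by blast
  obtain b where b: "E w b b" "\<And>w' x. w \<sqsubseteq> w' \<Longrightarrow> M w' x b \<longleftrightarrow> M w' x X \<and> forces w' (x ## e) \<beta>"
    using separation_ex[OF bd(3) e X] by blast
  obtain r where r: "E w r r" "opr w r a b" using opr_ex[OF a(1) b(1)] .
  obtain R0 where R0: "E w R0 R0" "upr w R0 r r" using upair_ex[OF r(1) r(1)] .
  \<comment> \<open>The condition \<open>C\<close> may be undecided at \<open>w\<close>, so the rule
    set consists of those elements of the singleton of \<open>r\<close> for which \<open>C\<close>
    holds; it acquires its rule at the worlds that force \<open>C\<close>.\<close>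
  obtain R where R: "E w R R" "\<And>w' x. w \<sqsubseteq> w' \<Longrightarrow> M w' x R \<longleftrightarrow> M w' x R0 \<and> forces w' (x ## e) (ren Suc C)"
    using separation_ex[OF bounded_fm_ren[OF bd(1)] e R0(1)] by blast
  have "x ## e \<circ> Suc = e" for x by (simp add: fun_eq_iff)
  then have R': "M w' x R \<longleftrightarrow> E w' x r \<and> forces w' e C" if "w \<sqsubseteq> w'" for w' x
    using R(2)[OF that] R0(2) that M_dom(1) E_sym E_trans unfolding upr_def forces_ren by metis
  have "rset w X R"
    unfolding rset_def
  proof (intro allI impI exI conjI)
    fix w' s assume w': "w \<sqsubseteq> w'" "M w' s R"
    show "E w' a a" "E w' b b" using a(1) b(1) w'(1) E_mono by blast+
    show "sub w' a X" "sub w' b X" using a(2) b(2) w'(1) le_trans unfolding sub_def by blast+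
    show "opr w' s a b"
      using opr_cong[OF opr_mono[OF r(2) w'(1)]] R'[OF w'(1)] w'(2) E_sym \<open>E w' a a\<close> \<open>E w' b b\<close> by blast
  qed
  moreover have "clo w' R Y \<longleftrightarrow> forces w' (Y ## X ## U ## e) (rules_fm C \<alpha> \<beta> 0)"
    if w': "w \<sqsubseteq> w'" "E w' Y Y" "sub w' Y X" for w' Y
    unfolding forces_rules_fm_0
  proof (intro iffI allI impI)
    fix v assume clo: "clo w' R Y" and v: "w' \<sqsubseteq> v" "forces v e C"
      and prem: "\<forall>w'' x. v \<sqsubseteq> w'' \<longrightarrow> M w'' x X \<longrightarrow> forces w'' (x ## e) \<alpha> \<longrightarrow> M w'' x Y"
    have wv: "w \<sqsubseteq> v" using w'(1) v(1) by (rule le_trans)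
    have "rl v R a b" using R'[OF wv] v(2) E_mono[OF r(1) wv] opr_mono[OF r(2) wv] unfolding rl_def by blast
    moreover have "sub v a Y" using prem a(2) le_trans[OF wv] unfolding sub_def by blast
    ultimately have "\<exists>x. M v x b \<and> M v x Y"
      using clo v(1) E_mono[OF a(1) wv] E_mono[OF b(1) wv] unfolding clo_def by blast
    then show "\<exists>x. M v x X \<and> forces v (x ## e) \<beta> \<and> M v x Y" using b(2)[OF wv] by blast
  next
    assume K: "\<forall>v. w' \<sqsubseteq> v \<longrightarrow> forces v e C \<longrightarrow>
        (\<forall>w'' x. v \<sqsubseteq> w'' \<longrightarrow> M w'' x X \<longrightarrow> forces w'' (x ## e) \<alpha> \<longrightarrow> M w'' x Y) \<longrightarrow>
        (\<exists>x. M v x X \<and> forces v (x ## e) \<beta> \<and> M v x Y)"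
    show "clo w' R Y"
      unfolding clo_def
    proof (intro allI impI)
      fix v a' b' assume v: "w' \<sqsubseteq> v" and D: "E v a' a'" "E v b' b'" and rl: "rl v R a' b'" and a': "sub v a' Y"
      have wv: "w \<sqsubseteq> v" using w'(1) v(1) by (rule le_trans)
      obtain c where c: "M v c R" "opr v c a' b'" using rl unfolding rl_def by blast
      have cr: "E v c r" "forces v e C" using R'[OF wv] c(1) by blast+
      have Dab: "E v a a" "E v b b" using a(1) b(1) wv E_mono by blast+
      have "opr v c a b" using opr_cong[OF opr_mono[OF r(2) wv] E_sym[OF cr(1)] Dab] .
      \<comment> \<open>A rule of \<open>R\<close> is given up to \<open>E\<close> only; injectivity
        of pairing identifies its components with \<open>a\<close> and \<open>b\<close>.\<close>
      note eq = opr_inj[OF this c(2) Dab D]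
      have "M w'' x Y" if "v \<sqsubseteq> w''" "M w'' x X" "forces w'' (x ## e) \<alpha>" for w'' x
      proof -
        have "M w'' x a" using a(2)[OF le_trans[OF wv that(1)]] that by blast
        then have "M w'' x a'" using M_cong E_mono[OF eq(1) that(1)] M_dom(1) by blast
        then show ?thesis using a' that(1) unfolding sub_def by blast
      qed
      then obtain x where x: "M v x X" "forces v (x ## e) \<beta>" "M v x Y" using K v cr(2) by blast
      then have "M v x b" using b(2)[OF wv] by blast
      then have "M v x b'" using M_cong eq(2) M_dom(1) by blast
      with x show "\<exists>x. M v x b' \<and> M v x Y" by blast
    qed
  qed
  ultimately show ?thesis using R(1) unfolding rulable_def by blast
qed

text \<open>For each value of the outermost parameter the induction hypothesis gives a rule set.
  Strong collection gathers such sets and their union handles all values. Both halves of strong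
  collection matter: the first supplies the rules for each value, the second excludes rules that
  belong to no value.\<close>

lemma rulable_rules_fm:
  assumes "env w e" "E w X X" "E w U U" and bd: "bounded_fm C" "bounded_fm \<alpha>" "bounded_fm \<beta>"
  shows "rulable w X (\<lambda>w Y. forces w (Y ## X ## U ## e) (rules_fm C \<alpha> \<beta> n))"
  using assms(1-3)
proof (induction n arbitrary: w e)
  case 0
  then show ?case using rulable_rules_fm_0[OF _ _ bd] by blast
next
  case (Suc n)
  let ?K = "rules_fm C \<alpha> \<beta> n"
  \<comment> \<open>Strong collection, unlike separation, accepts unbounded formulas, so
    \<open>\<psi>\<close> may state the correctness of the rule set \<open>R\<close> for the value
    \<open>k\<close> with a quantifier over all subsets of \<open>X\<close>.\<close>
  define \<psi> where "\<psi> = (rule_set (\<^bold>v 2) (\<^bold>v 1) \<^bold>\<and> (\<^bold>\<forall>Y\<^bold>\<subseteq>\<^bold>v 2. closed_under (\<^bold>v 1) Y \<^bold>\<longleftrightarrow>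
    (\<lambda>_. ren (0 ## 3 ## 4 ## 1 ## (\<lambda>i. i + 5)) ?K))) 0"
  have "Y ## k ## R ## X ## U ## e \<circ>
      (0 ## 3 ## 4 ## 1 ## (\<lambda>i. i + 5)) =
      Y ## X ## U ## k ## e" for Y k R
    by (auto simp: fun_eq_iff eval_nat_numeral split: nat.split)
  note forces_ren_eq[OF this]
  then have \<psi>: "forces w (k ## R ## X ## U ## e) \<psi> \<longleftrightarrow> rset w X R \<and>
      (\<forall>w' Y. w \<sqsubseteq> w' \<longrightarrow> E w' Y Y \<longrightarrow> sub w' Y X \<longrightarrow> (\<forall>w''. w' \<sqsubseteq> w'' \<longrightarrow>
        (clo w'' R Y \<longleftrightarrow> forces w'' (Y ## X ## U ## k ## e) ?K)))" for w k R
    unfolding \<psi>_def by (simp add: eval_nat_numeral)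
  have "\<forall>w' k. w \<sqsubseteq> w' \<longrightarrow> M w' k U \<longrightarrow>
    (\<exists>R. E w' R R \<and> forces w' (k ## R ## X ## U ## e) \<psi>)"
  proof (intro allI impI)
    fix w' k assume w': "w \<sqsubseteq> w'" "M w' k U"
    have "env w' (k ## e)" "E w' X X" "E w' U U"
      using Suc.prems env_mono[OF _ w'(1)] E_mono[OF _ w'(1)] w'(2) M_dom(1) by auto
    from Suc.IH[OF this] obtain R where R: "E w' R R" "rset w' X R"
      "\<And>w'' Y. w' \<sqsubseteq> w'' \<Longrightarrow> E w'' Y Y \<Longrightarrow> sub w'' Y X \<Longrightarrow>
        clo w'' R Y \<longleftrightarrow> forces w'' (Y ## X ## U ## k ## e) ?K"
      unfolding rulable_def by blast
    then show "\<exists>R. E w' R R \<and> forces w' (k ## R ## X ## U ## e) \<psi>"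
      unfolding \<psi> using le_trans E_mono sub_mono by meson
  qed
  from strong_collection_ex[OF _ Suc.prems(3) this] Suc.prems obtain d where d: "E w d d"
    "\<forall>w' k. w \<sqsubseteq> w' \<longrightarrow> M w' k U \<longrightarrow>
      (\<exists>R. M w' R d \<and> forces w' (k ## R ## X ## U ## e) \<psi>)"
    "\<forall>w' R. w \<sqsubseteq> w' \<longrightarrow> M w' R d \<longrightarrow>
      (\<exists>k. M w' k U \<and> forces w' (k ## R ## X ## U ## e) \<psi>)"
    by auto
  obtain S where S: "E w S S" "\<And>w' x. w \<sqsubseteq> w' \<Longrightarrow> M w' x S \<longleftrightarrow> (\<exists>R. M w' R d \<and> M w' x R)"
    using union_ex[OF d(1)] by blast
  have "rset w X S"
    unfolding rset_def
  proof (intro allI impI)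
    fix w' r assume w': "w \<sqsubseteq> w'" "M w' r S"
    then obtain R where R: "M w' R d" "M w' r R" using S(2) by blast
    then have "rset w' X R" using d(3) w'(1) \<psi> by blast
    then show "\<exists>a. E w' a a \<and> sub w' a X \<and> (\<exists>b. E w' b b \<and> sub w' b X \<and> opr w' r a b)"
      using R(2) le_refl unfolding rset_def by blast
  qed
  moreover have "clo w' S Y \<longleftrightarrow> forces w' (Y ## X ## U ## e) (rules_fm C \<alpha> \<beta> (Suc n))"
    if w': "w \<sqsubseteq> w'" and Y: "E w' Y Y" "sub w' Y X" for w' Y
    unfolding forces_rules_fm_Suc
  proof (intro iffI allI impI)
    fix v k assume clo: "clo w' S Y" and v: "w' \<sqsubseteq> v" "M v k U"
    have wv: "w \<sqsubseteq> v" using w' v(1) by (rule le_trans)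
    obtain R where R: "M v R d" "forces v (k ## R ## X ## U ## e) \<psi>"
      using d(2) wv v(2) by blast
    have "rl v' S a b" if "v \<sqsubseteq> v'" "rl v' R a b" for v' a b
      using rl_union[of v' R S] S(2)[OF le_trans[OF wv that(1)]] M_mono[OF R(1) that(1)] that(2) by blast
    then have "clo v R Y" using clo v(1) le_trans unfolding clo_def by blast
    then show "forces v (Y ## X ## U ## k ## e) ?K"
      using R(2) E_mono[OF Y(1) v(1)] sub_mono[OF Y(2) v(1)] le_refl unfolding \<psi> by blast
  next
    assume K: "\<forall>v k. w' \<sqsubseteq> v \<longrightarrow> M v k U \<longrightarrow> forces v (Y ## X ## U ## k ## e) ?K"
    show "clo w' S Y"
      unfolding clo_def
    proof (intro allI impI)
      fix v a b assume v: "w' \<sqsubseteq> v" and D: "E v a a" "E v b b" and rl: "rl v S a b" and a: "sub v a Y"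
      have wv: "w \<sqsubseteq> v" using w' v(1) by (rule le_trans)
      obtain c where c: "M v c S" "opr v c a b" using rl unfolding rl_def by blast
      then obtain R where R: "M v R d" "M v c R" using S(2)[OF wv] by blast
      then obtain k where k: "M v k U" "forces v (k ## R ## X ## U ## e) \<psi>"
        using d(3) wv by blast
      then have "clo v R Y"
        using K v E_mono[OF Y(1) v(1)] sub_mono[OF Y(2) v(1)] le_refl unfolding \<psi> by blast
      moreover have "rl v R a b" using R(2) c(2) unfolding rl_def by blast
      ultimately show "\<exists>x. M v x b \<and> M v x Y" using D a le_refl unfolding clo_def by blast
    qed
  qed
  ultimately show ?case using S(1) unfolding rulable_def by blast
qed

end

section \<open>Morphisms as closed sets\<close>

text \<open>The element \<open>x\<close> is the code \<open>({p}, {q})\<close>, which stands for the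
  pair \<open>(p, q)\<close> of a morphism; \<open>U\<close> must contain the two
  singletons.\<close>

definition b_point :: "var \<Rightarrow> var \<Rightarrow> var \<Rightarrow> var \<Rightarrow> form" where
  "b_point U x p q = (\<^bold>\<exists>s\<^bold>\<in>U. \<^bold>\<exists>t\<^bold>\<in>U. b_pair x s t \<^bold>\<and> b_upair s p p \<^bold>\<and> b_upair t q q)"

text \<open>\<open>S\<close> is one of the basic covers of \<open>p\<close>, that is, a member of a
  value \<open>B\<close> of \<open>BCov\<close> at \<open>p\<close>, where \<open>B\<close> is
  sought in \<open>U\<close>.\<close>

definition b_cov :: "var \<Rightarrow> var \<Rightarrow> var \<Rightarrow> var \<Rightarrow> form" where
  "b_cov U Bc p S = (\<^bold>\<exists>B\<^bold>\<in>U. b_rel Bc p B \<^bold>\<and> S \<^bold>\<in> B)"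

lemma bounded_b_point [simp]: "stable n U \<Longrightarrow> stable n x \<Longrightarrow> bounded_fm (b_point U x p q n)"
  by (simp add: b_point_def stable_Suc)

lemma bounded_b_cov [simp]: "stable n U \<Longrightarrow> stable n Bc \<Longrightarrow> bounded_fm (b_cov U Bc p S n)"
  by (simp add: b_cov_def stable_Suc)

context kripke
begin

definition point :: "'w \<Rightarrow> 'd \<Rightarrow> 'd \<Rightarrow> 'd \<Rightarrow> bool" where
  "point w x p q \<longleftrightarrow> (\<exists>s t. E w s s \<and> E w t t \<and> upr w s p p \<and> upr w t q q \<and> opr w x s t)"

definition bcov :: "'w \<Rightarrow> 'd \<Rightarrow> 'd \<Rightarrow> 'd \<Rightarrow> bool" where
  "bcov w Bc p S \<longleftrightarrow> (\<exists>B. E w B B \<and> rl w Bc p B \<and> M w S B)"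

definition pt :: "'w \<Rightarrow> 'd \<Rightarrow> 'd \<Rightarrow> 'd \<Rightarrow> bool" where
  "pt w Y p q \<longleftrightarrow> (\<exists>x. M w x Y \<and> point w x p q)"

lemma point_mono: "point w x p q \<Longrightarrow> w \<sqsubseteq> w' \<Longrightarrow> point w' x p q"
  unfolding point_def by (meson E_mono upr_mono opr_mono)

definition rule_at :: "'w \<Rightarrow> fm \<Rightarrow> fm \<Rightarrow> fm \<Rightarrow> 'd \<Rightarrow> 'd \<Rightarrow> (nat \<Rightarrow> 'd) \<Rightarrow> bool" where
  "rule_at w C \<alpha> \<beta> X Y e \<longleftrightarrow> (forces w e C \<longrightarrow>
     (\<forall>w' x. w \<sqsubseteq> w' \<longrightarrow> M w' x X \<longrightarrow> forces w' (x ## e) \<alpha> \<longrightarrow> M w' x Y) \<longrightarrow>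
     (\<exists>x. M w x X \<and> forces w (x ## e) \<beta> \<and> M w x Y))"

text \<open>All parameter quantifiers are merged into one quantification over lists at a single
  later world. Folding pushes the entries one after another, so the last entry ends up at index
  0.\<close>

lemma forces_rules_fm: "forces w (Y ## X ## U ## e) (rules_fm C \<alpha> \<beta> n) \<longleftrightarrow>
    (\<forall>w'. w \<sqsubseteq> w' \<longrightarrow> (\<forall>ks. length ks = n \<longrightarrow> (\<forall>k\<in>set ks. M w' k U) \<longrightarrow>
      rule_at w' C \<alpha> \<beta> X Y (fold case_nat ks e)))"
proof (induction n arbitrary: w e)
  case 0
  then show ?case by (simp add: forces_rules_fm_0 rule_at_def del: rules_fm.simps)
next
  case (Suc n)
  show ?case
    unfolding forces_rules_fm_Suc Suc.IH
  proof (intro iffI allI impI)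
    fix w' and ks :: "'d list"
    assume *: "\<forall>w' k. w \<sqsubseteq> w' \<longrightarrow> M w' k U \<longrightarrow> (\<forall>w''. w' \<sqsubseteq> w'' \<longrightarrow> (\<forall>ks. length ks = n \<longrightarrow>
        (\<forall>k\<in>set ks. M w'' k U) \<longrightarrow> rule_at w'' C \<alpha> \<beta> X Y (fold case_nat ks (k ## e))))"
      and w': "w \<sqsubseteq> w'" "length ks = Suc n" "\<forall>k\<in>set ks. M w' k U"
    then obtain k ks' where "ks = k # ks'" by (cases ks) auto
    then show "rule_at w' C \<alpha> \<beta> X Y (fold case_nat ks e)" using * w' le_refl by simp
  next
    fix w' k w'' and ks :: "'d list"
    assume *: "\<forall>w'. w \<sqsubseteq> w' \<longrightarrow> (\<forall>ks. length ks = Suc n \<longrightarrow> (\<forall>k\<in>set ks. M w' k U) \<longrightarrow>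
        rule_at w' C \<alpha> \<beta> X Y (fold case_nat ks e))"
      and w': "w \<sqsubseteq> w'" "M w' k U" "w' \<sqsubseteq> w''" "length ks = n" "\<forall>k\<in>set ks. M w'' k U"
    show "rule_at w'' C \<alpha> \<beta> X Y (fold case_nat ks (k ## e))"
      using *[THEN spec, THEN mp, OF le_trans[OF w'(1,3)], THEN spec[of _ "k # ks"]] w' M_mono[OF w'(2,3)]
      by simp
  qed
qed

lemma all_lists_3: "(\<forall>ks. length ks = 3 \<longrightarrow> Q ks) \<longleftrightarrow> (\<forall>a b c. Q [a, b, c])"
  and all_lists_4: "(\<forall>ks. length ks = 4 \<longrightarrow> Q ks) \<longleftrightarrow> (\<forall>a b c d. Q [a, b, c, d])"
  by (auto simp: eval_nat_numeral length_Suc_conv)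

end

context czf
begin

lemma forces_b_point: "stable n U \<Longrightarrow> stable n x \<Longrightarrow> stable n p \<Longrightarrow> stable n q \<Longrightarrow>
    forces w e (b_point U x p q n) \<longleftrightarrow>
    E w (e (x n)) (e (x n)) \<and> E w (e (p n)) (e (p n)) \<and> E w (e (q n)) (e (q n)) \<and>
    (\<exists>s t. M w s (e (U n)) \<and> M w t (e (U n)) \<and> opr w (e (x n)) s t \<and>
      upr w s (e (p n)) (e (p n)) \<and> upr w t (e (q n)) (e (q n)))"
  by (simp add: b_point_def stable_step stable_Suc) (use M_dom(1) in blast)

lemma forces_b_cov: "stable n U \<Longrightarrow> stable n Bc \<Longrightarrow> stable n p \<Longrightarrow> stable n S \<Longrightarrow>
    forces w e (b_cov U Bc p S n) \<longleftrightarrow> E w (e (p n)) (e (p n)) \<and>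
    (\<exists>B. M w B (e (U n)) \<and> rl w (e (Bc n)) (e (p n)) B \<and> M w (e (S n)) B)"
  by (simp add: b_cov_def stable_step stable_Suc) (use M_dom(1) in blast)

lemma point_cong:
  assumes "point w x p q" "E w x x'" "E w p p'" "E w q q'"
  shows "point w x' p' q'"
  using assms upr_cong opr_cong unfolding point_def by meson

lemma point_unique:
  assumes "point w x p q" "point w x' p q" "E w x x" "E w x' x'"
  shows "E w x x'"
proof -
  obtain s t where s: "E w s s" "E w t t" "upr w s p p" "upr w t q q" "opr w x s t"
    using assms(1) unfolding point_def by blast
  obtain s' t' where s': "E w s' s'" "E w t' t'" "upr w s' p p" "upr w t' q q" "opr w x' s' t'"
    using assms(2) unfolding point_def by blast
  have "E w s' s" "E w t' t" using upr_unique s s' by blast+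
  then have "opr w x' s t" using opr_cong[OF s'(5) assms(4)] by blast
  then show ?thesis using opr_unique[OF s(5)] assms(3,4) by blast
qed

lemma rulable_cong:
  assumes "rulable w X K" "\<And>w' Y. w \<sqsubseteq> w' \<Longrightarrow> E w' Y Y \<Longrightarrow> sub w' Y X \<Longrightarrow> K w' Y \<longleftrightarrow> L w' Y"
  shows "rulable w X L"
  using assms unfolding rulable_def by blast

end

section \<open>The rules for the individual conditions on a morphism\<close>

text \<open>
  \<open>BP\<close> and \<open>BQ\<close> are the functions \<open>BCov\<close> of the two spaces, \<open>SS\<close> and \<open>VV\<close> are the sets that the
  components of the codes \<open>(S, V)\<close> are taken from, and \<open>U\<close> bounds all quantifiers of the rules.
\<close>

locale point_rules = czf +
  fixes w :: 'a and P Q leP leQ BP BQ U SS VV X :: 'b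
  assumes dom: "E w P P" "E w Q Q" "E w leP leP" "E w leQ leQ" "E w BP BP" "E w BQ BQ"
      "E w U U" "E w SS SS" "E w VV VV" "E w X X"
    and P_U: "sub w P U" and Q_U: "sub w Q U" and SS_U: "sub w SS U" and VV_U: "sub w VV U"
    and BP_U: "\<And>v p B. w \<sqsubseteq> v \<Longrightarrow> M v p P \<Longrightarrow> E v B B \<Longrightarrow> rl v BP p B \<Longrightarrow> M v B U"
    and BQ_U: "\<And>v q B. w \<sqsubseteq> v \<Longrightarrow> M v q Q \<Longrightarrow> E v B B \<Longrightarrow> rl v BQ q B \<Longrightarrow> M v B U"
    and single_P: "\<And>v p. w \<sqsubseteq> v \<Longrightarrow> M v p P \<Longrightarrow> \<exists>s. M v s SS \<and> upr v s p p"
    and single_Q: "\<And>v q. w \<sqsubseteq> v \<Longrightarrow> M v q Q \<Longrightarrow> \<exists>t. M v t VV \<and> upr v t q q"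
    and bcov_P: "\<And>v p S. w \<sqsubseteq> v \<Longrightarrow> M v p P \<Longrightarrow> bcov v BP p S \<Longrightarrow> M v S SS \<and> sub v S P"
    and bcov_Q: "\<And>v q T. w \<sqsubseteq> v \<Longrightarrow> M v q Q \<Longrightarrow> bcov v BQ q T \<Longrightarrow> M v T VV \<and> sub v T Q"
    and Q_VV: "M w Q VV"
    and meet_Q: "\<And>v q0 q1. w \<sqsubseteq> v \<Longrightarrow> M v q0 Q \<Longrightarrow> M v q1 Q \<Longrightarrow> \<exists>V. M v V VV \<and>
      (\<forall>v' q. v \<sqsubseteq> v' \<longrightarrow> (M v' q V \<longleftrightarrow> M v' q Q \<and> rl v' leQ q q0 \<and> rl v' leQ q q1))"
    and pair_X: "\<And>v S V. w \<sqsubseteq> v \<Longrightarrow> M v S SS \<Longrightarrow> M v V VV \<Longrightarrow> \<exists>x. M v x X \<and> opr v x S V"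
begin

abbreviation params :: "nat \<Rightarrow> 'b" where
  "params \<equiv> P ## Q ## leP ## leQ ## BP ## BQ ## U ## SS ## VV ## (\<lambda>_. P)"

lemma env_params: "env w params"
  by (simp add: dom)

lemma P_in_U: "w \<sqsubseteq> v \<Longrightarrow> M v p P \<Longrightarrow> M v p U"
  and Q_in_U: "w \<sqsubseteq> v \<Longrightarrow> M v p Q \<Longrightarrow> M v p U"
  and SS_in_U: "w \<sqsubseteq> v \<Longrightarrow> M v p SS \<Longrightarrow> M v p U"
  and VV_in_U: "w \<sqsubseteq> v \<Longrightarrow> M v p VV \<Longrightarrow> M v p U"
  using P_U Q_U SS_U VV_U unfolding sub_def by blast+

text \<open>The singletons of \<open>p\<close> and \<open>q\<close> occur in \<open>SS\<close> and
  \<open>VV\<close>, hence in \<open>U\<close>, and are unique up to \<open>E\<close>; thus the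
  bound \<open>U\<close> loses nothing.\<close>

lemma point_bounded:
  assumes "w \<sqsubseteq> v" "M v p P" "M v q Q"
  shows "(\<exists>s t. M v s U \<and> M v t U \<and> opr v x s t \<and> upr v s p p \<and> upr v t q q) \<longleftrightarrow> point v x p q"
proof
  assume "point v x p q"
  then obtain s t where s: "E v s s" "E v t t" "upr v s p p" "upr v t q q" "opr v x s t"
    unfolding point_def by blast
  obtain s' where s': "M v s' SS" "upr v s' p p" using single_P assms by blast
  obtain t' where t': "M v t' VV" "upr v t' q q" using single_Q assms by blast
  have "E v s' s" "E v t' t" using upr_unique s s' t' M_dom(1) by blast+
  then have "M v s U" "M v t U"
    using M_cong[OF SS_in_U[OF assms(1) s'(1)]] M_cong[OF VV_in_U[OF assms(1) t'(1)]]
      E_mono[OF dom(7) assms(1)] by blast+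
  with s show "\<exists>s t. M v s U \<and> M v t U \<and> opr v x s t \<and> upr v s p p \<and> upr v t q q" by blast
next
  assume "\<exists>s t. M v s U \<and> M v t U \<and> opr v x s t \<and> upr v s p p \<and> upr v t q q"
  then show "point v x p q" using M_dom(1) unfolding point_def by blast
qed

lemma bcov_bounded_P:
  assumes "w \<sqsubseteq> v" "M v p P"
  shows "(\<exists>B. M v B U \<and> rl v BP p B \<and> M v S B) \<longleftrightarrow> bcov v BP p S"
  using BP_U[OF assms] M_dom(1) unfolding bcov_def by blast

lemma bcov_bounded_Q:
  assumes "w \<sqsubseteq> v" "M v q Q"
  shows "(\<exists>B. M v B U \<and> rl v BQ q B \<and> M v S B) \<longleftrightarrow> bcov v BQ q S"
  using BQ_U[OF assms] M_dom(1) unfolding bcov_def by blast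

lemma point_ex:
  assumes "w \<sqsubseteq> v" "M v p P" "M v q Q"
  obtains x where "M v x X" "point v x p q"
proof -
  obtain s where s: "M v s SS" "upr v s p p" using single_P assms by blast
  obtain t where t: "M v t VV" "upr v t q q" using single_Q assms by blast
  obtain x where x: "M v x X" "opr v x s t" using pair_X[OF assms(1) s(1) t(1)] by blast
  then have "point v x p q" using s t M_dom(1) unfolding point_def by blast
  with x(1) show thesis by (rule that)
qed

text \<open>A code exists in \<open>X\<close> and is unique up to \<open>E\<close>, so "all codes of
  \<open>(p, q)\<close> lie in \<open>Y\<close>", which is how a premise of a rule reads, agrees
  with "some code lies in \<open>Y\<close>".\<close>

lemma pt_prem:
  assumes v: "w \<sqsubseteq> v" "sub v Y X" "M v p P" "M v q Q"
  shows "(\<forall>v' x. v \<sqsubseteq> v' \<longrightarrow> M v' x X \<longrightarrow> point v' x p q \<longrightarrow> M v' x Y) \<longleftrightarrow> pt v Y p q"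
proof
  assume *: "\<forall>v' x. v \<sqsubseteq> v' \<longrightarrow> M v' x X \<longrightarrow> point v' x p q \<longrightarrow> M v' x Y"
  obtain x where "M v x X" "point v x p q" using point_ex[OF v(1,3,4)] .
  then show "pt v Y p q" using * le_refl unfolding pt_def by blast
next
  assume "pt v Y p q"
  then obtain y where y: "M v y Y" "point v y p q" unfolding pt_def by blast
  show "\<forall>v' x. v \<sqsubseteq> v' \<longrightarrow> M v' x X \<longrightarrow> point v' x p q \<longrightarrow> M v' x Y"
  proof (intro allI impI)
    fix v' x assume v': "v \<sqsubseteq> v'" "M v' x X" "point v' x p q"
    have "M v' y Y" "point v' y p q" using y v'(1) M_mono point_mono by blast+
    then show "M v' x Y" using point_unique[of v' y p q x] v'(2,3) M_dom M_cong by blast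
  qed
qed

lemma pt_conc:
  "sub v Y X \<Longrightarrow> (\<exists>x. M v x X \<and> point v x p q \<and> M v x Y) \<longleftrightarrow> pt v Y p q"
  unfolding pt_def using sub_D by blast

lemma rl_prem:
  assumes v: "w \<sqsubseteq> v" "sub v Y X" "M v S SS" "M v V VV"
  shows "(\<forall>v' x. v \<sqsubseteq> v' \<longrightarrow> M v' x X \<longrightarrow> opr v' x S V \<longrightarrow> M v' x Y) \<longleftrightarrow> rl v Y S V"
proof
  assume *: "\<forall>v' x. v \<sqsubseteq> v' \<longrightarrow> M v' x X \<longrightarrow> opr v' x S V \<longrightarrow> M v' x Y"
  obtain x where "M v x X" "opr v x S V" using pair_X[OF v(1,3,4)] by blast
  then show "rl v Y S V" using * le_refl unfolding rl_def by blast
next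
  assume "rl v Y S V"
  then show "\<forall>v' x. v \<sqsubseteq> v' \<longrightarrow> M v' x X \<longrightarrow> opr v' x S V \<longrightarrow> M v' x Y"
    using rl_mono rl_M M_dom(1) by blast
qed

text \<open>The form in which the conditions are verified: \<open>at\<close> computes a single rule,
  and by \<open>U\<close> the side condition itself confines the parameters to the bounding set, so
  that the bounds disappear from the result.\<close>

lemma rulable_3:
  assumes bd: "bounded_fm C" "bounded_fm \<alpha>" "bounded_fm \<beta>"
    and U: "\<And>v a b c. w \<sqsubseteq> v \<Longrightarrow> K v a b c \<Longrightarrow> M v a U \<and> M v b U \<and> M v c U"
    and at: "\<And>v Y a b c. w \<sqsubseteq> v \<Longrightarrow> sub v Y X \<Longrightarrow>
      rule_at v C \<alpha> \<beta> X Y (c ## b ## a ## params) \<longleftrightarrow> (K v a b c \<longrightarrow> L v Y a b c)"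
  shows "rulable w X (\<lambda>v Y. \<forall>v'. v \<sqsubseteq> v' \<longrightarrow> (\<forall>a b c. K v' a b c \<longrightarrow> L v' Y a b c))"
proof (rule rulable_cong[OF rulable_rules_fm[OF env_params dom(10) dom(7) bd, of 3]])
  fix v Y assume v: "w \<sqsubseteq> v" "E v Y Y" "sub v Y X"
  have "(\<forall>a b c. (\<forall>k\<in>set [a, b, c]. M v' k U) \<longrightarrow> rule_at v' C \<alpha> \<beta> X Y (fold case_nat [a, b, c] params)) \<longleftrightarrow>
      (\<forall>a b c. K v' a b c \<longrightarrow> L v' Y a b c)" if "v \<sqsubseteq> v'" for v'
    using at[OF le_trans[OF v(1) that] sub_mono[OF v(3) that]] U[OF le_trans[OF v(1) that]] by simp blast
  then show "forces v (Y ## X ## U ## params) (rules_fm C \<alpha> \<beta> 3) \<longleftrightarrow>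
      (\<forall>v'. v \<sqsubseteq> v' \<longrightarrow> (\<forall>a b c. K v' a b c \<longrightarrow> L v' Y a b c))"
    unfolding forces_rules_fm all_lists_3 by blast
qed

lemma rulable_4:
  assumes bd: "bounded_fm C" "bounded_fm \<alpha>" "bounded_fm \<beta>"
    and U: "\<And>v a b c d. w \<sqsubseteq> v \<Longrightarrow> K v a b c d \<Longrightarrow> M v a U \<and> M v b U \<and> M v c U \<and> M v d U"
    and at: "\<And>v Y a b c d. w \<sqsubseteq> v \<Longrightarrow> sub v Y X \<Longrightarrow>
      rule_at v C \<alpha> \<beta> X Y (d ## c ## b ## a ## params) \<longleftrightarrow>
      (K v a b c d \<longrightarrow> L v Y a b c d)"
  shows "rulable w X (\<lambda>v Y. \<forall>v'. v \<sqsubseteq> v' \<longrightarrow> (\<forall>a b c d. K v' a b c d \<longrightarrow> L v' Y a b c d))"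
proof (rule rulable_cong[OF rulable_rules_fm[OF env_params dom(10) dom(7) bd, of 4]])
  fix v Y assume v: "w \<sqsubseteq> v" "E v Y Y" "sub v Y X"
  have "(\<forall>a b c d. (\<forall>k\<in>set [a, b, c, d]. M v' k U) \<longrightarrow>
        rule_at v' C \<alpha> \<beta> X Y (fold case_nat [a, b, c, d] params)) \<longleftrightarrow>
      (\<forall>a b c d. K v' a b c d \<longrightarrow> L v' Y a b c d)" if "v \<sqsubseteq> v'" for v'
    using at[OF le_trans[OF v(1) that] sub_mono[OF v(3) that]] U[OF le_trans[OF v(1) that]] by simp blast
  then show "forces v (Y ## X ## U ## params) (rules_fm C \<alpha> \<beta> 4) \<longleftrightarrow>
      (\<forall>v'. v \<sqsubseteq> v' \<longrightarrow> (\<forall>a b c d. K v' a b c d \<longrightarrow> L v' Y a b c d))"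
    unfolding forces_rules_fm all_lists_4 by blast
qed

text \<open>
  In the following lemmas the last parameter of a rule is \<open>\<^bold>v 0\<close> in the condition \<open>C\<close> and
  \<open>\<^bold>v 1\<close> in the formulas \<open>\<alpha>\<close> and \<open>\<beta>\<close>, where \<open>\<^bold>v 0\<close> ranges over \<open>X\<close>.
\<close>

lemma rulable_mono: "rulable w X (\<lambda>v Y. \<forall>v'. v \<sqsubseteq> v' \<longrightarrow> (\<forall>p p' q q'.
    M v' p P \<and> M v' p' P \<and> M v' q Q \<and> M v' q' Q \<and> rl v' leP p' p \<and> rl v' leQ q q' \<longrightarrow>
    pt v' Y p q \<longrightarrow> pt v' Y p' q'))"
proof -
  \<comment> \<open>The parameters \<open>q'\<close>, \<open>q\<close>, \<open>p'\<close>,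
    \<open>p\<close> have indices 0 to 3, followed by \<open>P\<close>, \<open>Q\<close>,
    \<open>leP\<close>, \<open>leQ\<close>, \<open>BP\<close>, \<open>BQ\<close>, \<open>U\<close>
    at 4 to 10; in the premise and the conclusion all of them are shifted by one.\<close>
  define C where "C = (\<^bold>v 3 \<^bold>\<in> \<^bold>v 4 \<^bold>\<and> \<^bold>v 2 \<^bold>\<in> \<^bold>v 4 \<^bold>\<and> \<^bold>v 1 \<^bold>\<in> \<^bold>v 5 \<^bold>\<and> \<^bold>v 0 \<^bold>\<in> \<^bold>v 5 \<^bold>\<and>
    b_rel (\<^bold>v 6) (\<^bold>v 2) (\<^bold>v 3) \<^bold>\<and> b_rel (\<^bold>v 7) (\<^bold>v 1) (\<^bold>v 0)) 0"
  define \<alpha> where "\<alpha> = b_point (\<^bold>v 11) (\<^bold>v 0) (\<^bold>v 4) (\<^bold>v 2) 0"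
  define \<beta> where "\<beta> = b_point (\<^bold>v 11) (\<^bold>v 0) (\<^bold>v 3) (\<^bold>v 1) 0"
  show ?thesis
  proof (rule rulable_4[where C=C and \<alpha>=\<alpha> and \<beta>=\<beta>])
    fix v Y p p' q q' assume v: "w \<sqsubseteq> v" "sub v Y X"
    let ?e = "q' ## q ## p' ## p ## params"
    have "forces v ?e C \<longleftrightarrow>
        M v p P \<and> M v p' P \<and> M v q Q \<and> M v q' Q \<and> rl v leP p' p \<and> rl v leQ q q'"
      unfolding C_def by (simp add: eval_nat_numeral) (use M_dom(1) in blast)
    moreover have "(\<forall>u x. v \<sqsubseteq> u \<longrightarrow> M u x X \<longrightarrow> forces u (x ## ?e) \<alpha> \<longrightarrow> M u x Y) \<longleftrightarrow> pt v Y p q"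
      if "M v p P" "M v q Q"
      unfolding \<alpha>_def pt_prem[OF v that, symmetric]
      using point_bounded[OF le_trans[OF v(1)] M_mono[OF that(1)] M_mono[OF that(2)]] M_dom(1) M_mono that
      by (simp add: forces_b_point eval_nat_numeral) blast
    moreover have "(\<exists>x. M v x X \<and> forces v (x ## ?e) \<beta> \<and> M v x Y) \<longleftrightarrow> pt v Y p' q'"
      if "M v p' P" "M v q' Q"
      unfolding \<beta>_def pt_conc[OF v(2), symmetric]
      using point_bounded[OF v(1) that] M_dom(1) that
      by (simp add: forces_b_point eval_nat_numeral) blast
    ultimately show "rule_at v C \<alpha> \<beta> X Y ?e \<longleftrightarrow>
        (M v p P \<and> M v p' P \<and> M v q Q \<and> M v q' Q \<and> rl v leP p' p \<and> rl v leQ q q' \<longrightarrow>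
          pt v Y p q \<longrightarrow> pt v Y p' q')"
      unfolding rule_at_def by blast
  qed (use P_in_U Q_in_U in \<open>simp_all add: C_def \<alpha>_def \<beta>_def\<close>)
qed

text \<open>Infinitely many premises fit into one rule because a premise is a set: here the set of
  codes \<open>({p'}, {q})\<close> with \<open>p'\<close> in the basic cover \<open>S\<close>.
  Restricting to basic covers makes the rules a set.\<close>

lemma rulable_cov: "rulable w X (\<lambda>v Y. \<forall>v'. v \<sqsubseteq> v' \<longrightarrow> (\<forall>p q S.
    M v' p P \<and> M v' q Q \<and> bcov v' BP p S \<longrightarrow>
    (\<forall>u p'. v' \<sqsubseteq> u \<longrightarrow> M u p' S \<longrightarrow> pt u Y p' q) \<longrightarrow> pt v' Y p q))"
proof -
  define C where "C = (\<^bold>v 2 \<^bold>\<in> \<^bold>v 3 \<^bold>\<and> \<^bold>v 1 \<^bold>\<in> \<^bold>v 4 \<^bold>\<and> b_cov (\<^bold>v 9) (\<^bold>v 7) (\<^bold>v 2) (\<^bold>v 0)) 0"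
  define \<alpha> where "\<alpha> = (\<^bold>\<exists>p'\<^bold>\<in>\<^bold>v 1. b_point (\<^bold>v 10) (\<^bold>v 0) p' (\<^bold>v 2)) 0"
  define \<beta> where "\<beta> = b_point (\<^bold>v 10) (\<^bold>v 0) (\<^bold>v 3) (\<^bold>v 2) 0"
  show ?thesis
  proof (rule rulable_3[where C=C and \<alpha>=\<alpha> and \<beta>=\<beta>])
    fix v Y p q S assume v: "w \<sqsubseteq> v" "sub v Y X"
    let ?e = "S ## q ## p ## params"
    have "forces v ?e C \<longleftrightarrow> M v p P \<and> M v q Q \<and> bcov v BP p S"
      unfolding C_def using bcov_bounded_P[OF v(1)] M_dom(1)
      by (simp add: forces_b_cov eval_nat_numeral) blast
    moreover have "(\<forall>u x. v \<sqsubseteq> u \<longrightarrow> M u x X \<longrightarrow> forces u (x ## ?e) \<alpha> \<longrightarrow> M u x Y) \<longleftrightarrow>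
        (\<forall>u p'. v \<sqsubseteq> u \<longrightarrow> M u p' S \<longrightarrow> pt u Y p' q)"
      if "M v q Q" "bcov v BP p S" "M v p P"
    proof -
      have S: "sub v S P" using bcov_P[OF v(1) that(3,2)] ..
      have "forces u (x ## ?e) \<alpha> \<longleftrightarrow> (\<exists>p'. M u p' S \<and> point u x p' q)" if u: "v \<sqsubseteq> u" "M u x X" for u x
        unfolding \<alpha>_def
        using point_bounded[OF le_trans[OF v(1) u(1)] _ M_mono[OF \<open>M v q Q\<close> u(1)]] M_dom(1) u
          M_mono[OF \<open>M v q Q\<close> u(1)] S[unfolded sub_def]
        by (simp add: forces_b_point eval_nat_numeral) blast
      moreover have "(\<forall>u' x. u \<sqsubseteq> u' \<longrightarrow> M u' x X \<longrightarrow> point u' x p' q \<longrightarrow> M u' x Y) \<longleftrightarrow> pt u Y p' q"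
        if u: "v \<sqsubseteq> u" "M u p' S" for u p'
        using pt_prem[OF le_trans[OF v(1) u(1)] sub_mono[OF v(2) u(1)] _ M_mono[OF \<open>M v q Q\<close> u(1)], of p']
          S u unfolding sub_def by blast
      ultimately show ?thesis using le_refl le_trans M_mono by meson
    qed
    moreover have "(\<exists>x. M v x X \<and> forces v (x ## ?e) \<beta> \<and> M v x Y) \<longleftrightarrow> pt v Y p q"
      if "M v p P" "M v q Q"
      unfolding \<beta>_def pt_conc[OF v(2), symmetric]
      using point_bounded[OF v(1) that] M_dom(1) that
      by (simp add: forces_b_point eval_nat_numeral) blast
    ultimately show "rule_at v C \<alpha> \<beta> X Y ?e \<longleftrightarrow> (M v p P \<and> M v q Q \<and> bcov v BP p S \<longrightarrow>
        (\<forall>u p'. v \<sqsubseteq> u \<longrightarrow> M u p' S \<longrightarrow> pt u Y p' q) \<longrightarrow> pt v Y p q)"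
      unfolding rule_at_def by blast
  qed (use P_in_U Q_in_U bcov_P SS_in_U in \<open>auto simp: C_def \<alpha>_def \<beta>_def stable_Suc\<close>)
qed

text \<open>The second and the third parameter of the next rule are dummies.\<close>

lemma rulable_total: "rulable w X (\<lambda>v Y. \<forall>v'. v \<sqsubseteq> v' \<longrightarrow> (\<forall>p a b.
    M v' p P \<and> M v' a P \<and> M v' b P \<longrightarrow> (\<exists>S. bcov v' BP p S \<and> rl v' Y S Q)))"
proof -
  define C where "C = (\<^bold>v 2 \<^bold>\<in> \<^bold>v 3 \<^bold>\<and> \<^bold>v 1 \<^bold>\<in> \<^bold>v 3 \<^bold>\<and> \<^bold>v 0 \<^bold>\<in> \<^bold>v 3) 0"
  \<comment> \<open>The rule has the empty premise, described by \<open>Falsum\<close>, and offers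
    the codes \<open>(S, Q)\<close> with \<open>S\<close> a basic cover of \<open>p\<close>.\<close>
  define \<beta> where "\<beta> = (\<^bold>\<exists>S\<^bold>\<in>\<^bold>v 10. b_cov (\<^bold>v 10) (\<^bold>v 8) (\<^bold>v 3) S \<^bold>\<and> b_pair (\<^bold>v 0) S (\<^bold>v 5)) 0"
  show ?thesis
  proof (rule rulable_3[where C=C and \<alpha>=Falsum and \<beta>=\<beta>])
    fix v Y p a b assume v: "w \<sqsubseteq> v" "sub v Y X"
    let ?e = "b ## a ## p ## params"
    have "forces v ?e C \<longleftrightarrow> M v p P \<and> M v a P \<and> M v b P"
      unfolding C_def by (simp add: eval_nat_numeral)
    moreover have "(\<exists>x. M v x X \<and> forces v (x ## ?e) \<beta> \<and> M v x Y) \<longleftrightarrow>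
        (\<exists>S. bcov v BP p S \<and> rl v Y S Q)" if "M v p P"
    proof -
      have "forces v (x ## ?e) \<beta> \<longleftrightarrow> (\<exists>S. bcov v BP p S \<and> opr v x S Q)" if "M v x X" for x
        unfolding \<beta>_def
        using bcov_bounded_P[OF v(1) \<open>M v p P\<close>] bcov_P[OF v(1) \<open>M v p P\<close>] SS_in_U[OF v(1)] M_dom(1) that
          E_mono[OF dom(2) v(1)] \<open>M v p P\<close>
        by (simp add: forces_b_cov eval_nat_numeral) blast
      then show ?thesis using v(2) sub_D unfolding rl_def by blast
    qed
    ultimately show "rule_at v C Falsum \<beta> X Y ?e \<longleftrightarrow> (M v p P \<and> M v a P \<and> M v b P \<longrightarrow>
        (\<exists>S. bcov v BP p S \<and> rl v Y S Q))"
      unfolding rule_at_def by auto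
  qed (use P_in_U in \<open>auto simp: C_def \<beta>_def stable_Suc bounded_fm.intros\<close>)
qed

text \<open>The bound on \<open>q'\<close> is carried by the code: \<open>V\<close> ranges over
  members of \<open>VV\<close> all of whose elements lie below both \<open>q0\<close> and
  \<open>q1\<close>, so any element chosen from \<open>V\<close> later is a common lower
  bound.\<close>

lemma rulable_meet: "rulable w X (\<lambda>v Y. \<forall>v'. v \<sqsubseteq> v' \<longrightarrow> (\<forall>p q0 q1.
    M v' p P \<and> M v' q0 Q \<and> M v' q1 Q \<longrightarrow> pt v' Y p q0 \<and> pt v' Y p q1 \<longrightarrow>
    (\<exists>S V. bcov v' BP p S \<and> M v' V VV \<and>
      (\<forall>u q. v' \<sqsubseteq> u \<longrightarrow> M u q V \<longrightarrow> M u q Q \<and> rl u leQ q q0 \<and> rl u leQ q q1) \<and> rl v' Y S V)))"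
proof -
  define C where "C = (\<^bold>v 2 \<^bold>\<in> \<^bold>v 3 \<^bold>\<and> \<^bold>v 1 \<^bold>\<in> \<^bold>v 4 \<^bold>\<and> \<^bold>v 0 \<^bold>\<in> \<^bold>v 4) 0"
  \<comment> \<open>A premise set is included in \<open>Y\<close> iff all its elements are in
    \<open>Y\<close>, so two joint premises are described by a disjunction.\<close>
  define \<alpha> where "\<alpha> = (b_point (\<^bold>v 10) (\<^bold>v 0) (\<^bold>v 3) (\<^bold>v 2) \<^bold>\<or> b_point (\<^bold>v 10) (\<^bold>v 0) (\<^bold>v 3) (\<^bold>v 1)) 0"
  define \<beta> where "\<beta> = (\<^bold>\<exists>S\<^bold>\<in>\<^bold>v 10. \<^bold>\<exists>V\<^bold>\<in>\<^bold>v 12. b_cov (\<^bold>v 10) (\<^bold>v 8) (\<^bold>v 3) S \<^bold>\<and> b_pair (\<^bold>v 0) S V \<^bold>\<and>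
    (\<^bold>\<forall>q\<^bold>\<in>V. q \<^bold>\<in> \<^bold>v 5 \<^bold>\<and> b_rel (\<^bold>v 7) q (\<^bold>v 2) \<^bold>\<and> b_rel (\<^bold>v 7) q (\<^bold>v 1))) 0"
  show ?thesis
  proof (rule rulable_3[where C=C and \<alpha>=\<alpha> and \<beta>=\<beta>])
    fix v Y p q0 q1 assume v: "w \<sqsubseteq> v" "sub v Y X"
    let ?e = "q1 ## q0 ## p ## params"
    have "forces v ?e C \<longleftrightarrow> M v p P \<and> M v q0 Q \<and> M v q1 Q"
      unfolding C_def by (simp add: eval_nat_numeral)
    moreover have "(\<forall>u x. v \<sqsubseteq> u \<longrightarrow> M u x X \<longrightarrow> forces u (x ## ?e) \<alpha> \<longrightarrow> M u x Y) \<longleftrightarrow>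
        pt v Y p q0 \<and> pt v Y p q1" if "M v p P" "M v q0 Q" "M v q1 Q"
      unfolding \<alpha>_def pt_prem[OF v that(1,2), symmetric] pt_prem[OF v that(1,3), symmetric]
      using point_bounded[OF le_trans[OF v(1)] M_mono[OF that(1)] M_mono[OF that(2)]]
        point_bounded[OF le_trans[OF v(1)] M_mono[OF that(1)] M_mono[OF that(3)]] M_dom(1) M_mono that
      by (simp add: forces_b_point eval_nat_numeral) blast
    moreover have "(\<exists>x. M v x X \<and> forces v (x ## ?e) \<beta> \<and> M v x Y) \<longleftrightarrow>
        (\<exists>S V. bcov v BP p S \<and> M v V VV \<and>
          (\<forall>u q. v \<sqsubseteq> u \<longrightarrow> M u q V \<longrightarrow> M u q Q \<and> rl u leQ q q0 \<and> rl u leQ q q1) \<and> rl v Y S V)"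
      if "M v p P" "M v q0 Q" "M v q1 Q"
    proof -
      have D: "E u q0 q0" "E u q1 q1" if "v \<sqsubseteq> u" for u
        using \<open>M v q0 Q\<close> \<open>M v q1 Q\<close> that M_dom(1) E_mono by blast+
      have inner: "(\<forall>u q. v \<sqsubseteq> u \<longrightarrow> M u q V \<longrightarrow> M u q Q \<and> (E u q q \<and> E u q0 q0 \<and> rl u leQ q q0) \<and>
            E u q q \<and> E u q1 q1 \<and> rl u leQ q q1) \<longleftrightarrow>
          (\<forall>u q. v \<sqsubseteq> u \<longrightarrow> M u q V \<longrightarrow> M u q Q \<and> rl u leQ q q0 \<and> rl u leQ q q1)" for V
        using D M_dom(1) by blast
      have "forces v (x ## ?e) \<beta> \<longleftrightarrow> (\<exists>S. M v S U \<and> (\<exists>V. M v V VV \<and>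
          (E v p p \<and> (\<exists>B. M v B U \<and> rl v BP p B \<and> M v S B)) \<and>
          (E v x x \<and> E v S S \<and> E v V V \<and> opr v x S V) \<and>
          (\<forall>u q. v \<sqsubseteq> u \<longrightarrow> M u q V \<longrightarrow> M u q Q \<and> (E u q q \<and> E u q0 q0 \<and> rl u leQ q q0) \<and>
            E u q q \<and> E u q1 q1 \<and> rl u leQ q q1)))" for x
        unfolding \<beta>_def by (simp add: forces_b_cov eval_nat_numeral)
      then have "forces v (x ## ?e) \<beta> \<longleftrightarrow> (\<exists>S V. bcov v BP p S \<and> M v V VV \<and> opr v x S V \<and>
          (\<forall>u q. v \<sqsubseteq> u \<longrightarrow> M u q V \<longrightarrow> M u q Q \<and> rl u leQ q q0 \<and> rl u leQ q q1))" if "M v x X" for x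
        unfolding inner bcov_bounded_P[OF v(1) \<open>M v p P\<close>]
        using bcov_P[OF v(1) \<open>M v p P\<close>] SS_in_U[OF v(1)] M_dom(1) that \<open>M v p P\<close> by blast
      then show ?thesis using v(2) sub_D unfolding rl_def by blast
    qed
    ultimately show "rule_at v C \<alpha> \<beta> X Y ?e \<longleftrightarrow> (M v p P \<and> M v q0 Q \<and> M v q1 Q \<longrightarrow>
        pt v Y p q0 \<and> pt v Y p q1 \<longrightarrow> (\<exists>S V. bcov v BP p S \<and> M v V VV \<and>
          (\<forall>u q. v \<sqsubseteq> u \<longrightarrow> M u q V \<longrightarrow> M u q Q \<and> rl u leQ q q0 \<and> rl u leQ q q1) \<and> rl v Y S V))"
      unfolding rule_at_def by blast
  qed (use P_in_U Q_in_U in \<open>auto simp: C_def \<alpha>_def \<beta>_def stable_Suc\<close>)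
qed

lemma rulable_cover: "rulable w X (\<lambda>v Y. \<forall>v'. v \<sqsubseteq> v' \<longrightarrow> (\<forall>p q T.
    M v' p P \<and> M v' q Q \<and> bcov v' BQ q T \<longrightarrow> pt v' Y p q \<longrightarrow> (\<exists>S. bcov v' BP p S \<and> rl v' Y S T)))"
proof -
  define C where "C = (\<^bold>v 2 \<^bold>\<in> \<^bold>v 3 \<^bold>\<and> \<^bold>v 1 \<^bold>\<in> \<^bold>v 4 \<^bold>\<and> b_cov (\<^bold>v 9) (\<^bold>v 8) (\<^bold>v 1) (\<^bold>v 0)) 0"
  define \<alpha> where "\<alpha> = b_point (\<^bold>v 10) (\<^bold>v 0) (\<^bold>v 3) (\<^bold>v 2) 0"
  define \<beta> where "\<beta> = (\<^bold>\<exists>S\<^bold>\<in>\<^bold>v 10. b_cov (\<^bold>v 10) (\<^bold>v 8) (\<^bold>v 3) S \<^bold>\<and> b_pair (\<^bold>v 0) S (\<^bold>v 1)) 0"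
  show ?thesis
  proof (rule rulable_3[where C=C and \<alpha>=\<alpha> and \<beta>=\<beta>])
    fix v Y p q T assume v: "w \<sqsubseteq> v" "sub v Y X"
    let ?e = "T ## q ## p ## params"
    have "forces v ?e C \<longleftrightarrow> M v p P \<and> M v q Q \<and> bcov v BQ q T"
      unfolding C_def using bcov_bounded_Q[OF v(1)] M_dom(1)
      by (simp add: forces_b_cov eval_nat_numeral) blast
    moreover have "(\<forall>u x. v \<sqsubseteq> u \<longrightarrow> M u x X \<longrightarrow> forces u (x ## ?e) \<alpha> \<longrightarrow> M u x Y) \<longleftrightarrow> pt v Y p q"
      if "M v p P" "M v q Q"
      unfolding \<alpha>_def pt_prem[OF v that, symmetric]
      using point_bounded[OF le_trans[OF v(1)] M_mono[OF that(1)] M_mono[OF that(2)]] M_dom(1) M_mono that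
      by (simp add: forces_b_point eval_nat_numeral) blast
    moreover have "(\<exists>x. M v x X \<and> forces v (x ## ?e) \<beta> \<and> M v x Y) \<longleftrightarrow>
        (\<exists>S. bcov v BP p S \<and> rl v Y S T)" if "M v p P" "M v q Q" "bcov v BQ q T"
    proof -
      have "E v T T" using bcov_Q[OF v(1) that(2,3)] M_dom(1) by blast
      then have "forces v (x ## ?e) \<beta> \<longleftrightarrow> (\<exists>S. bcov v BP p S \<and> opr v x S T)" if "M v x X" for x
        unfolding \<beta>_def
        using bcov_bounded_P[OF v(1) \<open>M v p P\<close>] bcov_P[OF v(1) \<open>M v p P\<close>] SS_in_U[OF v(1)] M_dom(1) that
          \<open>M v p P\<close>
        by (simp add: forces_b_cov eval_nat_numeral) blast
      then show ?thesis using v(2) sub_D unfolding rl_def by blast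
    qed
    ultimately show "rule_at v C \<alpha> \<beta> X Y ?e \<longleftrightarrow> (M v p P \<and> M v q Q \<and> bcov v BQ q T \<longrightarrow>
        pt v Y p q \<longrightarrow> (\<exists>S. bcov v BP p S \<and> rl v Y S T))"
      unfolding rule_at_def by blast
  qed (use P_in_U Q_in_U bcov_Q VV_in_U in \<open>auto simp: C_def \<alpha>_def \<beta>_def stable_Suc\<close>)
qed

text \<open>The rule that gives codes their meaning: it unfolds \<open>(S, V)\<close>, one element
  \<open>p\<close> of \<open>S\<close> at a time, into a point \<open>({p}, {q})\<close> with
  \<open>q\<close> in \<open>V\<close>.\<close>

lemma rulable_choice: "rulable w X (\<lambda>v Y. \<forall>v'. v \<sqsubseteq> v' \<longrightarrow> (\<forall>S V p.
    M v' S SS \<and> M v' V VV \<and> M v' p S \<and> M v' p P \<longrightarrow> rl v' Y S V \<longrightarrow>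
    (\<exists>q. M v' q V \<and> M v' q Q \<and> pt v' Y p q)))"
proof -
  define C where "C = (\<^bold>v 2 \<^bold>\<in> \<^bold>v 10 \<^bold>\<and> \<^bold>v 1 \<^bold>\<in> \<^bold>v 11 \<^bold>\<and> \<^bold>v 0 \<^bold>\<in> \<^bold>v 2 \<^bold>\<and> \<^bold>v 0 \<^bold>\<in> \<^bold>v 3) 0"
  define \<alpha> where "\<alpha> = b_pair (\<^bold>v 0) (\<^bold>v 3) (\<^bold>v 2) 0"
  define \<beta> where "\<beta> = (\<^bold>\<exists>q\<^bold>\<in>\<^bold>v 2. q \<^bold>\<in> \<^bold>v 5 \<^bold>\<and> b_point (\<^bold>v 10) (\<^bold>v 0) (\<^bold>v 1) q) 0"
  show ?thesis
  proof (rule rulable_3[where C=C and \<alpha>=\<alpha> and \<beta>=\<beta>])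
    fix v Y S V p assume v: "w \<sqsubseteq> v" "sub v Y X"
    let ?e = "p ## V ## S ## params"
    have "forces v ?e C \<longleftrightarrow> M v S SS \<and> M v V VV \<and> M v p S \<and> M v p P"
      unfolding C_def by (simp add: eval_nat_numeral)
    moreover have "(\<forall>u x. v \<sqsubseteq> u \<longrightarrow> M u x X \<longrightarrow> forces u (x ## ?e) \<alpha> \<longrightarrow> M u x Y) \<longleftrightarrow> rl v Y S V"
      if "M v S SS" "M v V VV"
      unfolding \<alpha>_def rl_prem[OF v that, symmetric] using M_dom(1) that E_mono
      by (simp add: eval_nat_numeral) blast
    moreover have "(\<exists>x. M v x X \<and> forces v (x ## ?e) \<beta> \<and> M v x Y) \<longleftrightarrow>
        (\<exists>q. M v q V \<and> M v q Q \<and> pt v Y p q)" if "M v p P"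
    proof -
      have "forces v (x ## ?e) \<beta> \<longleftrightarrow> (\<exists>q. M v q V \<and> M v q Q \<and> point v x p q)" if "M v x X" for x
        unfolding \<beta>_def using point_bounded[OF v(1) \<open>M v p P\<close>] M_dom(1) that \<open>M v p P\<close>
        by (simp add: forces_b_point eval_nat_numeral) blast
      then show ?thesis using v(2) sub_D unfolding pt_def by blast
    qed
    ultimately show "rule_at v C \<alpha> \<beta> X Y ?e \<longleftrightarrow> (M v S SS \<and> M v V VV \<and> M v p S \<and> M v p P \<longrightarrow>
        rl v Y S V \<longrightarrow> (\<exists>q. M v q V \<and> M v q Q \<and> pt v Y p q))"
      unfolding rule_at_def by blast
  qed (use P_in_U SS_in_U VV_in_U in \<open>auto simp: C_def \<alpha>_def \<beta>_def stable_Suc\<close>)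
qed

end

section \<open>Translation between morphisms and closed sets\<close>

locale morphism_rules = point_rules +
  fixes Z :: 'b
  assumes dom_Z: "E w Z Z"
    and pair_Z: "\<And>v p q. w \<sqsubseteq> v \<Longrightarrow> M v p P \<Longrightarrow> M v q Q \<Longrightarrow> \<exists>z. M v z Z \<and> opr v z p q"
begin

text \<open>The conditions on a morphism with arbitrary covers replaced by basic covers, and with no
  downward closure demanded in the last one; this is the form that rules can express.\<close>

definition mor :: "'a \<Rightarrow> 'b \<Rightarrow> bool" where
  "mor v F \<longleftrightarrow>
    (\<forall>v'. v \<sqsubseteq> v' \<longrightarrow> (\<forall>z. M v' z F \<longrightarrow> (\<exists>p q. M v' p P \<and> M v' q Q \<and> opr v' z p q))) \<and>
    (\<forall>v'. v \<sqsubseteq> v' \<longrightarrow> (\<forall>p p' q q'. M v' p P \<and> M v' p' P \<and> M v' q Q \<and> M v' q' Q \<and>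
      rl v' leP p' p \<and> rl v' leQ q q' \<longrightarrow> rl v' F p q \<longrightarrow> rl v' F p' q')) \<and>
    (\<forall>v'. v \<sqsubseteq> v' \<longrightarrow> (\<forall>p q S. M v' p P \<and> M v' q Q \<and> bcov v' BP p S \<longrightarrow>
      (\<forall>u p'. v' \<sqsubseteq> u \<longrightarrow> M u p' S \<longrightarrow> rl u F p' q) \<longrightarrow> rl v' F p q)) \<and>
    (\<forall>v'. v \<sqsubseteq> v' \<longrightarrow> (\<forall>p. M v' p P \<longrightarrow>
      (\<exists>S. bcov v' BP p S \<and> (\<forall>u p'. v' \<sqsubseteq> u \<longrightarrow> M u p' S \<longrightarrow> (\<exists>q. M u q Q \<and> rl u F p' q))))) \<and>
    (\<forall>v'. v \<sqsubseteq> v' \<longrightarrow> (\<forall>p q0 q1. M v' p P \<and> M v' q0 Q \<and> M v' q1 Q \<longrightarrow>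
      rl v' F p q0 \<and> rl v' F p q1 \<longrightarrow> (\<exists>S. bcov v' BP p S \<and> (\<forall>u p'. v' \<sqsubseteq> u \<longrightarrow> M u p' S \<longrightarrow>
        (\<exists>q. M u q Q \<and> rl u F p' q \<and> rl u leQ q q0 \<and> rl u leQ q q1))))) \<and>
    (\<forall>v'. v \<sqsubseteq> v' \<longrightarrow> (\<forall>p q T. M v' p P \<and> M v' q Q \<and> bcov v' BQ q T \<longrightarrow> rl v' F p q \<longrightarrow>
      (\<exists>S. bcov v' BP p S \<and> (\<forall>u p'. v' \<sqsubseteq> u \<longrightarrow> M u p' S \<longrightarrow> (\<exists>q. M u q T \<and> rl u F p' q)))))"

definition closed_set :: "'a \<Rightarrow> 'b \<Rightarrow> bool" where
  "closed_set v Y \<longleftrightarrow>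
    (\<forall>v'. v \<sqsubseteq> v' \<longrightarrow> (\<forall>p p' q q'. M v' p P \<and> M v' p' P \<and> M v' q Q \<and> M v' q' Q \<and>
      rl v' leP p' p \<and> rl v' leQ q q' \<longrightarrow> pt v' Y p q \<longrightarrow> pt v' Y p' q')) \<and>
    (\<forall>v'. v \<sqsubseteq> v' \<longrightarrow> (\<forall>p q S. M v' p P \<and> M v' q Q \<and> bcov v' BP p S \<longrightarrow>
      (\<forall>u p'. v' \<sqsubseteq> u \<longrightarrow> M u p' S \<longrightarrow> pt u Y p' q) \<longrightarrow> pt v' Y p q)) \<and>
    (\<forall>v'. v \<sqsubseteq> v' \<longrightarrow> (\<forall>p a b. M v' p P \<and> M v' a P \<and> M v' b P \<longrightarrow>
      (\<exists>S. bcov v' BP p S \<and> rl v' Y S Q))) \<and>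
    (\<forall>v'. v \<sqsubseteq> v' \<longrightarrow> (\<forall>p q0 q1. M v' p P \<and> M v' q0 Q \<and> M v' q1 Q \<longrightarrow>
      pt v' Y p q0 \<and> pt v' Y p q1 \<longrightarrow> (\<exists>S V. bcov v' BP p S \<and> M v' V VV \<and>
        (\<forall>u q. v' \<sqsubseteq> u \<longrightarrow> M u q V \<longrightarrow> M u q Q \<and> rl u leQ q q0 \<and> rl u leQ q q1) \<and> rl v' Y S V))) \<and>
    (\<forall>v'. v \<sqsubseteq> v' \<longrightarrow> (\<forall>p q T. M v' p P \<and> M v' q Q \<and> bcov v' BQ q T \<longrightarrow> pt v' Y p q \<longrightarrow>
      (\<exists>S. bcov v' BP p S \<and> rl v' Y S T))) \<and>
    (\<forall>v'. v \<sqsubseteq> v' \<longrightarrow> (\<forall>S V p. M v' S SS \<and> M v' V VV \<and> M v' p S \<and> M v' p P \<longrightarrow> rl v' Y S V \<longrightarrow>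
      (\<exists>q. M v' q V \<and> M v' q Q \<and> pt v' Y p q)))"

lemmas mor_pairs = mor_def[THEN iffD1, THEN conjunct1, THEN spec, THEN mp]
lemmas mor_mono = mor_def[THEN iffD1, THEN conjunct2, THEN conjunct1, THEN spec, THEN mp]
lemmas mor_cov = mor_def[THEN iffD1, THEN conjunct2, THEN conjunct2, THEN conjunct1, THEN spec, THEN mp]
lemmas mor_total = mor_def[THEN iffD1, THEN conjunct2, THEN conjunct2, THEN conjunct2, THEN conjunct1, THEN spec, THEN mp]
lemmas mor_meet = mor_def[THEN iffD1, THEN conjunct2, THEN conjunct2, THEN conjunct2, THEN conjunct2, THEN conjunct1, THEN spec, THEN mp]
lemmas mor_cover = mor_def[THEN iffD1, THEN conjunct2, THEN conjunct2, THEN conjunct2, THEN conjunct2, THEN conjunct2, THEN spec, THEN mp]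

lemmas closed_mono = closed_set_def[THEN iffD1, THEN conjunct1, THEN spec, THEN mp]
lemmas closed_cov = closed_set_def[THEN iffD1, THEN conjunct2, THEN conjunct1, THEN spec, THEN mp]
lemmas closed_total = closed_set_def[THEN iffD1, THEN conjunct2, THEN conjunct2, THEN conjunct1, THEN spec, THEN mp]
lemmas closed_meet = closed_set_def[THEN iffD1, THEN conjunct2, THEN conjunct2, THEN conjunct2, THEN conjunct1, THEN spec, THEN mp]
lemmas closed_cover = closed_set_def[THEN iffD1, THEN conjunct2, THEN conjunct2, THEN conjunct2, THEN conjunct2, THEN conjunct1, THEN spec, THEN mp]
lemmas closed_choice = closed_set_def[THEN iffD1, THEN conjunct2, THEN conjunct2, THEN conjunct2, THEN conjunct2, THEN conjunct2, THEN spec, THEN mp]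

lemma rulable_closed_set: "rulable w X closed_set"
  unfolding closed_set_def[abs_def]
  by (intro rulable_conj rulable_mono rulable_cov rulable_total rulable_meet rulable_cover rulable_choice)

text \<open>What membership of the code \<open>(S, V)\<close> in the set belonging to
  \<open>F\<close> is meant to assert.\<close>

definition good :: "'a \<Rightarrow> 'b \<Rightarrow> 'b \<Rightarrow> 'b \<Rightarrow> bool" where
  "good v F S V \<longleftrightarrow> (\<forall>v' p. v \<sqsubseteq> v' \<longrightarrow> M v' p S \<longrightarrow> (\<exists>q. M v' q V \<and> rl v' F p q))"

lemma good_cong:
  assumes "good v F S V" "E v S S'" "E v V V'"
  shows "good v F S' V'"
  unfolding good_def
proof (intro allI impI)
  fix v' p assume v': "v \<sqsubseteq> v'" "M v' p S'"
  have "E v' S' S" "E v' V V'" using assms(2,3) v'(1) E_mono E_sym by blast+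
  then have "M v' p S" using v'(2) M_cong M_dom(1) by blast
  then obtain q where "M v' q V" "rl v' F p q" using assms(1) v'(1) unfolding good_def by blast
  then show "\<exists>q. M v' q V' \<and> rl v' F p q" using \<open>E v' V V'\<close> M_cong M_dom(1) by blast
qed

text \<open>\<open>Y\<close> consists of the codes of all good pairs, which bounded separation
  provides. On singletons, goodness of ({p}, {q}) amounts to \<open>F(p, q)\<close>.\<close>

lemma set_of_relation:
  assumes v: "w \<sqsubseteq> v" and F: "E v F F"
  obtains Y where "E v Y Y" "sub v Y X"
    "\<And>v' S V. v \<sqsubseteq> v' \<Longrightarrow> M v' S SS \<Longrightarrow> M v' V VV \<Longrightarrow> rl v' Y S V \<longleftrightarrow> good v' F S V"
    "\<And>v' p q. v \<sqsubseteq> v' \<Longrightarrow> M v' p P \<Longrightarrow> M v' q Q \<Longrightarrow> pt v' Y p q \<longleftrightarrow> rl v' F p q"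
proof -
  define \<chi> where "\<chi> = (\<^bold>\<exists>S\<^bold>\<in>\<^bold>v 1. \<^bold>\<exists>V\<^bold>\<in>\<^bold>v 2. b_pair (\<^bold>v 0) S V \<^bold>\<and> (\<^bold>\<forall>p\<^bold>\<in>S. \<^bold>\<exists>q\<^bold>\<in>V. b_rel (\<^bold>v 3) p q)) 0"
  let ?e = "SS ## VV ## F ## (\<lambda>_. P)"
  have "bounded_fm \<chi>" by (simp add: \<chi>_def stable_Suc)
  moreover have "env v ?e" using F dom E_mono[OF _ v] by simp
  moreover have "E v X X" using dom E_mono[OF _ v] by blast
  ultimately obtain Y where Y: "E v Y Y"
    "\<And>v' x. v \<sqsubseteq> v' \<Longrightarrow> M v' x Y \<longleftrightarrow> M v' x X \<and> forces v' (x ## ?e) \<chi>"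
    using separation_ex[of \<chi> v ?e X] by blast
  have \<chi>: "forces v' (x ## ?e) \<chi> \<longleftrightarrow> (\<exists>S V. M v' S SS \<and> M v' V VV \<and> opr v' x S V \<and> good v' F S V)"
    if "M v' x X" for v' x
    unfolding \<chi>_def good_def using that M_dom(1) by (simp add: eval_nat_numeral) blast
  have YX: "sub v Y X" using Y(2) unfolding sub_def by blast
  have rlY: "rl v' Y S V \<longleftrightarrow> good v' F S V" if v': "v \<sqsubseteq> v'" "M v' S SS" "M v' V VV" for v' S V
  proof
    assume "rl v' Y S V"
    then obtain x where x: "M v' x Y" "opr v' x S V" unfolding rl_def by blast
    then obtain S' V' where S': "M v' S' SS" "M v' V' VV" "opr v' x S' V'" "good v' F S' V'"
      using Y(2)[OF v'(1)] \<chi> by blast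
    have "E v' S' S" "E v' V' V" using opr_inj[OF S'(3) x(2)] S' v' M_dom(1) by blast+
    then show "good v' F S V" by (rule good_cong[OF S'(4)])
  next
    assume g: "good v' F S V"
    obtain x where "M v' x X" "opr v' x S V" using pair_X[OF le_trans[OF v v'(1)] v'(2,3)] by blast
    then show "rl v' Y S V" using Y(2)[OF v'(1)] \<chi> g v'(2,3) unfolding rl_def by blast
  qed
  have ptY: "pt v' Y p q \<longleftrightarrow> rl v' F p q" if v': "v \<sqsubseteq> v'" "M v' p P" "M v' q Q" for v' p q
  proof
    note D = M_dom(1)[OF v'(2)] M_dom(1)[OF v'(3)]
    assume "pt v' Y p q"
    then obtain x s t where x: "M v' x Y" "E v' s s" "E v' t t" "upr v' s p p" "upr v' t q q" "opr v' x s t"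
      unfolding pt_def point_def by blast
    then obtain S V where S: "M v' S SS" "M v' V VV" "opr v' x S V" "good v' F S V"
      using Y(2)[OF v'(1)] \<chi> by blast
    have eq: "E v' S s" "E v' V t" using opr_inj[OF S(3) x(6)] S x M_dom(1) by blast+
    have "good v' F s t" by (rule good_cong[OF S(4) eq])
    then obtain q' where q': "M v' q' t" "rl v' F p q'"
      using upr_M(1)[OF D(1) D(1) x(4)] le_refl unfolding good_def by blast
    then have "E v' q' q" using upr_cases[OF x(5)] by blast
    then show "rl v' F p q" using rl_cong[OF q'(2) _ D(1)] E_mono[OF F v'(1)] by blast
  next
    note D = M_dom(1)[OF v'(2)] M_dom(1)[OF v'(3)]
    assume r: "rl v' F p q"
    have wv': "w \<sqsubseteq> v'" using v v'(1) by (rule le_trans)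
    obtain s where s: "M v' s SS" "upr v' s p p" using single_P[OF wv' v'(2)] by blast
    obtain t where t: "M v' t VV" "upr v' t q q" using single_Q[OF wv' v'(3)] by blast
    have "good v' F s t"
      unfolding good_def
    proof (intro allI impI exI conjI)
      fix u p' assume u: "v' \<sqsubseteq> u" "M u p' s"
      have Du: "E u p p" "E u q q" "E u F F" using E_mono[OF D(1) u(1)] E_mono[OF D(2) u(1)]
          E_mono[OF F le_trans[OF v'(1) u(1)]] by blast+
      show "M u q t" using upr_M(1)[OF Du(2,2) upr_mono[OF t(2) u(1)]] .
      have "E u p p'" using upr_cases[OF upr_mono[OF s(2) u(1)] u(2)] E_sym by blast
      then show "rl u F p' q" using rl_cong[OF rl_mono[OF r u(1)] Du(3) _ Du(2)] by blast
    qed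
    then have "rl v' Y s t" using rlY[OF v'(1) s(1) t(1)] by blast
    then show "pt v' Y p q" using s t M_dom(1) unfolding pt_def point_def rl_def by blast
  qed
  show thesis by (rule that[OF Y(1) YX rlY ptY])
qed

lemma closed_set_of_morphism:
  assumes v: "w \<sqsubseteq> v" and F: "E v F F" and mor: "mor v F"
  obtains Y where "E v Y Y" "sub v Y X" "closed_set v Y"
    "\<And>v' p q. v \<sqsubseteq> v' \<Longrightarrow> M v' p P \<Longrightarrow> M v' q Q \<Longrightarrow> pt v' Y p q \<longleftrightarrow> rl v' F p q"
proof -
  obtain Y where Y: "E v Y Y" "sub v Y X"
    and rlY: "\<And>v' S V. v \<sqsubseteq> v' \<Longrightarrow> M v' S SS \<Longrightarrow> M v' V VV \<Longrightarrow> rl v' Y S V \<longleftrightarrow> good v' F S V"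
    and ptY: "\<And>v' p q. v \<sqsubseteq> v' \<Longrightarrow> M v' p P \<Longrightarrow> M v' q Q \<Longrightarrow> pt v' Y p q \<longleftrightarrow> rl v' F p q"
    using set_of_relation[OF v F] by metis
  have "closed_set v Y"
    unfolding closed_set_def
  proof (intro conjI allI impI; (elim conjE)?)
    fix v' p p' q q' assume v': "v \<sqsubseteq> v'" and a: "M v' p P" "M v' p' P" "M v' q Q" "M v' q' Q"
      "rl v' leP p' p" "rl v' leQ q q'" "pt v' Y p q"
    then have "rl v' F p q" using ptY[OF v'] by blast
    then have "rl v' F p' q'" using mor_mono[OF mor v'] a by blast
    then show "pt v' Y p' q'" using ptY[OF v'] a by blast
  next
    fix v' p q S
    assume v': "v \<sqsubseteq> v'" and a: "M v' p P" "M v' q Q" "bcov v' BP p S"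
      and pt: "\<forall>u p'. v' \<sqsubseteq> u \<longrightarrow> M u p' S \<longrightarrow> pt u Y p' q"
    have "sub v' S P" using bcov_P[OF le_trans[OF v v'] a(1,3)] ..
    then have "\<forall>u p'. v' \<sqsubseteq> u \<longrightarrow> M u p' S \<longrightarrow> rl u F p' q"
      using pt ptY[OF le_trans[OF v']] M_mono[OF a(2)] unfolding sub_def by blast
    then have "rl v' F p q" using mor_cov[OF mor v'] a by blast
    then show "pt v' Y p q" using ptY[OF v' a(1,2)] by blast
  next
    fix v' p assume v': "v \<sqsubseteq> v'" "M v' p P"
    then obtain S where S: "bcov v' BP p S" "\<forall>u p'. v' \<sqsubseteq> u \<longrightarrow> M u p' S \<longrightarrow> (\<exists>q. M u q Q \<and> rl u F p' q)"
      using mor_total[OF mor v'(1)] v'(2) by blast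
    then have "good v' F S Q" unfolding good_def by blast
    moreover have "M v' S SS" using bcov_P[OF le_trans[OF v v'(1)] v'(2) S(1)] ..
    ultimately have "rl v' Y S Q" using rlY[OF v'(1)] M_mono[OF Q_VV le_trans[OF v v'(1)]] by blast
    with S(1) show "\<exists>S. bcov v' BP p S \<and> rl v' Y S Q" by blast
  next
    fix v' p q0 q1
    assume v': "v \<sqsubseteq> v'" and a: "M v' p P" "M v' q0 Q" "M v' q1 Q" "pt v' Y p q0" "pt v' Y p q1"
    have "rl v' F p q0" "rl v' F p q1" using ptY[OF v'] a by blast+
    then obtain S where S: "bcov v' BP p S" "\<forall>u p'. v' \<sqsubseteq> u \<longrightarrow> M u p' S \<longrightarrow>
        (\<exists>q. M u q Q \<and> rl u F p' q \<and> rl u leQ q q0 \<and> rl u leQ q q1)"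
      using mor_meet[OF mor v'] a(1-3) by blast
    \<comment> \<open>Here \<open>V\<close> is the full set of common lower bounds, which
      \<open>VV\<close> was required to contain.\<close>
    obtain V where V: "M v' V VV"
      "\<forall>u q. v' \<sqsubseteq> u \<longrightarrow> (M u q V \<longleftrightarrow> M u q Q \<and> rl u leQ q q0 \<and> rl u leQ q q1)"
      using meet_Q[OF le_trans[OF v v'] a(2,3)] by blast
    have "good v' F S V" using S(2) V(2) unfolding good_def by blast
    moreover have "M v' S SS" using bcov_P[OF le_trans[OF v v'] a(1) S(1)] ..
    ultimately have "rl v' Y S V" using rlY[OF v' _ V(1)] by blast
    then show "\<exists>S V. bcov v' BP p S \<and> M v' V VV \<and>
        (\<forall>u q. v' \<sqsubseteq> u \<longrightarrow> M u q V \<longrightarrow> M u q Q \<and> rl u leQ q q0 \<and> rl u leQ q q1) \<and> rl v' Y S V"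
      using S(1) V by blast
  next
    fix v' p q T assume v': "v \<sqsubseteq> v'" and a: "M v' p P" "M v' q Q" "bcov v' BQ q T" "pt v' Y p q"
    have "rl v' F p q" using ptY[OF v'] a by blast
    then obtain S where S: "bcov v' BP p S"
        "\<forall>u p'. v' \<sqsubseteq> u \<longrightarrow> M u p' S \<longrightarrow> (\<exists>q. M u q T \<and> rl u F p' q)"
      using mor_cover[OF mor v'] a(1-3) by blast
    then have "good v' F S T" unfolding good_def by blast
    moreover have "M v' S SS" using bcov_P[OF le_trans[OF v v'] a(1) S(1)] ..
    moreover have "M v' T VV" using bcov_Q[OF le_trans[OF v v'] a(2,3)] ..
    ultimately have "rl v' Y S T" using rlY[OF v'] by blast
    with S(1) show "\<exists>S. bcov v' BP p S \<and> rl v' Y S T" by blast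
  next
    fix v' S V p assume v': "v \<sqsubseteq> v'" and a: "M v' S SS" "M v' V VV" "M v' p S" "M v' p P" "rl v' Y S V"
    then have "good v' F S V" using rlY by blast
    then obtain q where q: "M v' q V" "rl v' F p q" using a(3) le_refl unfolding good_def by blast
    \<comment> \<open>Members of \<open>VV\<close> need not be subsets of \<open>Q\<close>; that
      \<open>q\<close> lies in \<open>Q\<close> comes from \<open>F\<close> being a relation between
      \<open>P\<close> and \<open>Q\<close>.\<close>
    then obtain z where z: "M v' z F" "opr v' z p q" unfolding rl_def by blast
    then obtain p' q' where z': "M v' p' P" "M v' q' Q" "opr v' z p' q'" using mor_pairs[OF mor v'] by blast
    then have "E v' q' q" using opr_inj[OF z'(3) z(2)] a(4) q(1) M_dom(1) by blast
    then have "M v' q Q" using z'(2) M_cong M_dom(2) by blast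
    then show "\<exists>q. M v' q V \<and> M v' q Q \<and> pt v' Y p q" using q ptY[OF v' a(4)] by blast
  qed
  with Y ptY that show thesis by blast
qed

text \<open>The relation read off from the points of \<open>Y\<close>. The set \<open>Z\<close>
  contains all the pairs required, possibly among other elements, and makes the relation a set by
  separation.\<close>

definition described :: "'a \<Rightarrow> 'b \<Rightarrow> 'b \<Rightarrow> bool" where
  "described v Y F \<longleftrightarrow> (\<forall>v' z. v \<sqsubseteq> v' \<longrightarrow> (M v' z F \<longleftrightarrow>
     M v' z Z \<and> (\<exists>p q. M v' p P \<and> M v' q Q \<and> opr v' z p q \<and> pt v' Y p q)))"

lemma described_rl:
  assumes "w \<sqsubseteq> v" "described v Y F" "v \<sqsubseteq> v'" "M v' p P" "M v' q Q"
  shows "rl v' F p q \<longleftrightarrow> pt v' Y p q"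
proof
  assume "rl v' F p q"
  then obtain z where z: "M v' z F" "opr v' z p q" unfolding rl_def by blast
  then obtain p' q' where pq: "M v' p' P" "M v' q' Q" "opr v' z p' q'" "pt v' Y p' q'"
    using assms(2,3) unfolding described_def by blast
  have "E v' p' p" "E v' q' q" using opr_inj[OF pq(3) z(2)] pq assms M_dom(1) by blast+
  then show "pt v' Y p q" using pq(4) point_cong M_dom(1) unfolding pt_def by blast
next
  assume pt: "pt v' Y p q"
  obtain z where "M v' z Z" "opr v' z p q" using pair_Z[OF le_trans[OF assms(1,3)] assms(4,5)] by blast
  then show "rl v' F p q" using pt assms unfolding described_def rl_def by blast
qed

text \<open>Each existence condition yields a code \<open>(S, V)\<close> in \<open>Y\<close>, and
  the local fact \<open>choice\<close> unfolds it, by the choice rule, into the statement that every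
  \<open>p'\<close> in \<open>S\<close> is related to an element of \<open>V\<close>.\<close>

lemma described_mor:
  assumes v: "w \<sqsubseteq> v" and d: "described v Y F" and c: "closed_set v Y" and Y: "sub v Y X"
  shows "mor v F"
proof -
  note r = described_rl[OF v d]
  have choice: "\<exists>q. M u q V \<and> M u q Q \<and> rl u F p' q"
    if "v \<sqsubseteq> v'" "M v' p P" "bcov v' BP p S" "M v' V VV" "rl v' Y S V" "v' \<sqsubseteq> u" "M u p' S" for v' p S V u p'
  proof -
    have vu: "v \<sqsubseteq> u" using that(1,6) by (rule le_trans)
    have S: "M u S SS" "M u p' P" "M u V VV" "rl u Y S V"
      using bcov_P[OF le_trans[OF v that(1)] that(2,3)] that(4-7) M_mono rl_mono unfolding sub_def by blast+
    then have "\<exists>q. M u q V \<and> M u q Q \<and> pt u Y p' q" using closed_choice[OF c vu] that(7) by blast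
    then show ?thesis using r[OF vu S(2)] by blast
  qed
  show ?thesis
    unfolding mor_def
  proof (intro conjI allI impI; (elim conjE)?)
    fix v' z assume "v \<sqsubseteq> v'" "M v' z F"
    then show "\<exists>p q. M v' p P \<and> M v' q Q \<and> opr v' z p q" using d unfolding described_def by blast
  next
    fix v' p p' q q' assume v': "v \<sqsubseteq> v'" and a: "M v' p P" "M v' p' P" "M v' q Q" "M v' q' Q"
      "rl v' leP p' p" "rl v' leQ q q'" "rl v' F p q"
    then have "pt v' Y p q" using r[OF v'] by blast
    then have "pt v' Y p' q'" using closed_mono[OF c v'] a by blast
    then show "rl v' F p' q'" using r[OF v'] a by blast
  next
    fix v' p q S assume v': "v \<sqsubseteq> v'" and a: "M v' p P" "M v' q Q" "bcov v' BP p S"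
      and F: "\<forall>u p'. v' \<sqsubseteq> u \<longrightarrow> M u p' S \<longrightarrow> rl u F p' q"
    have "sub v' S P" using bcov_P[OF le_trans[OF v v'] a(1,3)] ..
    then have "\<forall>u p'. v' \<sqsubseteq> u \<longrightarrow> M u p' S \<longrightarrow> pt u Y p' q"
      using F r[OF le_trans[OF v']] M_mono[OF a(2)] unfolding sub_def by blast
    then have "pt v' Y p q" using closed_cov[OF c v'] a by blast
    then show "rl v' F p q" using r[OF v' a(1,2)] by blast
  next
    fix v' p assume v': "v \<sqsubseteq> v'" "M v' p P"
    then obtain S where "bcov v' BP p S" "rl v' Y S Q" using closed_total[OF c v'(1)] by blast
    then show "\<exists>S. bcov v' BP p S \<and> (\<forall>u p'. v' \<sqsubseteq> u \<longrightarrow> M u p' S \<longrightarrow> (\<exists>q. M u q Q \<and> rl u F p' q))"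
      using choice[OF v' _ M_mono[OF Q_VV le_trans[OF v v'(1)]]] by blast
  next
    fix v' p q0 q1
    assume v': "v \<sqsubseteq> v'" and a: "M v' p P" "M v' q0 Q" "M v' q1 Q" "rl v' F p q0" "rl v' F p q1"
    then have "pt v' Y p q0 \<and> pt v' Y p q1" using r[OF v'] by blast
    then obtain S V where S: "bcov v' BP p S" "M v' V VV" "rl v' Y S V"
      "\<forall>u q. v' \<sqsubseteq> u \<longrightarrow> M u q V \<longrightarrow> M u q Q \<and> rl u leQ q q0 \<and> rl u leQ q q1"
      using closed_meet[OF c v'] a(1-3) by blast
    have "\<exists>q. M u q Q \<and> rl u F p' q \<and> rl u leQ q q0 \<and> rl u leQ q q1" if u: "v' \<sqsubseteq> u" "M u p' S" for u p'
      using choice[OF v' a(1) S(1-3) u] S(4) u(1) by blast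
    with S(1) show "\<exists>S. bcov v' BP p S \<and> (\<forall>u p'. v' \<sqsubseteq> u \<longrightarrow> M u p' S \<longrightarrow>
        (\<exists>q. M u q Q \<and> rl u F p' q \<and> rl u leQ q q0 \<and> rl u leQ q q1))" by blast
  next
    fix v' p q T assume v': "v \<sqsubseteq> v'" and a: "M v' p P" "M v' q Q" "bcov v' BQ q T" "rl v' F p q"
    then have "pt v' Y p q" using r[OF v'] by blast
    then obtain S where S: "bcov v' BP p S" "rl v' Y S T" using closed_cover[OF c v'] a(1-3) by blast
    moreover have "M v' T VV" using bcov_Q[OF le_trans[OF v v'] a(2,3)] ..
    ultimately show "\<exists>S. bcov v' BP p S \<and> (\<forall>u p'. v' \<sqsubseteq> u \<longrightarrow> M u p' S \<longrightarrow> (\<exists>q. M u q T \<and> rl u F p' q))"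
      using choice[OF v' a(1)] by blast
  qed
qed

text \<open>NID is applied to the closed set \<open>Y\<close> of a morphism \<open>F\<close> and to
  the code of a given pair in \<open>F\<close>. The generator \<open>Y'\<close> obtained contains
  this code and is included in \<open>Y\<close>, so the relation described by \<open>Y'\<close>
  contains the pair and is included in \<open>F\<close>.\<close>

theorem morphisms_set_generated:
  "\<exists>G. E w G G \<and> (\<forall>v F. w \<sqsubseteq> v \<longrightarrow> M v F G \<longrightarrow> mor v F) \<and>
    (\<forall>v F x. w \<sqsubseteq> v \<longrightarrow> E v F F \<longrightarrow> mor v F \<longrightarrow> M v x F \<longrightarrow>
      (\<exists>F'. M v F' G \<and> M v x F' \<and> sub v F' F))"
proof -
  obtain R where R: "E w R R" "rset w X R"
    "\<forall>v Y. w \<sqsubseteq> v \<longrightarrow> E v Y Y \<longrightarrow> sub v Y X \<longrightarrow> (clo v R Y \<longleftrightarrow> closed_set v Y)"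
    using rulable_closed_set unfolding rulable_def by blast
  obtain H where H: "E w H H" "\<And>v Y. w \<sqsubseteq> v \<Longrightarrow> M v Y H \<Longrightarrow> sub v Y X \<and> clo v R Y"
    "\<And>v Y x. w \<sqsubseteq> v \<Longrightarrow> E v Y Y \<Longrightarrow> sub v Y X \<Longrightarrow> clo v R Y \<Longrightarrow> M v x Y \<Longrightarrow>
      \<exists>Y'. M v Y' H \<and> M v x Y' \<and> sub v Y' Y"
    using NID_ex[OF dom(10) R(1,2)] by metis
  define \<theta> where "\<theta> = (\<^bold>\<exists>p\<^bold>\<in>\<^bold>v 4. \<^bold>\<exists>q\<^bold>\<in>\<^bold>v 5. b_pair (\<^bold>v 0) p q \<^bold>\<and> (\<^bold>\<exists>x\<^bold>\<in>\<^bold>v 1. b_point (\<^bold>v 10) x p q)) 0"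
  have "bounded_fm \<theta>" by (simp add: \<theta>_def stable_Suc)
  let ?e = "\<lambda>Y F. Y ## F ## Z ## params"
  have \<theta>: "forces v (z ## (?e Y F)) \<theta> \<longleftrightarrow> (\<exists>p q. M v p P \<and> M v q Q \<and> opr v z p q \<and> pt v Y p q)"
    if "w \<sqsubseteq> v" "E v z z" for v z Y F
  proof -
    have pb: "(\<exists>x. M v x Y \<and> E v x x \<and> E v p p \<and> E v q q \<and>
          (\<exists>s t. M v s U \<and> M v t U \<and> opr v x s t \<and> upr v s p p \<and> upr v t q q)) \<longleftrightarrow> pt v Y p q"
      if "M v p P" "M v q Q" for p q
      unfolding point_bounded[OF \<open>w \<sqsubseteq> v\<close> that] pt_def using that M_dom(1) by blast
    have "forces v (z ## (?e Y F)) \<theta> \<longleftrightarrow> (\<exists>p. M v p P \<and> (\<exists>q. M v q Q \<and>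
        (E v z z \<and> E v p p \<and> E v q q \<and> opr v z p q) \<and> (\<exists>x. M v x Y \<and> E v x x \<and> E v p p \<and> E v q q \<and>
          (\<exists>s t. M v s U \<and> M v t U \<and> opr v x s t \<and> upr v s p p \<and> upr v t q q))))"
      unfolding \<theta>_def by (simp add: forces_b_point eval_nat_numeral)
    also have "\<dots> \<longleftrightarrow> (\<exists>p. M v p P \<and> (\<exists>q. M v q Q \<and>
        (E v z z \<and> E v p p \<and> E v q q \<and> opr v z p q) \<and> pt v Y p q))"
      by (rule ex_cong1, rule conj_cong, rule refl)+ (rule conj_cong, rule refl, rule pb)
    also have "\<dots> \<longleftrightarrow> (\<exists>p q. M v p P \<and> M v q Q \<and> opr v z p q \<and> pt v Y p q)"
      using M_dom(1) that(2) by blast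
    finally show ?thesis .
  qed
  define \<delta> where "\<delta> = (\<^bold>\<forall>z. z \<^bold>\<in> \<^bold>v 1 \<^bold>\<longleftrightarrow> z \<^bold>\<in> \<^bold>v 2 \<^bold>\<and> (\<lambda>_. \<theta>)) 0"
  have \<delta>: "forces v (?e Y F) \<delta> \<longleftrightarrow> described v Y F" if "w \<sqsubseteq> v" for v Y F
    unfolding \<delta>_def described_def using \<theta>[OF le_trans[OF that]] M_dom(1)
    by (simp add: eval_nat_numeral) blast
  have "\<forall>v Y. w \<sqsubseteq> v \<longrightarrow> M v Y H \<longrightarrow> (\<exists>F. E v F F \<and> forces v (?e Y F) \<delta>)"
  proof (intro allI impI)
    fix v Y assume v: "w \<sqsubseteq> v" "M v Y H"
    \<comment> \<open>The place of \<open>F\<close> is filled with \<open>Y\<close> for the time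
      being: \<open>F\<close> is still to be separated, and \<open>\<theta>\<close> does not refer
      to it.\<close>
    have "env v (?e Y Y)" using dom dom_Z E_mono[OF _ v(1)] v(2) M_dom(1) by simp
    moreover have "E v Z Z" using dom_Z E_mono v(1) by blast
    ultimately obtain F where F: "E v F F"
      "\<And>v' z. v \<sqsubseteq> v' \<Longrightarrow> M v' z F \<longleftrightarrow> M v' z Z \<and> forces v' (z ## (?e Y Y)) \<theta>"
      using separation_ex[OF \<open>bounded_fm \<theta>\<close>, of v "?e Y Y" Z] by blast
    then have "described v Y F"
      using \<theta>[OF le_trans[OF v(1)]] M_dom(1) unfolding described_def by blast
    then show "\<exists>F. E v F F \<and> forces v (?e Y F) \<delta>" using F(1) \<delta>[OF v(1)] by blast
  qed
  moreover have "env w (Z ## params)" using dom dom_Z by simp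
  ultimately obtain G where G: "E w G G"
    "\<forall>v Y. w \<sqsubseteq> v \<longrightarrow> M v Y H \<longrightarrow> (\<exists>F. M v F G \<and> forces v (?e Y F) \<delta>)"
    \<comment> \<open>This half of strong collection ensures that every member of \<open>G\<close>
      is described by a generator, hence is a morphism.\<close>
    "\<forall>v F. w \<sqsubseteq> v \<longrightarrow> M v F G \<longrightarrow> (\<exists>Y. M v Y H \<and> forces v (?e Y F) \<delta>)"
    using strong_collection_ex[of w "Z ## params" H \<delta>] H(1) by blast
  show ?thesis
  proof (rule exI[of _ G], intro conjI allI impI)
    show "E w G G" by (rule G(1))
  next
    fix v F assume v: "w \<sqsubseteq> v" "M v F G"
    then obtain Y where Y: "M v Y H" "described v Y F" using G(3) \<delta> by blast
    moreover have "sub v Y X" "clo v R Y" using H(2)[OF v(1) Y(1)] by blast+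
    ultimately show "mor v F" using described_mor[OF v(1)] R(3) v(1) M_dom(1) by blast
  next
    fix v F x assume v: "w \<sqsubseteq> v" and F: "E v F F" "mor v F" "M v x F"
    obtain Y where Y: "E v Y Y" "sub v Y X" "closed_set v Y"
      and ptY: "\<And>v' p q. v \<sqsubseteq> v' \<Longrightarrow> M v' p P \<Longrightarrow> M v' q Q \<Longrightarrow> pt v' Y p q \<longleftrightarrow> rl v' F p q"
      using closed_set_of_morphism[OF v F(1,2)] by metis
    obtain p q where pq: "M v p P" "M v q Q" "opr v x p q"
      using mor_pairs[OF F(2) le_refl] F(3) by blast
    then have "rl v F p q" using F(3) unfolding rl_def by blast
    then obtain y where y: "M v y Y" "point v y p q" using ptY[OF le_refl pq(1,2)] unfolding pt_def by blast
    have "clo v R Y" using R(3) v Y by blast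
    then obtain Y' where Y': "M v Y' H" "M v y Y'" "sub v Y' Y" using H(3)[OF v Y(1,2) _ y(1)] by blast
    then obtain F' where F': "M v F' G" "described v Y' F'" using G(2) \<delta> v by blast
    have "pt v Y' p q" using Y'(2) y(2) unfolding pt_def by blast
    moreover obtain z where z: "M v z Z" "opr v z p q" using pair_Z[OF v pq(1,2)] by blast
    then have "M v x Z"
      using opr_unique[OF z(2) pq(3)] M_cong[OF z(1)] M_dom[OF z(1)] M_dom(1)[OF F(3)] by blast
    ultimately have "M v x F'" using F'(2) pq le_refl unfolding described_def by blast
    moreover have "sub v F' F"
      unfolding sub_def
    proof (intro allI impI)
      fix v' z assume v': "v \<sqsubseteq> v'" "M v' z F'"
      then obtain p q where pq': "M v' p P" "M v' q Q" "opr v' z p q" "pt v' Y' p q"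
        using F'(2) unfolding described_def by blast
      then have "pt v' Y p q" using Y'(3) v'(1) unfolding pt_def sub_def by blast
      then have "rl v' F p q" using ptY[OF v'(1) pq'(1,2)] by blast
      then show "M v' z F" using rl_M pq'(3) M_dom(1)[OF v'(2)] by blast
    qed
    ultimately show "\<exists>F'. M v F' G \<and> M v x F' \<and> sub v F' F" using F'(1) by blast
  qed
qed

end

section \<open>Set-presented formal spaces\<close>

context kripke
begin

text \<open>Nested restricted quantifiers each introduce another later world. When the restriction
  is persistent, the worlds merge into one, which lets the simplifier flatten long quantifier
  prefixes.\<close>

lemma collapse_future:
  assumes "\<And>w w' x. w \<sqsubseteq> w' \<Longrightarrow> N w x \<Longrightarrow> N w' x"
  shows "(\<forall>w'. w \<sqsubseteq> w' \<longrightarrow> (\<forall>x. N w' x \<longrightarrow> (\<forall>w''. w' \<sqsubseteq> w'' \<longrightarrow> K w'' x))) \<longleftrightarrow>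
    (\<forall>w'. w \<sqsubseteq> w' \<longrightarrow> (\<forall>x. N w' x \<longrightarrow> K w' x))" (is "?l \<longleftrightarrow> ?r")
proof (intro iffI allI impI)
  fix w' x assume "?l" "w \<sqsubseteq> w'" "N w' x"
  then show "K w' x" using le_refl by blast
next
  fix w' x w'' assume "?r" "w \<sqsubseteq> w'" "N w' x" "w' \<sqsubseteq> w''"
  then show "K w'' x" using le_trans assms by blast
qed

lemma collapse_M: "(\<forall>w'. w \<sqsubseteq> w' \<longrightarrow> (\<forall>x. M w' x a \<longrightarrow> (\<forall>w''. w' \<sqsubseteq> w'' \<longrightarrow> K w'' x))) \<longleftrightarrow>
    (\<forall>w'. w \<sqsubseteq> w' \<longrightarrow> (\<forall>x. M w' x a \<longrightarrow> K w' x))"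
  by (rule collapse_future) (rule M_mono)

lemma collapse_sub: "(\<forall>w'. w \<sqsubseteq> w' \<longrightarrow> (\<forall>x. E w' x x \<longrightarrow> sub w' x a \<longrightarrow> (\<forall>w''. w' \<sqsubseteq> w'' \<longrightarrow> K w'' x))) \<longleftrightarrow>
    (\<forall>w'. w \<sqsubseteq> w' \<longrightarrow> (\<forall>x. E w' x x \<longrightarrow> sub w' x a \<longrightarrow> K w' x))"
  unfolding imp_conjL[symmetric] by (rule collapse_future) (blast intro: E_mono sub_mono)

lemma collapse_rl: "(\<forall>w'. w \<sqsubseteq> w' \<longrightarrow> (\<forall>x. E w' x x \<longrightarrow> rl w' b a x \<longrightarrow> (\<forall>w''. w' \<sqsubseteq> w'' \<longrightarrow> K w'' x))) \<longleftrightarrow>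
    (\<forall>w'. w \<sqsubseteq> w' \<longrightarrow> (\<forall>x. E w' x x \<longrightarrow> rl w' b a x \<longrightarrow> K w' x))"
  unfolding imp_conjL[symmetric] by (rule collapse_future) (blast intro: E_mono rl_mono)

lemmas collapse = collapse_M collapse_sub collapse_rl

lemma forces_class_rel [simp]: "forces w e (class_rel A x y n) \<longleftrightarrow>
    forces w (e (x n) ## e (y n) ## (\<lambda>i. e (i + n))) A"
  by (simp add: class_rel_def)

lemma forces_is_preorder:
  assumes "stable n P" "stable n r"
  shows "forces w e (is_preorder P r n) \<longleftrightarrow> forces w e (is_relation r P P n) \<and>
      (\<forall>w'. w \<sqsubseteq> w' \<longrightarrow> (\<forall>p. M w' p (e (P n)) \<longrightarrow> rl w' (e (r n)) p p)) \<and>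
      (\<forall>w'. w \<sqsubseteq> w' \<longrightarrow> (\<forall>p. M w' p (e (P n)) \<longrightarrow> (\<forall>q. M w' q (e (P n)) \<longrightarrow> (\<forall>s. M w' s (e (P n)) \<longrightarrow>
        rl w' (e (r n)) p q \<and> rl w' (e (r n)) q s \<longrightarrow> rl w' (e (r n)) p s))))"
  using assms by (simp add: is_preorder_def stable_step stable_Suc collapse)

lemma forces_set_presented:
  assumes "stable n P" and sp: "forces w e (set_presented P (class_rel A) n)"
  obtains Bc where "E w Bc Bc"
    "\<forall>v p S. w \<sqsubseteq> v \<longrightarrow> M v p (e (P n)) \<longrightarrow> bcov v Bc p S \<longrightarrow> sub v S (e (P n))"
    "\<forall>v p U. w \<sqsubseteq> v \<longrightarrow> M v p (e (P n)) \<longrightarrow> E v U U \<longrightarrow> sub v U (e (P n)) \<longrightarrow>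
      (forces v (p ## U ## (\<lambda>i. e (i + n))) A \<longleftrightarrow> (\<exists>S. bcov v Bc p S \<and> sub v S U))"
proof -
  let ?P = "e (P n)" and ?cov = "\<lambda>v p U. forces v (p ## U ## (\<lambda>i. e (i + n))) A"
  have "\<exists>x. E w x x \<and>
      (\<forall>w'. w \<sqsubseteq> w' \<longrightarrow> (\<forall>xa. M w' xa x \<longrightarrow> (\<exists>x. M w' x ?P \<and> (\<exists>xb. E w' xb xb \<and> opr w' xa x xb)))) \<and>
      (\<forall>w'. w \<sqsubseteq> w' \<longrightarrow> (\<forall>xa. M w' xa ?P \<longrightarrow> (\<exists>xb. E w' xb xb \<and> rl w' x xa xb \<and>
        (\<forall>w'a. w' \<sqsubseteq> w'a \<longrightarrow> (\<forall>b'. E w'a b' b' \<longrightarrow> rl w'a x xa b' \<longrightarrow> E w'a b' xb))))) \<and>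
      (\<forall>w'. w \<sqsubseteq> w' \<longrightarrow> (\<forall>p. M w' p ?P \<longrightarrow> (\<forall>B. E w' B B \<longrightarrow> rl w' x p B \<longrightarrow>
        (\<forall>w''. w' \<sqsubseteq> w'' \<longrightarrow> (\<forall>S. M w'' S B \<longrightarrow> sub w'' S ?P)) \<and>
        (\<forall>w''. w' \<sqsubseteq> w'' \<longrightarrow> (\<forall>U. E w'' U U \<longrightarrow> sub w'' U ?P \<longrightarrow>
          (?cov w'' p U \<longleftrightarrow> (\<exists>S. M w'' S B \<and> sub w'' S U)))))))"
    using assms by (simp add: set_presented_def is_function_on_def stable_step stable_Suc collapse)
  then obtain Bc where Bc: "E w Bc Bc"
    and func: "\<forall>w'. w \<sqsubseteq> w' \<longrightarrow> (\<forall>xa. M w' xa ?P \<longrightarrow> (\<exists>xb. E w' xb xb \<and> rl w' Bc xa xb \<and>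
        (\<forall>w'a. w' \<sqsubseteq> w'a \<longrightarrow> (\<forall>b'. E w'a b' b' \<longrightarrow> rl w'a Bc xa b' \<longrightarrow> E w'a b' xb))))"
    and val: "\<forall>w'. w \<sqsubseteq> w' \<longrightarrow> (\<forall>p. M w' p ?P \<longrightarrow> (\<forall>B. E w' B B \<longrightarrow> rl w' Bc p B \<longrightarrow>
        (\<forall>w''. w' \<sqsubseteq> w'' \<longrightarrow> (\<forall>S. M w'' S B \<longrightarrow> sub w'' S ?P)) \<and>
        (\<forall>w''. w' \<sqsubseteq> w'' \<longrightarrow> (\<forall>U. E w'' U U \<longrightarrow> sub w'' U ?P \<longrightarrow>
          (?cov w'' p U \<longleftrightarrow> (\<exists>S. M w'' S B \<and> sub w'' S U))))))"
    by (elim exE conjE) (rule that)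
  have ex: "\<exists>B. E v B B \<and> rl v Bc p B" if "w \<sqsubseteq> v" "M v p ?P" for v p
    using func that by blast
  have val: "(\<forall>w''. v \<sqsubseteq> w'' \<longrightarrow> (\<forall>S. M w'' S B \<longrightarrow> sub w'' S ?P)) \<and>
      (\<forall>w''. v \<sqsubseteq> w'' \<longrightarrow> (\<forall>U. E w'' U U \<longrightarrow> sub w'' U ?P \<longrightarrow>
        (?cov w'' p U \<longleftrightarrow> (\<exists>S. M w'' S B \<and> sub w'' S U))))"
    if "w \<sqsubseteq> v" "M v p ?P" "E v B B" "rl v Bc p B" for v p B
    using val that by simp
  have sub: "sub v S ?P" if "w \<sqsubseteq> v" "M v p ?P" "E v B B" "rl v Bc p B" "M v S B" for v p B S
    using conjunct1[OF val[OF that(1-4)], THEN spec, THEN mp, OF le_refl] that(5) by blast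
  have cov: "?cov v p U \<longleftrightarrow> (\<exists>S. M v S B \<and> sub v S U)"
    if "w \<sqsubseteq> v" "M v p ?P" "E v B B" "rl v Bc p B" "E v U U" "sub v U ?P" for v p B U
    using conjunct2[OF val[OF that(1-4)], THEN spec, THEN mp, OF le_refl] that(5,6) by blast
  show thesis
  proof (rule that[OF Bc]; intro allI impI)
    fix v p S assume "w \<sqsubseteq> v" "M v p ?P" "bcov v Bc p S"
    then show "sub v S ?P" using sub unfolding bcov_def by blast
  next
    fix v p U assume v: "w \<sqsubseteq> v" "M v p ?P" "E v U U" "sub v U ?P"
    obtain B where "E v B B" "rl v Bc p B" using ex[OF v(1,2)] by blast
    then show "?cov v p U \<longleftrightarrow> (\<exists>S. bcov v Bc p S \<and> sub v S U)"
      using cov[OF v(1,2) _ _ v(3,4)] unfolding bcov_def by blast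
  qed
qed

end

context czf
begin

text \<open>Only a set containing the singletons is needed, so collection of unordered pairs
  suffices, used on the diagonal.\<close>

lemma singletons_ex:
  assumes "E w a a"
  obtains c where "E w c c" "\<And>v x. w \<sqsubseteq> v \<Longrightarrow> M v x a \<Longrightarrow> \<exists>s. M v s c \<and> upr v s x x"
proof -
  have "\<exists>z. E v z z \<and> forces v (z ## y ## x ## (\<lambda>_. a)) (is_upair (\<^bold>v 0) (\<^bold>v 1) (\<^bold>v 2) 0)"
    if v: "w \<sqsubseteq> v" "M v x a" "M v y a" for v x y
    using upair_ex[OF M_dom(1)[OF v(3)] M_dom(1)[OF v(2)]] by (simp add: eval_nat_numeral) blast
  from collection2[OF _ assms assms this] assms obtain c where c: "E w c c"
    "\<And>v x y. w \<sqsubseteq> v \<Longrightarrow> M v x a \<Longrightarrow> M v y a \<Longrightarrow>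
      \<exists>z. M v z c \<and> forces v (z ## y ## x ## (\<lambda>_. a)) (is_upair (\<^bold>v 0) (\<^bold>v 1) (\<^bold>v 2) 0)"
    by auto
  have "\<exists>s. M v s c \<and> upr v s x x" if "w \<sqsubseteq> v" "M v x a" for v x
    using c(2)[OF that that(2)] by (simp add: eval_nat_numeral)
  with c(1) show thesis by (rule that)
qed

lemma pairs_ex:
  assumes "E w a a" "E w b b"
  obtains c where "E w c c" "\<And>v x y. w \<sqsubseteq> v \<Longrightarrow> M v x a \<Longrightarrow> M v y b \<Longrightarrow> \<exists>z. M v z c \<and> opr v z x y"
proof -
  have "\<exists>z. E v z z \<and> forces v (z ## y ## x ## (\<lambda>_. a)) (is_pair (\<^bold>v 0) (\<^bold>v 2) (\<^bold>v 1) 0)"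
    if v: "w \<sqsubseteq> v" "M v x a" "M v y b" for v x y
    using opr_ex[OF M_dom(1)[OF v(2)] M_dom(1)[OF v(3)]] by (simp add: eval_nat_numeral) blast
  from collection2[OF _ assms this] assms obtain c where c: "E w c c"
    "\<And>v x y. w \<sqsubseteq> v \<Longrightarrow> M v x a \<Longrightarrow> M v y b \<Longrightarrow>
      \<exists>z. M v z c \<and> forces v (z ## y ## x ## (\<lambda>_. a)) (is_pair (\<^bold>v 0) (\<^bold>v 2) (\<^bold>v 1) 0)"
    by auto
  have "\<exists>z. M v z c \<and> opr v z x y" if "w \<sqsubseteq> v" "M v x a" "M v y b" for v x y
    using c(2)[OF that] by (simp add: eval_nat_numeral)
  with c(1) show thesis by (rule that)
qed

text \<open>Two formulas describe the set of common lower bounds: the bounded \<open>C\<close>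
  builds it by separation for given \<open>x\<close> and \<open>y\<close>, and \<open>A\<close>
  characterises it so that these sets can be collected.\<close>

lemma meets_ex:
  assumes Q: "E w Q Q" and r: "E w r r"
  obtains c where "E w c c" "\<And>v x y. w \<sqsubseteq> v \<Longrightarrow> M v x Q \<Longrightarrow> M v y Q \<Longrightarrow> \<exists>V. M v V c \<and>
      (\<forall>v' q. v \<sqsubseteq> v' \<longrightarrow> (M v' q V \<longleftrightarrow> M v' q Q \<and> rl v' r q x \<and> rl v' r q y))"
proof -
  define A where "A = (\<^bold>\<forall>q. q \<^bold>\<in> \<^bold>v 0 \<^bold>\<longleftrightarrow> q \<^bold>\<in> \<^bold>v 3 \<^bold>\<and> rel (\<^bold>v 4) q (\<^bold>v 2) \<^bold>\<and> rel (\<^bold>v 4) q (\<^bold>v 1)) 0"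
  define C where "C = (b_rel (\<^bold>v 4) (\<^bold>v 0) (\<^bold>v 2) \<^bold>\<and> b_rel (\<^bold>v 4) (\<^bold>v 0) (\<^bold>v 1)) 0"
  let ?e = "Q ## r ## (\<lambda>_. Q)"
  have A: "forces v (V ## y ## x ## ?e) A \<longleftrightarrow>
      (\<forall>v' q. v \<sqsubseteq> v' \<longrightarrow> (M v' q V \<longleftrightarrow> M v' q Q \<and> rl v' r q x \<and> rl v' r q y))" for v V x y
    unfolding A_def using M_dom(1) by (simp add: eval_nat_numeral) blast
  have "\<exists>V. E v V V \<and> forces v (V ## y ## x ## ?e) A"
    if v: "w \<sqsubseteq> v" "M v x Q" "M v y Q" for v x y
  proof -
    have D: "E v' x x" "E v' y y" if "v \<sqsubseteq> v'" for v'
      using M_dom(1)[OF v(2)] M_dom(1)[OF v(3)] that E_mono by blast+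
    have "bounded_fm C" by (simp add: C_def)
    moreover have "env v (y ## x ## ?e)" "E v Q Q"
      using E_mono[OF Q v(1)] E_mono[OF r v(1)] D le_refl by auto
    ultimately obtain V where V: "E v V V" "\<And>v' q. v \<sqsubseteq> v' \<Longrightarrow>
        M v' q V \<longleftrightarrow> M v' q Q \<and> forces v' (q ## y ## x ## ?e) C"
      using separation_ex[of C v "y ## x ## ?e" Q] by blast
    have "forces v' (q ## y ## x ## ?e) C \<longleftrightarrow> rl v' r q x \<and> rl v' r q y"
      if "v \<sqsubseteq> v'" "M v' q Q" for v' q
      unfolding C_def using D[OF that(1)] M_dom(1)[OF that(2)] by (simp add: eval_nat_numeral)
    then show ?thesis unfolding A using V by blast
  qed
  from collection2[OF _ Q Q this] Q r obtain c where "E w c c"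
    "\<And>v x y. w \<sqsubseteq> v \<Longrightarrow> M v x Q \<Longrightarrow> M v y Q \<Longrightarrow>
      \<exists>V. M v V c \<and> forces v (V ## y ## x ## ?e) A"
    by auto
  with that show thesis unfolding A by blast
qed

text \<open>A pair (p, B) in the graph is {{p}, {p, B}}, so two unions of the graph contain every
  value \<open>B\<close>, and a third union contains the members of these values.\<close>

lemma values_ex:
  assumes "E w Bc Bc"
  obtains b s where "E w b b" "E w s s"
    "\<And>v p B. w \<sqsubseteq> v \<Longrightarrow> E v p p \<Longrightarrow> E v B B \<Longrightarrow> rl v Bc p B \<Longrightarrow> M v B b"
    "\<And>v p S. w \<sqsubseteq> v \<Longrightarrow> E v p p \<Longrightarrow> bcov v Bc p S \<Longrightarrow> M v S s"
proof -
  obtain a where a: "E w a a" "\<And>v x. w \<sqsubseteq> v \<Longrightarrow> M v x a \<longleftrightarrow> (\<exists>y. M v y Bc \<and> M v x y)"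
    using union_ex[OF assms] by blast
  obtain b where b: "E w b b" "\<And>v x. w \<sqsubseteq> v \<Longrightarrow> M v x b \<longleftrightarrow> (\<exists>y. M v y a \<and> M v x y)"
    using union_ex[OF a(1)] by blast
  obtain s where s: "E w s s" "\<And>v x. w \<sqsubseteq> v \<Longrightarrow> M v x s \<longleftrightarrow> (\<exists>y. M v y b \<and> M v x y)"
    using union_ex[OF b(1)] by blast
  have B: "M v B b" if v: "w \<sqsubseteq> v" "E v p p" "E v B B" "rl v Bc p B" for v p B
  proof -
    obtain c where c: "M v c Bc" "opr v c p B" using v(4) unfolding rl_def by blast
    obtain t where "M v t c" "upr v t p B" using opr_members[OF v(2,3) c(2)] by blast
    then show ?thesis using a(2)[OF v(1)] b(2)[OF v(1)] c(1) upr_M(2)[OF v(2,3)] by blast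
  qed
  moreover have "M v S s" if v: "w \<sqsubseteq> v" "E v p p" "bcov v Bc p S" for v p S
    using v(3) B[OF v(1,2)] s(2)[OF v(1)] unfolding bcov_def by blast
  ultimately show thesis using that b(1) s(1) by blast
qed

text \<open>\<open>SS\<close> holds the singletons from \<open>P\<close> and the basic covers on
  \<open>P\<close>; \<open>VV\<close> holds the singletons from \<open>Q\<close>, the basic covers
  on \<open>Q\<close>, the sets of common lower bounds, and \<open>Q\<close> as a member of the
  singleton \<open>t\<close>.\<close>

lemma morphism_rules_ex:
  assumes D: "E w P P" "E w Q Q" "E w leP leP" "E w leQ leQ" "E w BP BP" "E w BQ BQ"
    and subP: "\<forall>v p S. w \<sqsubseteq> v \<longrightarrow> M v p P \<longrightarrow> bcov v BP p S \<longrightarrow> sub v S P"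
    and subQ: "\<forall>v q T. w \<sqsubseteq> v \<longrightarrow> M v q Q \<longrightarrow> bcov v BQ q T \<longrightarrow> sub v T Q"
  obtains U SS VV X Z where "morphism_rules (\<sqsubseteq>) M E w P Q leP leQ BP BQ U SS VV X Z"
proof -
  obtain bP sP where bsP: "E w bP bP" "E w sP sP"
    "\<And>v p B. w \<sqsubseteq> v \<Longrightarrow> E v p p \<Longrightarrow> E v B B \<Longrightarrow> rl v BP p B \<Longrightarrow> M v B bP"
    "\<And>v p S. w \<sqsubseteq> v \<Longrightarrow> E v p p \<Longrightarrow> bcov v BP p S \<Longrightarrow> M v S sP"
    using values_ex[OF D(5)] by metis
  obtain bQ sQ where bsQ: "E w bQ bQ" "E w sQ sQ"
    "\<And>v p B. w \<sqsubseteq> v \<Longrightarrow> E v p p \<Longrightarrow> E v B B \<Longrightarrow> rl v BQ p B \<Longrightarrow> M v B bQ"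
    "\<And>v p S. w \<sqsubseteq> v \<Longrightarrow> E v p p \<Longrightarrow> bcov v BQ p S \<Longrightarrow> M v S sQ"
    using values_ex[OF D(6)] by metis
  obtain cP where cP: "E w cP cP" "\<And>v x. w \<sqsubseteq> v \<Longrightarrow> M v x P \<Longrightarrow> \<exists>s. M v s cP \<and> upr v s x x"
    using singletons_ex[OF D(1)] by metis
  obtain cQ where cQ: "E w cQ cQ" "\<And>v x. w \<sqsubseteq> v \<Longrightarrow> M v x Q \<Longrightarrow> \<exists>s. M v s cQ \<and> upr v s x x"
    using singletons_ex[OF D(2)] by metis
  obtain m where m: "E w m m" "\<And>v x y. w \<sqsubseteq> v \<Longrightarrow> M v x Q \<Longrightarrow> M v y Q \<Longrightarrow> \<exists>V. M v V m \<and>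
      (\<forall>v' q. v \<sqsubseteq> v' \<longrightarrow> (M v' q V \<longleftrightarrow> M v' q Q \<and> rl v' leQ q x \<and> rl v' leQ q y))"
    using meets_ex[OF D(2,4)] by metis
  obtain t where t: "E w t t" "upr w t Q Q" using upair_ex[OF D(2,2)] .
  obtain SS where SS: "E w SS SS" "\<And>v x. w \<sqsubseteq> v \<Longrightarrow> M v x SS \<longleftrightarrow> M v x cP \<or> M v x sP"
    using binary_union_ex[OF cP(1) bsP(2)] by metis
  obtain V1 where V1: "E w V1 V1" "\<And>v x. w \<sqsubseteq> v \<Longrightarrow> M v x V1 \<longleftrightarrow> M v x cQ \<or> M v x sQ"
    using binary_union_ex[OF cQ(1) bsQ(2)] by metis
  obtain V2 where V2: "E w V2 V2" "\<And>v x. w \<sqsubseteq> v \<Longrightarrow> M v x V2 \<longleftrightarrow> M v x m \<or> M v x t"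
    using binary_union_ex[OF m(1) t(1)] by metis
  obtain VV where VV: "E w VV VV" "\<And>v x. w \<sqsubseteq> v \<Longrightarrow> M v x VV \<longleftrightarrow> M v x V1 \<or> M v x V2"
    using binary_union_ex[OF V1(1) V2(1)] by metis
  obtain U1 where U1: "E w U1 U1" "\<And>v x. w \<sqsubseteq> v \<Longrightarrow> M v x U1 \<longleftrightarrow> M v x P \<or> M v x Q"
    using binary_union_ex[OF D(1,2)] by metis
  obtain U2 where U2: "E w U2 U2" "\<And>v x. w \<sqsubseteq> v \<Longrightarrow> M v x U2 \<longleftrightarrow> M v x SS \<or> M v x VV"
    using binary_union_ex[OF SS(1) VV(1)] by metis
  obtain U3 where U3: "E w U3 U3" "\<And>v x. w \<sqsubseteq> v \<Longrightarrow> M v x U3 \<longleftrightarrow> M v x bP \<or> M v x bQ"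
    using binary_union_ex[OF bsP(1) bsQ(1)] by metis
  obtain U4 where U4: "E w U4 U4" "\<And>v x. w \<sqsubseteq> v \<Longrightarrow> M v x U4 \<longleftrightarrow> M v x U1 \<or> M v x U2"
    using binary_union_ex[OF U1(1) U2(1)] by metis
  obtain U where U: "E w U U" "\<And>v x. w \<sqsubseteq> v \<Longrightarrow> M v x U \<longleftrightarrow> M v x U4 \<or> M v x U3"
    using binary_union_ex[OF U4(1) U3(1)] by metis
  obtain X where X: "E w X X" "\<And>v x y. w \<sqsubseteq> v \<Longrightarrow> M v x SS \<Longrightarrow> M v y VV \<Longrightarrow> \<exists>z. M v z X \<and> opr v z x y"
    using pairs_ex[OF SS(1) VV(1)] by metis
  obtain Z where Z: "E w Z Z" "\<And>v x y. w \<sqsubseteq> v \<Longrightarrow> M v x P \<Longrightarrow> M v y Q \<Longrightarrow> \<exists>z. M v z Z \<and> opr v z x y"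
    using pairs_ex[OF D(1,2)] by metis
  have U_iff: "M v x U \<longleftrightarrow> M v x P \<or> M v x Q \<or> M v x SS \<or> M v x VV \<or> M v x bP \<or> M v x bQ" if "w \<sqsubseteq> v" for v x
    using U(2) U4(2) U3(2) U2(2) U1(2) that by blast
  have VV_iff: "M v x VV \<longleftrightarrow> M v x cQ \<or> M v x sQ \<or> M v x m \<or> M v x t" if "w \<sqsubseteq> v" for v x
    using VV(2) V1(2) V2(2) that by blast
  have "morphism_rules (\<sqsubseteq>) M E w P Q leP leQ BP BQ U SS VV X Z"
  proof
    show "E w P P" "E w Q Q" "E w leP leP" "E w leQ leQ" "E w BP BP" "E w BQ BQ" "E w U U" "E w SS SS"
      "E w VV VV" "E w X X" "E w Z Z"
      by (fact D U(1) SS(1) VV(1) X(1) Z(1))+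
    show "sub w P U" "sub w Q U" "sub w SS U" "sub w VV U" using U_iff unfolding sub_def by blast+
    show "M w Q VV" using VV_iff[OF le_refl] upr_M(1)[OF D(2,2) t(2)] by blast
  next
    fix v p B assume "w \<sqsubseteq> v" "M v p P" "E v B B" "rl v BP p B"
    then show "M v B U" using U_iff bsP(3) M_dom(1) by blast
  next
    fix v p B assume "w \<sqsubseteq> v" "M v p Q" "E v B B" "rl v BQ p B"
    then show "M v B U" using U_iff bsQ(3) M_dom(1) by blast
  next
    fix v p assume "w \<sqsubseteq> v" "M v p P"
    then show "\<exists>s. M v s SS \<and> upr v s p p" using SS(2) cP(2) by blast
  next
    fix v p assume "w \<sqsubseteq> v" "M v p Q"
    then show "\<exists>s. M v s VV \<and> upr v s p p" using VV_iff cQ(2) by blast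
  next
    fix v p S assume "w \<sqsubseteq> v" "M v p P" "bcov v BP p S"
    then show "M v S SS \<and> sub v S P" using SS(2) bsP(4) M_dom(1) subP by blast
  next
    fix v p S assume "w \<sqsubseteq> v" "M v p Q" "bcov v BQ p S"
    then show "M v S VV \<and> sub v S Q" using VV_iff bsQ(4) M_dom(1) subQ by blast
  next
    fix v x y assume v: "w \<sqsubseteq> v" "M v x Q" "M v y Q"
    then show "\<exists>V. M v V VV \<and>
      (\<forall>v' q. v \<sqsubseteq> v' \<longrightarrow> (M v' q V \<longleftrightarrow> M v' q Q \<and> rl v' leQ q x \<and> rl v' leQ q y))"
      using VV_iff[OF v(1)] m(2)[OF v] by blast
  next
    fix v S V assume "w \<sqsubseteq> v" "M v S SS" "M v V VV"
    then show "\<exists>x. M v x X \<and> opr v x S V" by (rule X(2))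
  next
    fix v S V assume "w \<sqsubseteq> v" "M v S P" "M v V Q"
    then show "\<exists>x. M v x Z \<and> opr v x S V" by (rule Z(2))
  qed
  then show thesis by (rule that)
qed

end

context morphism_rules
begin

text \<open>The forced meaning of \<open>morphism\<close>, with the quantifier nesting left as the
  simplifier produces it, and with the two covers as arbitrary predicates.\<close>

definition cov_mor :: "('a \<Rightarrow> 'b \<Rightarrow> 'b \<Rightarrow> bool) \<Rightarrow> ('a \<Rightarrow> 'b \<Rightarrow> 'b \<Rightarrow> bool) \<Rightarrow> 'a \<Rightarrow> 'b \<Rightarrow> bool" where
  "cov_mor cov cov' v F \<longleftrightarrow>
    (\<forall>v'. v \<sqsubseteq> v' \<longrightarrow> (\<forall>c. M v' c F \<longrightarrow> (\<exists>p. M v' p P \<and> (\<exists>q. M v' q Q \<and> opr v' c p q)))) \<and>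
    (\<forall>v'. v \<sqsubseteq> v' \<longrightarrow> (\<forall>p. M v' p P \<longrightarrow> (\<forall>p'. M v' p' P \<longrightarrow> (\<forall>q. M v' q Q \<longrightarrow> (\<forall>q'. M v' q' Q \<longrightarrow>
      rl v' F p q \<and> rl v' leP p' p \<and> rl v' leQ q q' \<longrightarrow> rl v' F p' q'))))) \<and>
    (\<forall>v'. v \<sqsubseteq> v' \<longrightarrow> (\<forall>q. M v' q Q \<longrightarrow> (\<forall>p. M v' p P \<longrightarrow> (\<forall>U. E v' U U \<longrightarrow> sub v' U P \<longrightarrow>
      cov v' p U \<and> (\<forall>u. v' \<sqsubseteq> u \<longrightarrow> (\<forall>p'. M u p' U \<longrightarrow> rl u F p' q)) \<longrightarrow> rl v' F p q)))) \<and>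
    (\<forall>v'. v \<sqsubseteq> v' \<longrightarrow> (\<forall>p. M v' p P \<longrightarrow> (\<exists>S. E v' S S \<and> sub v' S P \<and> cov v' p S \<and>
      (\<forall>u. v' \<sqsubseteq> u \<longrightarrow> (\<forall>p'. M u p' S \<longrightarrow> (\<exists>q. M u q Q \<and> rl u F p' q)))))) \<and>
    (\<forall>v'. v \<sqsubseteq> v' \<longrightarrow> (\<forall>q0. M v' q0 Q \<longrightarrow> (\<forall>q1. M v' q1 Q \<longrightarrow> (\<forall>p. M v' p P \<longrightarrow>
      rl v' F p q0 \<and> rl v' F p q1 \<longrightarrow> (\<exists>S. E v' S S \<and> sub v' S P \<and> cov v' p S \<and>
        (\<forall>u. v' \<sqsubseteq> u \<longrightarrow> (\<forall>p'. M u p' S \<longrightarrow>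
          (\<exists>q. M u q Q \<and> rl u F p' q \<and> rl u leQ q q0 \<and> rl u leQ q q1)))))))) \<and>
    (\<forall>v'. v \<sqsubseteq> v' \<longrightarrow> (\<forall>p. M v' p P \<longrightarrow> (\<forall>q. M v' q Q \<longrightarrow> (\<forall>T. E v' T T \<longrightarrow> sub v' T Q \<longrightarrow>
      rl v' F p q \<and> cov' v' q T \<longrightarrow> (\<exists>S. E v' S S \<and> sub v' S P \<and>
        (\<forall>u. v' \<sqsubseteq> u \<longrightarrow> (\<forall>s. M u s S \<longrightarrow> (\<forall>c. M u c P \<longrightarrow> rl u leP c s \<longrightarrow> M u c S))) \<and> cov v' p S \<and>
        (\<forall>u. v' \<sqsubseteq> u \<longrightarrow> (\<forall>p'. M u p' S \<longrightarrow> (\<exists>q. M u q T \<and> rl u F p' q))))))))"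

lemmas cov_mor_pairs = cov_mor_def[THEN iffD1, THEN conjunct1, THEN spec, THEN mp]
lemmas cov_mor_mono = cov_mor_def[THEN iffD1, THEN conjunct2, THEN conjunct1, THEN spec, THEN mp]
lemmas cov_mor_cov = cov_mor_def[THEN iffD1, THEN conjunct2, THEN conjunct2, THEN conjunct1, THEN spec, THEN mp]
lemmas cov_mor_total = cov_mor_def[THEN iffD1, THEN conjunct2, THEN conjunct2, THEN conjunct2, THEN conjunct1, THEN spec, THEN mp]
lemmas cov_mor_meet = cov_mor_def[THEN iffD1, THEN conjunct2, THEN conjunct2, THEN conjunct2, THEN conjunct2, THEN conjunct1, THEN spec, THEN mp]
lemmas cov_mor_cover = cov_mor_def[THEN iffD1, THEN conjunct2, THEN conjunct2, THEN conjunct2, THEN conjunct2, THEN conjunct2, THEN spec, THEN mp]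

lemma forces_morphism:
  assumes "stable n xP" "stable n xl" "stable n xQ" "stable n xl'" "stable n xF"
    and "e (xP n) = P" "e (xl n) = leP" "e (xQ n) = Q" "e (xl' n) = leQ" "e (xF n) = F"
  shows "forces v e (morphism xP xl (class_rel A) xQ xl' (class_rel A') xF n) \<longleftrightarrow>
    cov_mor (\<lambda>v p U. forces v (p ## U ## (\<lambda>i. e (i + n))) A)
      (\<lambda>v p U. forces v (p ## U ## (\<lambda>i. e (i + n))) A') v F"
  unfolding cov_mor_def using assms
  by (simp add: morphism_def is_relation_def stable_step stable_Suc collapse)

lemma down_ex:
  assumes v: "w \<sqsubseteq> v" and S: "E v S S" "sub v S P"
    and refl: "\<forall>v p. w \<sqsubseteq> v \<longrightarrow> M v p P \<longrightarrow> rl v leP p p"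
    and trans: "\<forall>v p q r. w \<sqsubseteq> v \<longrightarrow> M v p P \<longrightarrow> M v q P \<longrightarrow> M v r P \<longrightarrow>
      rl v leP p q \<longrightarrow> rl v leP q r \<longrightarrow> rl v leP p r"
  obtains D where "E v D D" "sub v D P" "sub v S D"
    "\<forall>u. v \<sqsubseteq> u \<longrightarrow> (\<forall>s. M u s D \<longrightarrow> (\<forall>c. M u c P \<longrightarrow> rl u leP c s \<longrightarrow> M u c D))"
    "\<forall>u c. v \<sqsubseteq> u \<longrightarrow> M u c D \<longrightarrow> M u c P \<and> (\<exists>s. M u s S \<and> M u s P \<and> rl u leP c s)"
proof -
  define A where "A = (\<^bold>\<exists>s\<^bold>\<in>\<^bold>v 1. b_rel (\<^bold>v 2) (\<^bold>v 0) s) 0"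
  let ?e = "S ## leP ## (\<lambda>_. P)"
  have "bounded_fm A" by (simp add: A_def)
  moreover have "env v ?e" "E v P P" using S(1) dom E_mono[OF _ v] by auto
  ultimately obtain D where D: "E v D D"
    "\<And>u c. v \<sqsubseteq> u \<Longrightarrow> M u c D \<longleftrightarrow> M u c P \<and> forces u (c ## ?e) A"
    using separation_ex[of A v ?e P] by blast
  have iff: "M u c D \<longleftrightarrow> M u c P \<and> (\<exists>s. M u s S \<and> rl u leP c s)" if "v \<sqsubseteq> u" for u c
    unfolding D(2)[OF that] A_def using M_dom(1) by (simp add: eval_nat_numeral) blast
  have SP: "M u s P" if "v \<sqsubseteq> u" "M u s S" for u s using S(2) that unfolding sub_def by blast
  show thesis
  proof (rule that[OF D(1)])
    show "sub v D P" using iff unfolding sub_def by blast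
    show "sub v S D" using iff SP refl le_trans[OF v] unfolding sub_def by blast
    show "\<forall>u c. v \<sqsubseteq> u \<longrightarrow> M u c D \<longrightarrow> M u c P \<and> (\<exists>s. M u s S \<and> M u s P \<and> rl u leP c s)"
      using iff SP by blast
    show "\<forall>u. v \<sqsubseteq> u \<longrightarrow> (\<forall>s. M u s D \<longrightarrow> (\<forall>c. M u c P \<longrightarrow> rl u leP c s \<longrightarrow> M u c D))"
    proof (intro allI impI)
      fix u s c assume u: "v \<sqsubseteq> u" "M u s D" "M u c P" "rl u leP c s"
      then obtain s' where s': "M u s P" "M u s' S" "rl u leP s s'" using iff by blast
      then have "rl u leP c s'" using trans le_trans[OF v u(1)] u(3,4) SP[OF u(1)] by blast
      then show "M u c D" using iff[OF u(1)] u(3) s'(2) by blast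
    qed
  qed
qed

text \<open>Every cover contains a basic one, and a basic cover is a cover. Downward closure in the
  last condition is recovered by closing a basic cover downwards, since a morphism is
  monotone.\<close>

lemma cov_mor_iff_mor:
  assumes v: "w \<sqsubseteq> v"
    and covP: "\<forall>v p U. w \<sqsubseteq> v \<longrightarrow> M v p P \<longrightarrow> E v U U \<longrightarrow> sub v U P \<longrightarrow>
      (cov v p U \<longleftrightarrow> (\<exists>S. bcov v BP p S \<and> sub v S U))"
    and covQ: "\<forall>v q U. w \<sqsubseteq> v \<longrightarrow> M v q Q \<longrightarrow> E v U U \<longrightarrow> sub v U Q \<longrightarrow>
      (cov' v q U \<longleftrightarrow> (\<exists>S. bcov v BQ q S \<and> sub v S U))"
    and reflP: "\<forall>v p. w \<sqsubseteq> v \<longrightarrow> M v p P \<longrightarrow> rl v leP p p"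
    and transP: "\<forall>v p q r. w \<sqsubseteq> v \<longrightarrow> M v p P \<longrightarrow> M v q P \<longrightarrow> M v r P \<longrightarrow>
      rl v leP p q \<longrightarrow> rl v leP q r \<longrightarrow> rl v leP p r"
    and reflQ: "\<forall>v p. w \<sqsubseteq> v \<longrightarrow> M v p Q \<longrightarrow> rl v leQ p p"
  shows "cov_mor cov cov' v F \<longleftrightarrow> mor v F"
proof -
  have sub_refl: "sub u a a" for u a unfolding sub_def by blast
  have bcovP: "E u S S" "sub u S P" "cov u p S" if "v \<sqsubseteq> u" "M u p P" "bcov u BP p S" for u p S
    using bcov_P[OF le_trans[OF v that(1)] that(2,3)] that M_dom(1) covP le_trans[OF v] sub_refl by blast+
  have bcovQ: "E u T T" "sub u T Q" "cov' u q T" if "v \<sqsubseteq> u" "M u q Q" "bcov u BQ q T" for u q T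
    using bcov_Q[OF le_trans[OF v that(1)] that(2,3)] that M_dom(1) covQ le_trans[OF v] sub_refl by blast+
  have coverP: "\<exists>S'. bcov u BP p S' \<and> sub u S' S" if "v \<sqsubseteq> u" "M u p P" "E u S S" "sub u S P" "cov u p S" for u p S
    using covP le_trans[OF v] that by blast
  have coverQ: "\<exists>S'. bcov u BQ p S' \<and> sub u S' S" if "v \<sqsubseteq> u" "M u p Q" "E u S S" "sub u S Q" "cov' u p S" for u p S
    using covQ le_trans[OF v] that by blast
  have m0: "(\<exists>p. M v' p P \<and> (\<exists>q. M v' q Q \<and> opr v' c p q)) \<longleftrightarrow> (\<exists>p q. M v' p P \<and> M v' q Q \<and> opr v' c p q)" for v' c
    by blast
  have m2: "(\<forall>U. E v' U U \<longrightarrow> sub v' U P \<longrightarrow>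
        cov v' p U \<and> (\<forall>u. v' \<sqsubseteq> u \<longrightarrow> (\<forall>p'. M u p' U \<longrightarrow> rl u F p' q)) \<longrightarrow> rl v' F p q) \<longleftrightarrow>
      (\<forall>S. bcov v' BP p S \<longrightarrow> (\<forall>u p'. v' \<sqsubseteq> u \<longrightarrow> M u p' S \<longrightarrow> rl u F p' q) \<longrightarrow> rl v' F p q)"
    if "v \<sqsubseteq> v'" "M v' p P" for v' p q
    using bcovP[OF that] coverP[OF that] unfolding sub_def by meson
  \<comment> \<open>The property \<open>K\<close> of the elements of the cover is left open, as this
    equivalence serves totality, the condition on two elements of \<open>Q\<close>, and the covering
    condition once downward closure is dropped.\<close>
  have m34: "(\<exists>S. E v' S S \<and> sub v' S P \<and> cov v' p S \<and> (\<forall>u. v' \<sqsubseteq> u \<longrightarrow> (\<forall>p'. M u p' S \<longrightarrow> K u p'))) \<longleftrightarrow>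
      (\<exists>S. bcov v' BP p S \<and> (\<forall>u p'. v' \<sqsubseteq> u \<longrightarrow> M u p' S \<longrightarrow> K u p'))"
    if "v \<sqsubseteq> v'" "M v' p P" for v' p K
    using bcovP[OF that] coverP[OF that] unfolding sub_def by meson
  show ?thesis
  proof
    assume c: "cov_mor cov cov' v F"
    show "mor v F"
      unfolding mor_def
    proof (intro conjI allI impI; (elim conjE)?)
      fix v' z assume "v \<sqsubseteq> v'" "M v' z F"
      then show "\<exists>p q. M v' p P \<and> M v' q Q \<and> opr v' z p q" using cov_mor_pairs[OF c] by blast
    next
      fix v' p p' q q' assume v': "v \<sqsubseteq> v'" and a: "M v' p P" "M v' p' P" "M v' q Q" "M v' q' Q"
        "rl v' leP p' p" "rl v' leQ q q'" "rl v' F p q"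
      then show "rl v' F p' q'" using cov_mor_mono[OF c v'] by blast
    next
      fix v' p q S assume v': "v \<sqsubseteq> v'" and a: "M v' p P" "M v' q Q" "bcov v' BP p S"
        and F: "\<forall>u p'. v' \<sqsubseteq> u \<longrightarrow> M u p' S \<longrightarrow> rl u F p' q"
      note cov_mor_cov[OF c v', THEN spec, THEN mp, OF a(2), THEN spec, THEN mp, OF a(1)]
      from this[unfolded m2[OF v' a(1)]] show "rl v' F p q" using a(3) F by blast
    next
      fix v' p assume v': "v \<sqsubseteq> v'" "M v' p P"
      note cov_mor_total[OF c v'(1), THEN spec, THEN mp, OF v'(2)]
      then show "\<exists>S. bcov v' BP p S \<and> (\<forall>u p'. v' \<sqsubseteq> u \<longrightarrow> M u p' S \<longrightarrow> (\<exists>q. M u q Q \<and> rl u F p' q))"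
        unfolding m34[OF v'] .
    next
      fix v' p q0 q1
      assume v': "v \<sqsubseteq> v'" and a: "M v' p P" "M v' q0 Q" "M v' q1 Q" "rl v' F p q0" "rl v' F p q1"
      note cov_mor_meet[OF c v', THEN spec, THEN mp, OF a(2), THEN spec, THEN mp, OF a(3),
          THEN spec, THEN mp, OF a(1), THEN mp, OF conjI[OF a(4,5)]]
      then show "\<exists>S. bcov v' BP p S \<and> (\<forall>u p'. v' \<sqsubseteq> u \<longrightarrow> M u p' S \<longrightarrow>
          (\<exists>q. M u q Q \<and> rl u F p' q \<and> rl u leQ q q0 \<and> rl u leQ q q1))"
        unfolding m34[OF v' a(1)] .
    next
      fix v' p q T assume v': "v \<sqsubseteq> v'" and a: "M v' p P" "M v' q Q" "bcov v' BQ q T" "rl v' F p q"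
      note T = bcovQ[OF v' a(2,3)]
      from cov_mor_cover[OF c v', THEN spec, THEN mp, OF a(1), THEN spec, THEN mp, OF a(2),
          THEN spec, THEN mp, OF T(1), THEN mp, OF T(2), THEN mp, OF conjI[OF a(4) T(3)]]
      have "\<exists>S. E v' S S \<and> sub v' S P \<and> cov v' p S \<and>
          (\<forall>u. v' \<sqsubseteq> u \<longrightarrow> (\<forall>p'. M u p' S \<longrightarrow> (\<exists>q. M u q T \<and> rl u F p' q)))" by blast
      then show "\<exists>S. bcov v' BP p S \<and> (\<forall>u p'. v' \<sqsubseteq> u \<longrightarrow> M u p' S \<longrightarrow> (\<exists>q. M u q T \<and> rl u F p' q))"
        unfolding m34[OF v' a(1)] .
    qed
  next
    assume m: "mor v F"
    show "cov_mor cov cov' v F"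
      unfolding cov_mor_def
    proof (intro conjI allI impI; (elim conjE)?)
      fix v' z assume "v \<sqsubseteq> v'" "M v' z F"
      then show "\<exists>p. M v' p P \<and> (\<exists>q. M v' q Q \<and> opr v' z p q)" using mor_pairs[OF m] by blast
    next
      fix v' p p' q q' assume v': "v \<sqsubseteq> v'" and a: "M v' p P" "M v' p' P" "M v' q Q" "M v' q' Q"
        "rl v' F p q" "rl v' leP p' p" "rl v' leQ q q'"
      then show "rl v' F p' q'" using mor_mono[OF m v'] by blast
    next
      fix v' q p U assume v': "v \<sqsubseteq> v'" and a: "M v' q Q" "M v' p P" and U: "E v' U U" "sub v' U P" "cov v' p U"
        and F: "\<forall>u. v' \<sqsubseteq> u \<longrightarrow> (\<forall>p'. M u p' U \<longrightarrow> rl u F p' q)"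
      have "\<forall>S. bcov v' BP p S \<longrightarrow> (\<forall>u p'. v' \<sqsubseteq> u \<longrightarrow> M u p' S \<longrightarrow> rl u F p' q) \<longrightarrow> rl v' F p q"
        using mor_cov[OF m v'] a by blast
      from this[folded m2[OF v' a(2)]] show "rl v' F p q" using U F by blast
    next
      fix v' p assume v': "v \<sqsubseteq> v'" "M v' p P"
      show "\<exists>S. E v' S S \<and> sub v' S P \<and> cov v' p S \<and>
          (\<forall>u. v' \<sqsubseteq> u \<longrightarrow> (\<forall>p'. M u p' S \<longrightarrow> (\<exists>q. M u q Q \<and> rl u F p' q)))"
        unfolding m34[OF v'] using mor_total[OF m v'(1)] v'(2) by blast
    next
      fix v' q0 q1 p
      assume v': "v \<sqsubseteq> v'" and a: "M v' q0 Q" "M v' q1 Q" "M v' p P" "rl v' F p q0" "rl v' F p q1"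
      show "\<exists>S. E v' S S \<and> sub v' S P \<and> cov v' p S \<and> (\<forall>u. v' \<sqsubseteq> u \<longrightarrow> (\<forall>p'. M u p' S \<longrightarrow>
          (\<exists>q. M u q Q \<and> rl u F p' q \<and> rl u leQ q q0 \<and> rl u leQ q q1)))"
        unfolding m34[OF v' a(3)] using mor_meet[OF m v'] a by blast
    next
      fix v' p q T assume v': "v \<sqsubseteq> v'" and a: "M v' p P" "M v' q Q" and T: "E v' T T" "sub v' T Q"
        and F: "rl v' F p q" "cov' v' q T"
      obtain T' where T': "bcov v' BQ q T'" "sub v' T' T" using coverQ[OF v' a(2) T F(2)] by blast
      obtain S where S: "bcov v' BP p S" "\<forall>u p'. v' \<sqsubseteq> u \<longrightarrow> M u p' S \<longrightarrow> (\<exists>q. M u q T' \<and> rl u F p' q)"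
        using mor_cover[OF m v'] a T'(1) F(1) by blast
      note S' = bcovP[OF v' a(1) S(1)]
      obtain D where D: "E v' D D" "sub v' D P" "sub v' S D"
        "\<forall>u. v' \<sqsubseteq> u \<longrightarrow> (\<forall>s. M u s D \<longrightarrow> (\<forall>c. M u c P \<longrightarrow> rl u leP c s \<longrightarrow> M u c D))"
        "\<forall>u c. v' \<sqsubseteq> u \<longrightarrow> M u c D \<longrightarrow> M u c P \<and> (\<exists>s. M u s S \<and> M u s P \<and> rl u leP c s)"
        using down_ex[OF le_trans[OF v v'] S'(1,2) reflP transP] by metis
      \<comment> \<open>The given cover \<open>T\<close> is shrunk to a basic cover so that
        \<open>mor\<close> applies, while the basic cover \<open>S\<close> obtained is enlarged to
        its downward closure \<open>D\<close>, which still covers \<open>p\<close>.\<close>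
      have "cov v' p D" using covP le_trans[OF v v'] a(1) D(1-3) S(1) by blast
      moreover have "\<exists>q. M u q T \<and> rl u F p' q" if u: "v' \<sqsubseteq> u" "M u p' D" for u p'
      proof -
        have vu: "v \<sqsubseteq> u" using v' u(1) by (rule le_trans)
        obtain s where s: "M u p' P" "M u s S" "M u s P" "rl u leP p' s" using D(5) u by blast
        obtain r where r: "M u r T'" "rl u F s r" using S(2) u(1) s(2) by blast
        have rT: "M u r T" using r(1) T'(2) u(1) unfolding sub_def by blast
        then have rQ: "M u r Q" using T(2) u(1) unfolding sub_def by blast
        have "rl u leQ r r" using reflQ le_trans[OF v vu] rQ by blast
        then have "rl u F p' r" using mor_mono[OF m vu] s rQ r(2) by blast
        with rT show ?thesis by blast
      qed
      ultimately show "\<exists>S. E v' S S \<and> sub v' S P \<and>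
          (\<forall>u. v' \<sqsubseteq> u \<longrightarrow> (\<forall>s. M u s S \<longrightarrow> (\<forall>c. M u c P \<longrightarrow> rl u leP c s \<longrightarrow> M u c S))) \<and> cov v' p S \<and>
          (\<forall>u. v' \<sqsubseteq> u \<longrightarrow> (\<forall>p'. M u p' S \<longrightarrow> (\<exists>q. M u q T \<and> rl u F p' q)))"
        using D(1,2,4) by blast
    qed
  qed
qed

end

section \<open>Forcing of the theorem in a model of the axioms\<close>

context czf
begin

lemma forces_set_generated: "forces w e (set_generated C n) \<longleftrightarrow>
    (\<exists>G. E w G G \<and>
      (\<forall>v. w \<sqsubseteq> v \<longrightarrow> (\<forall>F. M v F G \<longrightarrow>
        forces v (F ## G ## e) (C (\<lambda>m. m - Suc (Suc n)) (Suc (Suc n))))) \<and>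
      (\<forall>v. w \<sqsubseteq> v \<longrightarrow> (\<forall>F. E v F F \<longrightarrow>
        forces v (F ## G ## e) (C (\<lambda>m. m - Suc (Suc n)) (Suc (Suc n))) \<longrightarrow>
        (\<forall>u. v \<sqsubseteq> u \<longrightarrow> (\<forall>x. M u x F \<longrightarrow> (\<exists>F'. M u F' G \<and> M u x F' \<and> sub u F' F))))))"
  by (simp add: set_generated_def stable_Suc)

lemma set_generated_morphisms:
  assumes st: "stable n xP" "stable n xl" "stable n xQ" "stable n xl'"
    and e: "env w e"
    and fs: "forces w e (formal_space xP xl (class_rel A) n)" "forces w e (set_presented xP (class_rel A) n)"
      "forces w e (formal_space xQ xl' (class_rel A') n)" "forces w e (set_presented xQ (class_rel A') n)"
  shows "forces w e (set_generated (\<lambda>F. morphism xP xl (class_rel A) xQ xl' (class_rel A') F) n)"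
proof -
  let ?P = "e (xP n)" and ?l = "e (xl n)" and ?Q = "e (xQ n)" and ?l' = "e (xl' n)"
  let ?cov = "\<lambda>v p U. forces v (p ## U ## (\<lambda>i. e (i + n))) A"
  let ?cov' = "\<lambda>v p U. forces v (p ## U ## (\<lambda>i. e (i + n))) A'"
  have "forces w e (is_preorder xP xl n)" "forces w e (is_preorder xQ xl' n)"
    using fs(1,3) unfolding formal_space_def forces_fConj by blast+
  then have pre: "\<forall>v p. w \<sqsubseteq> v \<longrightarrow> M v p ?P \<longrightarrow> rl v ?l p p"
      "\<forall>v p q r. w \<sqsubseteq> v \<longrightarrow> M v p ?P \<longrightarrow> M v q ?P \<longrightarrow> M v r ?P \<longrightarrow> rl v ?l p q \<longrightarrow> rl v ?l q r \<longrightarrow> rl v ?l p r"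
      "\<forall>v p. w \<sqsubseteq> v \<longrightarrow> M v p ?Q \<longrightarrow> rl v ?l' p p"
    unfolding forces_is_preorder[OF st(1,2)] forces_is_preorder[OF st(3,4)] by blast+
  obtain Bc where Bc: "E w Bc Bc" "\<forall>v p S. w \<sqsubseteq> v \<longrightarrow> M v p ?P \<longrightarrow> bcov v Bc p S \<longrightarrow> sub v S ?P"
    "\<forall>v p U. w \<sqsubseteq> v \<longrightarrow> M v p ?P \<longrightarrow> E v U U \<longrightarrow> sub v U ?P \<longrightarrow>
      (?cov v p U \<longleftrightarrow> (\<exists>S. bcov v Bc p S \<and> sub v S U))"
    using forces_set_presented[OF st(1) fs(2)] .
  obtain Bc' where Bc': "E w Bc' Bc'" "\<forall>v p S. w \<sqsubseteq> v \<longrightarrow> M v p ?Q \<longrightarrow> bcov v Bc' p S \<longrightarrow> sub v S ?Q"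
    "\<forall>v p U. w \<sqsubseteq> v \<longrightarrow> M v p ?Q \<longrightarrow> E v U U \<longrightarrow> sub v U ?Q \<longrightarrow>
      (?cov' v p U \<longleftrightarrow> (\<exists>S. bcov v Bc' p S \<and> sub v S U))"
    using forces_set_presented[OF st(3) fs(4)] .
  have "E w ?P ?P" "E w ?Q ?Q" "E w ?l ?l" "E w ?l' ?l'" using e unfolding env_def by blast+
  then obtain U SS VV X Z where "morphism_rules (\<sqsubseteq>) M E w ?P ?Q ?l ?l' Bc Bc' U SS VV X Z"
    using morphism_rules_ex[OF _ _ _ _ Bc(1) Bc'(1) Bc(2) Bc'(2)] by blast
  then interpret mr: morphism_rules "(\<sqsubseteq>)" M E w ?P ?Q ?l ?l' Bc Bc' U SS VV X Z .
  obtain G where G: "E w G G" "\<forall>v F. w \<sqsubseteq> v \<longrightarrow> M v F G \<longrightarrow> mr.mor v F"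
    "\<forall>v F x. w \<sqsubseteq> v \<longrightarrow> E v F F \<longrightarrow> mr.mor v F \<longrightarrow> M v x F \<longrightarrow> (\<exists>F'. M v F' G \<and> M v x F' \<and> sub v F' F)"
    using mr.morphisms_set_generated by (elim exE conjE) (rule that)
  have mor: "forces v (F ## G ## e)
      (morphism xP xl (class_rel A) xQ xl' (class_rel A') (\<lambda>m. m - Suc (Suc n)) (Suc (Suc n))) \<longleftrightarrow> mr.mor v F"
    if v: "w \<sqsubseteq> v" for v F
  proof -
    have "forces v (F ## G ## e)
        (morphism xP xl (class_rel A) xQ xl' (class_rel A') (\<lambda>m. m - Suc (Suc n)) (Suc (Suc n))) \<longleftrightarrow>
      mr.cov_mor ?cov ?cov' v F"
      using st by (subst mr.forces_morphism) (simp_all add: stable_step stable_Suc)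
    also have "\<dots> \<longleftrightarrow> mr.mor v F"
      by (rule mr.cov_mor_iff_mor[OF v Bc(3) Bc'(3) pre])
    finally show ?thesis .
  qed
  show ?thesis
    unfolding forces_set_generated
  proof (rule exI[of _ G], intro conjI allI impI)
    show "E w G G" by (rule G(1))
  next
    fix v F assume v: "w \<sqsubseteq> v" "M v F G"
    then show "forces v (F ## G ## e)
        (morphism xP xl (class_rel A) xQ xl' (class_rel A') (\<lambda>m. m - Suc (Suc n)) (Suc (Suc n)))"
      using mor[OF v(1)] G(2) by blast
  next
    fix v F u x assume v: "w \<sqsubseteq> v" "E v F F" "v \<sqsubseteq> u" "M u x F"
      and F: "forces v (F ## G ## e)
        (morphism xP xl (class_rel A) xQ xl' (class_rel A') (\<lambda>m. m - Suc (Suc n)) (Suc (Suc n)))"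
    have "mr.mor u F" using forces_mono[OF F v(3)] mor[OF le_trans[OF v(1,3)]] by blast
    then show "\<exists>F'. M u F' G \<and> M u x F' \<and> sub u F' F"
      using G(3) le_trans[OF v(1,3)] E_mono[OF v(2,3)] v(4) by blast
  qed
qed

end

theorem theorem5p6:
  fixes A A' :: fm
  shows "CZF \<union> {NID} \<turnstile>
    (\<^bold>\<forall>P le Q le'.
       formal_space P le (class_rel A) \<^bold>\<and> set_presented P (class_rel A) \<^bold>\<and>
       formal_space Q le' (class_rel A') \<^bold>\<and> set_presented Q (class_rel A') \<^bold>\<longrightarrow>
       set_generated (\<lambda>F. morphism P le (class_rel A) Q le' (class_rel A') F)) 0"
proof (rule kripke_complete)
  fix le :: "fm set \<Rightarrow> fm set \<Rightarrow> bool" and M and E :: "fm set \<Rightarrow> nat \<Rightarrow> nat \<Rightarrow> bool" and w e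
  assume k: "kripke le M E" and e: "kripke.env E w e"
    and valid: "\<And>B w e. B \<in> CZF \<union> {NID} \<Longrightarrow> kripke.env E w e \<Longrightarrow> kripke.forces le M E w e B"
  interpret czf le M E
    using k valid by (simp add: czf_def czf_axioms_def)
  \<comment> \<open>Each of the four quantifiers and the implication may pass to a later world,
    hence the chain of five worlds through which the environment must persist.\<close>
  have env: "env w5 (l' ## Q ## l ## P ## e)"
    if "le w w1" "E w1 P P" "le w1 w2" "E w2 l l" "le w2 w3" "E w3 Q Q" "le w3 w4" "E w4 l' l'" "le w4 w5"
    for w1 w2 w3 w4 w5 P l Q l'
  proof -
    have "env w1 (P ## e)" using env_mono[OF e that(1)] that(2) by simp
    from env_mono[OF this that(3)] have "env w2 (l ## P ## e)" using that(4) by simp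
    from env_mono[OF this that(5)] have "env w3 (Q ## l ## P ## e)"
      using that(6) by simp
    from env_mono[OF this that(7)] have "env w4 (l' ## Q ## l ## P ## e)"
      using that(8) by simp
    then show ?thesis by (rule env_mono[OF _ that(9)])
  qed
  show "forces w e ((\<^bold>\<forall>P le Q le'.
       formal_space P le (class_rel A) \<^bold>\<and> set_presented P (class_rel A) \<^bold>\<and>
       formal_space Q le' (class_rel A') \<^bold>\<and> set_presented Q (class_rel A') \<^bold>\<longrightarrow>
       set_generated (\<lambda>F. morphism P le (class_rel A) Q le' (class_rel A') F)) 0)"
    unfolding forces_fAll forces_fImpl forces_fConj
    by (intro allI impI, elim conjE, rule set_generated_morphisms)
      ((rule env; assumption) | assumption | (simp; fail))+
qed

end
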